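(* Up to equivalence there are exactly $217$ unit-edge lattice polygons whose (counterclockwise) primitive edge vectors can be chosen with all coordinates in $[-2,2]$, excluding the standard triangle. They comprise: the unit square (whose cone is the ordinary double point; it is the unique terminal class, and it is smoothable); $8$ reduced-rigid classes; $79$ deformable-but-non-smoothable classes; and $129$ (further) smoothable classes. The $8$ reduced-rigid classes are, listed as $[k,i;\,E(Q)]$: \[ \begin{array}{l} [3,1;\,(-2,-1),(1,-1),(1,2)]\\ [4,1;\,(-2,-1),(0,-1),(1,0),(1,2)]\\ [4,2;\,(-2,-1),(2,-1),(1,2),(-1,0)]\\ [4,2;\,(-2,-1),(2,-1),(1,1),(-1,1)]\\ [5,2;\,(-2,-1),(2,-1),(1,1),(0,1),(-1,0)]\\ [5,3;\,(-2,-1),(-1,-1),(2,-1),(1,2),(0,1)]\\ [5,4;\,(-2,-1),(0,-1),(2,-1),(1,2),(-1,1)]\\ [6,5;\,(-2,-1),(-1,-1),(2,-1),(1,0),(1,2),(-1,1)] \end{array} \]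
   Context: A unit-edge polygon is a (two-dimensional convex) lattice polygon $Q\subset\mathbb{R}^2$, with lattice $\mathbb{Z}^2$, all of whose edges have lattice length one (i.e. its edge vectors are primitive). $E(Q)$ denotes the multiset of its edge vectors, listed counterclockwise; they sum to zero. $k$ is the number of edges and $i$ the number of interior lattice points. Two polygons are equivalent if they differ by an affine unimodular transformation ($\mathbb{Z}^2\rtimes GL_2(\mathbb{Z})$), equivalently if their edge multisets are $GL_2(\mathbb{Z})$-equivalent; so a class is counted if some representative has all edge vectors in $[-2,2]^2$. The standard triangle is the class of $\operatorname{conv}\{(0,0),(1,0),(0,1)\}$. For such $Q$, $C(Q)$ is the affine toric threefold of the cone over $Q$ placed at height one (an isolated Gorenstein canonical singularity when $Q$ is not a standard triangle). It is terminal iff $Q$ has no lattice points other than its vertices. Types of a unit-edge polygon $Q$ other than the standard triangle: - reduced-rigid (R): $E(Q)$ has no proper non-empty zero-sum sub-multiset (equivalently the reduced miniversal base of $C(Q)$ is a point); - deformable-but-non-smoothable (D): $E(Q)$ has a proper non-empty zero-sum sub-multiset, but admits no partition into pairs $\{v,-v\}$ and unimodular triples, i.e. triples $\{a,b,c\}$ with $a+b+c=0$ and $|\det(a,b)|=1$ (equivalently $C(Q)$ deforms non-trivially but is not smoothable); - smoothable (S): $E(Q)$ admits a partition into such pairs and unimodular triples (equivalently $C(Q)$ is smoothable). *)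

theory Defs
  imports
    "HOL-Analysis.Analysis"
    "HOL-Library.Multiset"
    "HOL-Library.Numeral_Type"
    "HOL-Library.Poly_Mapping"
begin

section \<open>Unit-edge lattice polygons\<close>

definition lattice2 :: "(real^2) set" where
  "lattice2 = {x. \<forall>j. x $ j \<in> \<int>}"

definition primitive_vec :: "real^2 \<Rightarrow> bool" where
  "primitive_vec v \<longleftrightarrow>
     (\<exists>a b :: int. v = vector [of_int a, of_int b] \<and> coprime a b)"

definition lattice_polygon :: "(real^2) set \<Rightarrow> bool" where
  "lattice_polygon Q \<longleftrightarrow>
     polytope Q \<and> aff_dim Q = 2 \<and> (\<forall>x. x extreme_point_of Q \<longrightarrow> x \<in> lattice2)"

text \<open>
  An edge with endpoints \<open>a\<close>, \<open>b\<close> is traversed counterclockwise as \<open>(a, b)\<close> precisely when the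
  polygon lies to the left of the line from \<open>a\<close> to \<open>b\<close>. For a polygon, every edge thus occurs with
  exactly one of its two orientations, and the set below is finite.
\<close>

definition oriented_edges :: "(real^2) set \<Rightarrow> ((real^2) \<times> (real^2)) set" where
  "oriented_edges Q =
     {(a, b). closed_segment a b edge_of Q \<and>
              (\<forall>x\<in>Q. 0 \<le> det (vector [b - a, x - a] :: real^2^2))}"

definition edge_vectors :: "(real^2) set \<Rightarrow> (real^2) multiset" where
  "edge_vectors Q = image_mset (\<lambda>(a, b). b - a) (mset_set (oriented_edges Q))"

definition unit_edge_polygon :: "(real^2) set \<Rightarrow> bool" where
  "unit_edge_polygon Q \<longleftrightarrow> lattice_polygon Q \<and> (\<forall>v\<in>#edge_vectors Q. primitive_vec v)"

definition num_edges :: "(real^2) set \<Rightarrow> nat" where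
  "num_edges Q = card {e. e edge_of Q}"

definition num_interior :: "(real^2) set \<Rightarrow> nat" where
  "num_interior Q = card (interior Q \<inter> lattice2)"

definition polygon_data :: "(real^2) set \<Rightarrow> nat \<times> nat \<times> (real^2) multiset" where
  "polygon_data Q = (num_edges Q, num_interior Q, edge_vectors Q)"


section \<open>Affine unimodular equivalence\<close>

definition unimodular_equiv :: "((real^2) set \<times> (real^2) set) set" where
  "unimodular_equiv =
     {(P, Q). \<exists>(M :: real^2^2) t.
        (\<forall>i j. M $ i $ j \<in> \<int>) \<and> \<bar>det M\<bar> = 1 \<and> t \<in> lattice2 \<and>
        Q = (\<lambda>x. M *v x + t) ` P}"

definition classes :: "(real^2) set set \<Rightarrow> (real^2) set set set" where
  "classes \<Q> = \<Q> // unimodular_equiv"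

definition standard_triangle :: "(real^2) set" where
  "standard_triangle = convex hull {vector [0, 0], vector [1, 0], vector [0, 1]}"

definition unit_square :: "(real^2) set" where
  "unit_square =
     convex hull {vector [0, 0], vector [1, 0], vector [1, 1], vector [0, 1]}"

definition small_polygons :: "(real^2) set set" where
  "small_polygons =
     {Q. unit_edge_polygon Q \<and> (Q, standard_triangle) \<notin> unimodular_equiv \<and>
         (\<exists>Q'. unit_edge_polygon Q' \<and> (Q, Q') \<in> unimodular_equiv \<and>
               (\<forall>v\<in>#edge_vectors Q'. \<forall>j. -2 \<le> v $ j \<and> v $ j \<le> 2))}"


section \<open>Types of polygons\<close>

definition has_zero_sum_part :: "(real^2) multiset \<Rightarrow> bool" where
  "has_zero_sum_part E \<longleftrightarrow> (\<exists>F. F \<subset># E \<and> F \<noteq> {#} \<and> \<Sum>\<^sub># F = 0)"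

definition opposite_pair :: "(real^2) multiset \<Rightarrow> bool" where
  "opposite_pair B \<longleftrightarrow> (\<exists>v. B = {#v, - v#})"

definition unimodular_triple :: "(real^2) multiset \<Rightarrow> bool" where
  "unimodular_triple B \<longleftrightarrow>
     (\<exists>a b c. B = {#a, b, c#} \<and> a + b + c = 0 \<and> \<bar>det (vector [a, b] :: real^2^2)\<bar> = 1)"

definition has_smoothing_partition :: "(real^2) multiset \<Rightarrow> bool" where
  "has_smoothing_partition E \<longleftrightarrow>
     (\<exists>\<P>. \<Sum>\<^sub># \<P> = E \<and> (\<forall>B\<in>#\<P>. opposite_pair B \<or> unimodular_triple B))"

definition reduced_rigid :: "(real^2) set \<Rightarrow> bool" where
  "reduced_rigid Q \<longleftrightarrow> \<not> has_zero_sum_part (edge_vectors Q)"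

definition deformable_non_smoothable :: "(real^2) set \<Rightarrow> bool" where
  "deformable_non_smoothable Q \<longleftrightarrow>
     has_zero_sum_part (edge_vectors Q) \<and> \<not> has_smoothing_partition (edge_vectors Q)"

definition smoothable :: "(real^2) set \<Rightarrow> bool" where
  "smoothable Q \<longleftrightarrow> has_smoothing_partition (edge_vectors Q)"


section \<open>The affine toric threefold of a polygon\<close>

definition lattice3 :: "((real^2) \<times> real) set" where
  "lattice3 = lattice2 \<times> \<int>"

definition toric_cone :: "(real^2) set \<Rightarrow> ((real^2) \<times> real) set" where
  "toric_cone Q = cone hull (Q \<times> {1})"

text \<open>
  The canonical divisor is given by the linear form \<open>snd\<close> (the height), so the toric exceptional
  divisor of a primitive lattice vector \<open>u\<close> of the cone, not a ray generator, has discrepancy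
  \<open>snd u - 1\<close>. Terminality asks all of these to be positive; multiples of a primitive vector may be
  included, since their height is at least 2.
\<close>

definition terminal_cone :: "(real^2) set \<Rightarrow> bool" where
  "terminal_cone Q \<longleftrightarrow>
     (\<forall>u \<in> toric_cone Q \<inter> lattice3.
        u \<noteq> 0 \<and> u \<notin> {(v, 1) |v. v extreme_point_of Q} \<longrightarrow> snd u - 1 > 0)"

lemma terminal_cone_iff:
  "terminal_cone Q \<longleftrightarrow> (\<forall>x \<in> Q \<inter> lattice2. x extreme_point_of Q)"
proof
  assume t: "terminal_cone Q"
  show "\<forall>x \<in> Q \<inter> lattice2. x extreme_point_of Q"
  proof (intro ballI, rule ccontr)
    fix x assume x: "x \<in> Q \<inter> lattice2" and n: "\<not> x extreme_point_of Q"
    have "(x, 1) \<in> toric_cone Q"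
      unfolding toric_cone_def by (rule hull_inc) (use x in simp)
    moreover have "(x, 1) \<in> lattice3"
      using x by (simp add: lattice3_def)
    ultimately have "(x, 1) \<in> toric_cone Q \<inter> lattice3"
      by simp
    moreover have "(x, 1 :: real) \<noteq> 0 \<and> (x, 1 :: real) \<notin> {(v, 1) |v. v extreme_point_of Q}"
      using n by (simp add: zero_prod_def)
    ultimately have "snd (x, 1 :: real) - 1 > 0"
      using t unfolding terminal_cone_def by blast
    then show False by simp
  qed
next
  assume v: "\<forall>x \<in> Q \<inter> lattice2. x extreme_point_of Q"
  show "terminal_cone Q"
    unfolding terminal_cone_def
  proof (intro ballI impI)
    fix u assume u: "u \<in> toric_cone Q \<inter> lattice3"
      and n: "u \<noteq> 0 \<and> u \<notin> {(v, 1) |v. v extreme_point_of Q}"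
    from u obtain c x where c: "c \<ge> 0" "x \<in> Q" "u = (c *\<^sub>R x, c)"
      unfolding toric_cone_def cone_hull_expl by auto
    have l: "c *\<^sub>R x \<in> lattice2" "c \<in> \<int>"
      using u c(3) by (simp_all add: lattice3_def)
    from l(2) obtain k :: int where k: "c = of_int k"
      by (rule Ints_cases)
    have "c \<noteq> 0" using n c(3) by (auto simp: zero_prod_def)
    moreover have "c \<noteq> 1"
    proof
      assume "c = 1"
      with l(1) c(2) v have "x extreme_point_of Q" by simp
      with n c(3) \<open>c = 1\<close> show False by simp
    qed
    ultimately have "k \<noteq> 0" "k \<noteq> 1" "k \<ge> 0" using c(1) k by simp_all
    then have "k > 1" by linarith
    then show "snd u - 1 > 0" using c(3) k by simp
  qed
qed

text \<open>
  The coordinate ring of the toric threefold is the monoid algebra of the lattice points of the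
  dual cone, realised inside the monoid algebra of the ambient space: monomials are exponent
  vectors, and multiplication of finitely supported functions is convolution.
\<close>

definition coordinate_ring :: "(real^2) set \<Rightarrow> (((real^2) \<times> real) \<Rightarrow>\<^sub>0 complex) set" where
  "coordinate_ring Q =
     {f. Poly_Mapping.keys f \<subseteq> {m \<in> lattice3. \<forall>u\<in>toric_cone Q. 0 \<le> m \<bullet> u}}"

definition poly_var :: "4 \<Rightarrow> (4 \<Rightarrow>\<^sub>0 nat) \<Rightarrow>\<^sub>0 complex" where
  "poly_var j = Poly_Mapping.single (Poly_Mapping.single j 1) 1"

text \<open>
  The ordinary double point is \<open>xy = zw\<close> in affine four-space: the coordinate ring is required to
  be isomorphic, as a complex algebra, to the polynomial ring in four variables modulo \<open>xy - zw\<close>.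
\<close>

definition cone_is_ordinary_double_point :: "(real^2) set \<Rightarrow> bool" where
  "cone_is_ordinary_double_point Q \<longleftrightarrow>
     (\<exists>\<phi> :: ((4 \<Rightarrow>\<^sub>0 nat) \<Rightarrow>\<^sub>0 complex) \<Rightarrow> (((real^2) \<times> real) \<Rightarrow>\<^sub>0 complex).
        (\<forall>p q. \<phi> (p + q) = \<phi> p + \<phi> q) \<and>
        (\<forall>p q. \<phi> (p * q) = \<phi> p * \<phi> q) \<and>
        (\<forall>c. \<phi> (Poly_Mapping.single 0 c) = Poly_Mapping.single 0 c) \<and>
        range \<phi> = coordinate_ring Q \<and>
        (\<forall>p. \<phi> p = 0 \<longleftrightarrow> poly_var 0 * poly_var 1 - poly_var 2 * poly_var 3 dvd p))"

end

theory Submission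
  imports Defs
begin

text \<open>
  The classification is reduced to a finite computation on sets of integer vectors, and the
  computation is then carried out by rewriting.

  The reduction rests on the theorem of Minkowski for polygons. Every vertex of a polygon starts
  one oriented edge and ends one, so the edge vectors sum to zero (\<open>sum_edge_set_eq_0\<close>); they have
  distinct directions, because the direction of an edge determines the face it lies in. Sorted by
  angle, consecutive edge vectors belong to consecutive edges, so the vertices are the partial
  sums of the sorted edge vectors up to a translation (\<open>polygon_eq_translate_of_chain_hull\<close>).
  Conversely, the partial sums of any zero-sum set of vectors with distinct directions, not all
  parallel, are the vertices of a polygon with these edges (\<open>edge_set_chain_hull\<close>). Consequently
  two lattice polygons are equivalent exactly if a unimodular matrix carries one edge set to the
  other (\<open>unimodular_equiv_iff_edge_set\<close>), and classes of small unit-edge polygons correspond to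
  orbits of zero-sum sets, with at least three members, of the 16 primitive vectors with
  coordinates in \<open>[-2, 2]\<close>.

  The orbits are counted with a table of 218 representatives, the first being the standard
  triangle. That the table is complete is checked by enumerating all zero-sum sets and finding for
  each a matrix that carries it to a representative (\<open>enumeration_matched\<close>). That no two entries
  are equivalent follows from an integer invariant of edge sets, the \<open>moment\<close>, which increases
  strictly along the table (\<open>representatives_moments\<close>). The types depend only on the edge set and
  are invariant under unimodular maps; they are decided for each representative by a search that
  is proved correct (\<open>is_rigid_iff\<close>, \<open>has_block_partition_iff\<close>).

  Terminality means that all lattice points are vertices. All representatives but the triangle and
  the square have an interior lattice point (\<open>representatives_contain_point\<close>), whereas the lattice
  points of the square are its corners. Finally, the dual cone of the unit square is generated by
  four lattice points with the single relation that two of them have the same sum as the other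
  two; hence the coordinate ring is the polynomial ring modulo \<open>xy - zw\<close>
  (\<open>unit_square_ordinary_double_point\<close>).
\<close>

section \<open>Oriented edges of a polygon\<close>

definition det2 :: "real^2 \<Rightarrow> real^2 \<Rightarrow> real" where
  "det2 u v = u $ 1 * v $ 2 - u $ 2 * v $ 1"

lemma det_vector_eq_det2: "det (vector [u, v] :: real^2^2) = det2 u v"
  by (simp add: det_2 det2_def)

lemma det2_simps [simp]:
  "det2 (u + u') v = det2 u v + det2 u' v" "det2 u (v + v') = det2 u v + det2 u v'"
  "det2 (u - u') v = det2 u v - det2 u' v" "det2 u (v - v') = det2 u v - det2 u v'"
  "det2 (c *\<^sub>R u) v = c * det2 u v" "det2 u (c *\<^sub>R v) = c * det2 u v"
  "det2 (- u) v = - det2 u v" "det2 u (- v) = - det2 u v"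
  "det2 u u = 0" "det2 0 v = 0" "det2 u 0 = 0"
  by (simp_all add: det2_def algebra_simps)

lemma det2_sum_right: "det2 u (\<Sum>i\<in>I. f i) = (\<Sum>i\<in>I. det2 u (f i))"
  by (induction I rule: infinite_finite_induct) auto

lemma det2_commute: "det2 u v = - det2 v u"
  by (simp add: det2_def)

definition perp :: "real^2 \<Rightarrow> real^2" where
  "perp u = vector [- (u $ 2), u $ 1]"

lemma det2_inner: "det2 u v = perp u \<bullet> v"
  by (simp add: det2_def perp_def inner_vec_def sum_2)

lemma perp_eq_0 [simp]: "perp u = 0 \<longleftrightarrow> u = 0"
  by (simp add: perp_def vec_eq_iff forall_2 conj_commute)

lemma det2_eq_0_imp_scale:
  assumes "det2 u v = 0" "u \<noteq> 0"
  obtains c where "v = c *\<^sub>R u"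
proof (cases "u $ 1 = 0")
  case True
  then have "u $ 2 \<noteq> 0" using assms(2) by (auto simp: vec_eq_iff forall_2)
  then show ?thesis using assms(1) True
    by (intro that[of "v $ 2 / u $ 2"]) (auto simp: vec_eq_iff forall_2 det2_def)
next
  case False
  then show ?thesis using assms(1)
    by (intro that[of "v $ 1 / u $ 1"]) (auto simp: vec_eq_iff forall_2 det2_def field_simps)
qed

definition polygon :: "(real^2) set \<Rightarrow> bool" where
  "polygon Q \<longleftrightarrow> polytope Q \<and> aff_dim Q = 2"

lemma polygonD:
  assumes "polygon Q"
  shows "convex Q" "compact Q" "polyhedron Q" "Q \<noteq> {}"
    "Q = convex hull {v. v extreme_point_of Q}" "finite {v. v extreme_point_of Q}"
proof -
  have "polytope Q" "aff_dim Q = 2" using assms by (auto simp: polygon_def)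
  then show "convex Q" "compact Q" "polyhedron Q" "Q \<noteq> {}"
    by (auto simp: polytope_imp_convex polytope_imp_compact polytope_imp_polyhedron)
  then show "Q = convex hull {v. v extreme_point_of Q}" "finite {v. v extreme_point_of Q}"
    using Krein_Milman_Minkowski[of Q] finite_polyhedron_extreme_points[of Q] by blast+
qed

lemma polygon_not_in_line:
  assumes "polygon Q" "u \<noteq> 0" "\<And>x. x \<in> Q \<Longrightarrow> det2 u x = k"
  shows False
proof -
  have "aff_dim Q \<le> aff_dim {x. perp u \<bullet> x = k}"
    by (rule aff_dim_subset) (use assms in \<open>auto simp: det2_inner\<close>)
  then show False using assms(1,2) by (simp add: polygon_def)
qed

lemma oriented_edgeD:
  assumes "(a, b) \<in> oriented_edges Q"
  shows "a \<noteq> b" "a \<in> Q" "b \<in> Q" "closed_segment a b edge_of Q"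
    "closed_segment a b face_of Q" "\<And>x. x \<in> Q \<Longrightarrow> det2 (b - a) x \<ge> det2 (b - a) a"
proof -
  show e: "closed_segment a b edge_of Q"
    using assms by (auto simp: oriented_edges_def)
  then show f: "closed_segment a b face_of Q" by (simp add: edge_of_def)
  show "a \<noteq> b" using e by (auto simp: edge_of_def)
  show "a \<in> Q" "b \<in> Q" using face_of_imp_subset[OF f] by auto
  show "det2 (b - a) x \<ge> det2 (b - a) a" if "x \<in> Q" for x
    using assms that by (auto simp: oriented_edges_def det_vector_eq_det2)
qed

lemma oriented_edge_extreme:
  assumes "(a, b) \<in> oriented_edges Q"
  shows "a extreme_point_of Q" "b extreme_point_of Q"
  using extreme_point_of_face[OF oriented_edgeD(5)[OF assms]] extreme_point_of_segment
  by blast+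

lemma line_face_le:
  assumes "polygon Q" "u \<noteq> 0" "\<And>x. x \<in> Q \<Longrightarrow> k \<le> det2 u x"
  shows "Q \<inter> {x. det2 u x = k} face_of Q" "aff_dim (Q \<inter> {x. det2 u x = k}) \<le> 1"
proof -
  show "Q \<inter> {x. det2 u x = k} face_of Q"
    unfolding det2_inner
    by (rule face_of_Int_supporting_hyperplane_ge) (use assms polygonD in \<open>auto simp: det2_inner\<close>)
  have "aff_dim (Q \<inter> {x. det2 u x = k}) \<le> aff_dim {x. perp u \<bullet> x = k}"
    by (rule aff_dim_subset) (auto simp: det2_inner)
  then show "aff_dim (Q \<inter> {x. det2 u x = k}) \<le> 1" using assms(2) by simp
qed

text \<open>
  An edge is the whole face that its direction cuts out: that face lies in a line, so it cannot be
  larger than the edge without raising the dimension. Hence the direction of an oriented edge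
  determines the edge, and the edge vectors of a polygon form a set.
\<close>

lemma oriented_edge_eq_line_face:
  assumes Q: "polygon Q" and ab: "(a, b) \<in> oriented_edges Q"
  shows "closed_segment a b = Q \<inter> {x. det2 (b - a) x = det2 (b - a) a}" (is "?S = ?F")
proof (rule ccontr)
  assume ne: "?S \<noteq> ?F"
  have u: "b - a \<noteq> 0" using oriented_edgeD(1)[OF ab] by simp
  note F = line_face_le[OF Q u oriented_edgeD(6)[OF ab]]
  have sub: "?S \<subseteq> ?F"
  proof
    fix x assume x: "x \<in> ?S"
    then obtain t where t: "x = (1 - t) *\<^sub>R a + t *\<^sub>R b" by (auto simp: closed_segment_def)
    have "det2 (b - a) x = det2 (b - a) a"
      unfolding t by (simp add: det2_def algebra_simps)
    moreover have "x \<in> Q" using x oriented_edgeD(5)[OF ab] face_of_imp_subset by blast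
    ultimately show "x \<in> ?F" by simp
  qed
  then have "?S face_of ?F"
    using face_of_subset[OF oriented_edgeD(5)[OF ab]] by blast
  then have "aff_dim ?S < aff_dim ?F"
    using ne F(1) face_of_imp_convex by (intro face_of_aff_dim_lt) blast+
  then show False
    using F(2) oriented_edgeD(4)[OF ab] by (simp add: edge_of_def)
qed

lemma oriented_edge_direction_unique:
  assumes Q: "polygon Q" and ab: "(a, b) \<in> oriented_edges Q" and ab': "(a', b') \<in> oriented_edges Q"
    and par: "b' - a' = c *\<^sub>R (b - a)" "c > 0"
  shows "a' = a \<and> b' = b"
proof -
  have "det2 (b - a) a' \<ge> det2 (b - a) a"
    using oriented_edgeD(2)[OF ab'] oriented_edgeD(6)[OF ab] by blast
  moreover have "det2 (b' - a') a \<ge> det2 (b' - a') a'"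
    using oriented_edgeD(2)[OF ab] oriented_edgeD(6)[OF ab'] by blast
  then have "c * det2 (b - a) a \<ge> c * det2 (b - a) a'" unfolding par(1) by simp
  then have "det2 (b - a) a \<ge> det2 (b - a) a'" using par(2) mult_le_cancel_left_pos by blast
  ultimately have eq: "det2 (b - a) a' = det2 (b - a) a" by simp
  have "closed_segment a' b' = Q \<inter> {x. det2 (b' - a') x = det2 (b' - a') a'}"
    by (rule oriented_edge_eq_line_face[OF Q ab'])
  also have "\<dots> = Q \<inter> {x. c * det2 (b - a) x = c * det2 (b - a) a'}"
    unfolding par(1) by (simp only: det2_simps)
  also have "\<dots> = closed_segment a b"
    using par(2) eq oriented_edge_eq_line_face[OF Q ab] by auto
  finally have "{a', b'} = {a, b}" by (simp add: closed_segment_eq)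
  then consider "a' = a \<and> b' = b" | "a' = b" "b' = a" by (auto simp: doubleton_eq_iff)
  then show ?thesis
  proof cases
    case 2
    then have "(1 + c) *\<^sub>R (b - a) = 0" using par(1) by (simp add: algebra_simps)
    then show ?thesis using par(2) oriented_edgeD(1)[OF ab] by auto
  qed
qed

text \<open>
  If a line through the vertex \<open>v\<close> and another point supports the polygon, then the polygon meets
  that line in an edge, and \<open>v\<close> is an end of it. The sign \<open>s\<close> tells on which side the polygon
  lies, so that outgoing and incoming edges are treated at once.
\<close>

lemma supporting_line_edge:
  assumes Q: "polygon Q" and v: "v extreme_point_of Q" and w: "w \<in> Q" "w \<noteq> v"
    and s: "s = 1 \<or> s = (-1 :: real)"
    and supp: "\<And>x. x \<in> Q \<Longrightarrow> 0 \<le> s * det2 (w - v) (x - v)"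
  obtains b where "closed_segment v b edge_of Q" "\<And>x. x \<in> Q \<Longrightarrow> 0 \<le> s * det2 (b - v) (x - v)"
proof -
  let ?u = "s *\<^sub>R (w - v)"
  let ?F = "Q \<inter> {x. det2 ?u x = det2 ?u v}"
  have u: "?u \<noteq> 0" using w(2) s by auto
  have "det2 ?u v \<le> det2 ?u x" if "x \<in> Q" for x
    using supp[OF that] by (simp add: algebra_simps)
  note F = line_face_le[OF Q u this]
  have vQ: "v \<in> Q" using v by (simp add: extreme_point_of_def)
  have vw: "v \<in> ?F" "w \<in> ?F"
    using vQ w(1) det2_commute[of v w] by (auto simp: algebra_simps)
  have "collinear ?F" using F(2) by (simp add: collinear_aff_dim)
  moreover have "compact ?F" "convex ?F"
    using face_of_imp_compact[OF polygonD(1,2)[OF Q] F(1)] face_of_imp_convex[OF F(1)] by blast+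
  ultimately obtain c d where cd: "?F = closed_segment c d"
    using vw(1) compact_convex_collinear_segment[of ?F] by blast
  have "v extreme_point_of ?F"
    using extreme_point_of_face[OF F(1)] v vw(1) by blast
  then have "v = c \<or> v = d" unfolding cd by (simp add: extreme_point_of_segment)
  then obtain b where b: "?F = closed_segment v b"
    using cd closed_segment_commute by metis
  have "b \<noteq> v" using b vw(2) w(2) by auto
  then have "aff_dim (closed_segment v b) = 1"
    by (simp add: segment_convex_hull aff_dim_convex_hull aff_dim_2)
  then have "closed_segment v b edge_of Q"
    using F(1) unfolding b edge_of_def by blast
  moreover obtain t where t: "0 \<le> t" "w - v = t *\<^sub>R (b - v)"
    using vw(2) unfolding b by (auto simp: closed_segment_def algebra_simps)
  have "t > 0" using t w(2) by (cases "t = 0") auto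
  have "0 \<le> s * det2 (b - v) (x - v)" if "x \<in> Q" for x
  proof -
    have "0 \<le> t * (s * det2 (b - v) (x - v))"
      using supp[OF that] unfolding t(2) by (simp add: algebra_simps)
    then show ?thesis using \<open>t > 0\<close> by (simp add: zero_le_mult_iff)
  qed
  ultimately show ?thesis using that by blast
qed

text \<open>
  The vertex \<open>v\<close> can be separated strictly from the hull of the other vertices by a functional
  \<open>c\<close>. Seen from \<open>v\<close>, all other vertices then lie in an open half plane, where directions are
  compared by their slope with respect to \<open>c\<close>; the vertex of extreme slope spans the supporting
  line.
\<close>

lemma extreme_point_supporting_line:
  assumes Q: "polygon Q" and v: "v extreme_point_of Q" and s: "s = 1 \<or> s = (-1 :: real)"
  obtains w where "w \<in> Q" "w \<noteq> v" "\<And>x. x \<in> Q \<Longrightarrow> 0 \<le> s * det2 (w - v) (x - v)"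
proof -
  define W where "W = {w. w extreme_point_of Q} - {v}"
  have finW: "finite W" and hullQ: "Q = convex hull (insert v W)"
    using polygonD(5,6)[OF Q] v by (auto simp: W_def insert_absorb)
  have WQ: "W \<subseteq> Q" by (auto simp: W_def extreme_point_of_def)
  have "W \<noteq> {}"
  proof
    assume "W = {}"
    then have "aff_dim Q = 0" using hullQ by simp
    then show False using Q by (simp add: polygon_def)
  qed
  have "v \<notin> convex hull W"
  proof
    assume v': "v \<in> convex hull W"
    have "convex hull W \<subseteq> Q" using WQ polygonD(1)[OF Q] by (simp add: subset_hull)
    then have "v extreme_point_of convex hull W"
      using v v' unfolding extreme_point_of_def by blast
    then show False using extreme_point_of_convex_hull by (auto simp: W_def)
  qed
  then obtain c r where c: "c \<bullet> v < r" "\<And>x. x \<in> convex hull W \<Longrightarrow> c \<bullet> x > r"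
    using separating_hyperplane_closed_point[of "convex hull W" v] finW
      finite_imp_compact_convex_hull compact_imp_closed by (metis convex_convex_hull)
  have cW: "c \<bullet> (x - v) > 0" if "x \<in> W" for x
    using c(1) c(2)[OF hull_inc[OF that]] by (simp add: inner_diff_right)
  define q where "q x = s * det2 c (x - v) / (c \<bullet> (x - v))" for x
  have "Min (q ` W) \<in> q ` W" using finW \<open>W \<noteq> {}\<close> by (intro Min_in) auto
  then obtain w where w: "w \<in> W" and qw: "q w = Min (q ` W)" by auto
  have "c \<noteq> 0" using cW[OF w] by auto
  have main: "0 \<le> s * det2 (w - v) (x - v)" if x: "x \<in> W" for x
  proof -
    have "q w \<le> q x" using qw x finW by simp
    then have "s * det2 c (w - v) * (c \<bullet> (x - v)) \<le> s * det2 c (x - v) * (c \<bullet> (w - v))"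
      using cW[OF x] cW[OF w] by (simp add: q_def field_simps)
    moreover have "(c \<bullet> (w - v)) * det2 c (x - v) - det2 c (w - v) * (c \<bullet> (x - v))
        = (c \<bullet> c) * det2 (w - v) (x - v)"
      by (simp add: det2_def inner_vec_def sum_2 algebra_simps)
    then have "s * det2 c (x - v) * (c \<bullet> (w - v)) - s * det2 c (w - v) * (c \<bullet> (x - v))
        = (c \<bullet> c) * (s * det2 (w - v) (x - v))"
      by (metis (no_types, opaque_lifting) mult.assoc mult.commute right_diff_distrib)
    ultimately have "0 \<le> (c \<bullet> c) * (s * det2 (w - v) (x - v))" by linarith
    moreover have "c \<bullet> c > 0" using \<open>c \<noteq> 0\<close> by simp
    ultimately show ?thesis using zero_le_mult_iff[of "c \<bullet> c" "s * det2 (w - v) (x - v)"] by linarith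
  qed
  have "insert v W \<subseteq> {x. 0 \<le> perp (s *\<^sub>R (w - v)) \<bullet> x - perp (s *\<^sub>R (w - v)) \<bullet> v}"
    using main by (auto simp flip: det2_inner simp: algebra_simps)
  also have "\<dots> = {x. perp (s *\<^sub>R (w - v)) \<bullet> x \<ge> perp (s *\<^sub>R (w - v)) \<bullet> v}" by auto
  finally have "Q \<subseteq> {x. perp (s *\<^sub>R (w - v)) \<bullet> x \<ge> perp (s *\<^sub>R (w - v)) \<bullet> v}"
    unfolding hullQ by (rule hull_minimal) (rule convex_halfspace_ge)
  then have "0 \<le> s * det2 (w - v) (x - v)" if "x \<in> Q" for x
    using that by (auto simp flip: det2_inner simp: algebra_simps)
  moreover have "w \<in> Q" "w \<noteq> v" using w WQ by (auto simp: W_def)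
  ultimately show ?thesis using that by blast
qed

lemma outgoing_edge_exists:
  assumes Q: "polygon Q" and v: "v extreme_point_of Q"
  obtains b where "(v, b) \<in> oriented_edges Q"
proof -
  obtain w where w: "w \<in> Q" "w \<noteq> v" "\<And>x. x \<in> Q \<Longrightarrow> 0 \<le> 1 * det2 (w - v) (x - v)"
    using extreme_point_supporting_line[OF Q v, of 1] by blast
  obtain b where "closed_segment v b edge_of Q" "\<And>x. x \<in> Q \<Longrightarrow> 0 \<le> 1 * det2 (b - v) (x - v)"
    using supporting_line_edge[OF Q v w(1,2) _ w(3)] by blast
  then have "(v, b) \<in> oriented_edges Q"
    unfolding oriented_edges_def det_vector_eq_det2 by simp
  then show ?thesis using that by blast
qed

lemma incoming_edge_exists:
  assumes Q: "polygon Q" and v: "v extreme_point_of Q"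
  obtains a where "(a, v) \<in> oriented_edges Q"
proof -
  obtain w where w: "w \<in> Q" "w \<noteq> v" "\<And>x. x \<in> Q \<Longrightarrow> 0 \<le> -1 * det2 (w - v) (x - v)"
    using extreme_point_supporting_line[OF Q v, of "-1"] by blast
  obtain a where a: "closed_segment v a edge_of Q" "\<And>x. x \<in> Q \<Longrightarrow> 0 \<le> -1 * det2 (a - v) (x - v)"
    using supporting_line_edge[OF Q v w(1,2) _ w(3)] by blast
  have "0 \<le> det2 (v - a) (x - a)" if "x \<in> Q" for x
    using a(2)[OF that] det2_commute[of a v] by (simp add: algebra_simps)
  then have "(a, v) \<in> oriented_edges Q"
    unfolding oriented_edges_def det_vector_eq_det2
    using a(1) by (simp add: closed_segment_commute)
  then show ?thesis using that by blast
qed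

text \<open>
  Both uniqueness statements below come down to this: a polygon is not squeezed between two
  opposite half planes with a common boundary.
\<close>

lemma opposite_supports_False:
  assumes Q: "polygon Q" and u: "u \<noteq> 0" and c: "c < 0"
    and s1: "\<And>x. x \<in> Q \<Longrightarrow> det2 u x \<ge> det2 u v"
    and s2: "\<And>x. x \<in> Q \<Longrightarrow> det2 (c *\<^sub>R u) x \<ge> det2 (c *\<^sub>R u) v"
  shows False
proof (rule polygon_not_in_line[OF Q u])
  fix x assume x: "x \<in> Q"
  have "c * det2 u x \<ge> c * det2 u v" using s2[OF x] by simp
  then have "det2 u x \<le> det2 u v" using c mult_le_cancel_left_neg by blast
  then show "det2 u x = det2 u v" using s1[OF x] by simp
qed

lemma oriented_edge_left_of_end:
  assumes "(a, b) \<in> oriented_edges Q" "x \<in> Q"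
  shows "det2 (b - a) x \<ge> det2 (b - a) b"
  using oriented_edgeD(6)[OF assms] det2_commute[of a b] by simp

lemma outgoing_edge_unique:
  assumes Q: "polygon Q" and b: "(v, b) \<in> oriented_edges Q" and b': "(v, b') \<in> oriented_edges Q"
  shows "b' = b"
proof -
  let ?u = "b - v" and ?u' = "b' - v"
  have "det2 ?u ?u' \<ge> 0" using oriented_edgeD(6)[OF b oriented_edgeD(3)[OF b']] by simp
  moreover have "det2 ?u' ?u \<ge> 0" using oriented_edgeD(6)[OF b' oriented_edgeD(3)[OF b]] by simp
  ultimately have "det2 ?u ?u' = 0" using det2_commute[of ?u ?u'] by linarith
  moreover have u: "?u \<noteq> 0" "?u' \<noteq> 0" using oriented_edgeD(1) b b' by force+
  ultimately obtain c where c: "?u' = c *\<^sub>R ?u" using det2_eq_0_imp_scale by blast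
  have "c \<noteq> 0" using c u(2) by auto
  moreover have "\<not> c < 0"
    using opposite_supports_False[OF Q u(1), of c v] oriented_edgeD(6)[OF b]
      oriented_edgeD(6)[OF b'] unfolding c by blast
  ultimately show ?thesis
    using oriented_edge_direction_unique[OF Q b b' c] by linarith
qed

lemma incoming_edge_unique:
  assumes Q: "polygon Q" and a: "(a, v) \<in> oriented_edges Q" and a': "(a', v) \<in> oriented_edges Q"
  shows "a' = a"
proof -
  let ?u = "v - a" and ?u' = "v - a'"
  have "det2 ?u (v - a') \<le> 0" using oriented_edge_left_of_end[OF a oriented_edgeD(2)[OF a']] by simp
  moreover have "det2 ?u' ?u \<le> 0" using oriented_edge_left_of_end[OF a' oriented_edgeD(2)[OF a]] by simp
  ultimately have "det2 ?u ?u' = 0" using det2_commute[of ?u ?u'] by linarith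
  moreover have u: "?u \<noteq> 0" "?u' \<noteq> 0" using oriented_edgeD(1) a a' by force+
  ultimately obtain c where c: "?u' = c *\<^sub>R ?u" using det2_eq_0_imp_scale by blast
  have "c \<noteq> 0" using c u(2) by auto
  moreover have "\<not> c < 0"
    using opposite_supports_False[OF Q u(1), of c v] oriented_edge_left_of_end[OF a]
      oriented_edge_left_of_end[OF a'] unfolding c by blast
  ultimately show ?thesis
    using oriented_edge_direction_unique[OF Q a a' c] by linarith
qed

text \<open>
  Every vertex starts exactly one edge and ends exactly one edge. This replaces an explicit
  description of the boundary as a closed path, and makes the edge vectors sum to zero.
\<close>

lemma bij_betw_edge_start:
  assumes Q: "polygon Q"
  shows "bij_betw fst (oriented_edges Q) {v. v extreme_point_of Q}"
proof (rule bij_betw_imageI)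
  show "inj_on fst (oriented_edges Q)"
    unfolding inj_on_def using outgoing_edge_unique[OF Q] by fastforce
  show "fst ` oriented_edges Q = {v. v extreme_point_of Q}"
    
  proof safe
    fix v assume "v extreme_point_of Q"
    then obtain b where "(v, b) \<in> oriented_edges Q" using outgoing_edge_exists[OF Q] by metis
    then show "v \<in> fst ` oriented_edges Q" by force
  qed (simp add: oriented_edge_extreme(1))
qed

lemma bij_betw_edge_end:
  assumes Q: "polygon Q"
  shows "bij_betw snd (oriented_edges Q) {v. v extreme_point_of Q}"
proof (rule bij_betw_imageI)
  show "inj_on snd (oriented_edges Q)"
    unfolding inj_on_def using incoming_edge_unique[OF Q] by fastforce
  show "snd ` oriented_edges Q = {v. v extreme_point_of Q}"
    
  proof safe
    fix v assume "v extreme_point_of Q"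
    then obtain a where "(a, v) \<in> oriented_edges Q" using incoming_edge_exists[OF Q] by metis
    then show "v \<in> snd ` oriented_edges Q" by force
  qed (simp add: oriented_edge_extreme(2))
qed

definition edge_set :: "(real^2) set \<Rightarrow> (real^2) set" where
  "edge_set Q = (\<lambda>(a, b). b - a) ` oriented_edges Q"

lemma finite_oriented_edges: "polygon Q \<Longrightarrow> finite (oriented_edges Q)"
  using bij_betw_finite[OF bij_betw_edge_start] polygonD(6) by blast

lemma oriented_edge_vector_unique:
  "polygon Q \<Longrightarrow> (a, b) \<in> oriented_edges Q \<Longrightarrow> (a', b') \<in> oriented_edges Q \<Longrightarrow> b' - a' = b - a
    \<Longrightarrow> a' = a \<and> b' = b"
  by (rule oriented_edge_direction_unique[where c = 1]) simp_all

lemma inj_on_edge_vector: "polygon Q \<Longrightarrow> inj_on (\<lambda>(a, b). b - a) (oriented_edges Q)"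
  unfolding inj_on_def using oriented_edge_vector_unique by fastforce

lemma edge_vectors_eq_mset_set: "polygon Q \<Longrightarrow> edge_vectors Q = mset_set (edge_set Q)"
  unfolding edge_vectors_def edge_set_def
  by (rule image_mset_mset_set) (rule inj_on_edge_vector)

lemma finite_edge_set: "polygon Q \<Longrightarrow> finite (edge_set Q)"
  by (simp add: edge_set_def finite_oriented_edges)

lemma card_edge_set:
  assumes "polygon Q"
  shows "card (edge_set Q) = card {v. v extreme_point_of Q}"
  using card_image[OF inj_on_edge_vector[OF assms]] bij_betw_same_card[OF bij_betw_edge_start[OF assms]]
  by (simp add: edge_set_def)

lemma sum_edge_set_eq_0:
  assumes Q: "polygon Q"
  shows "\<Sum>(edge_set Q) = 0"
proof -
  have "\<Sum>(edge_set Q) = (\<Sum>e\<in>oriented_edges Q. snd e - fst e)"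
    unfolding edge_set_def
    by (subst sum.reindex[OF inj_on_edge_vector[OF Q]]) (simp add: case_prod_unfold)
  also have "\<dots> = \<Sum>{v. v extreme_point_of Q} - \<Sum>{v. v extreme_point_of Q}"
    using sum.reindex_bij_betw[OF bij_betw_edge_start[OF Q], of id]
      sum.reindex_bij_betw[OF bij_betw_edge_end[OF Q], of id] by (simp add: sum_subtractf)
  finally show ?thesis by simp
qed

lemma card_edge_set_ge_3:
  assumes Q: "polygon Q"
  shows "3 \<le> card (edge_set Q)"
proof -
  have "2 = aff_dim {v. v extreme_point_of Q}"
    using Q polygonD(5)[OF Q] aff_dim_convex_hull by (metis polygon_def)
  also have "\<dots> \<le> int (card {v. v extreme_point_of Q}) - 1"
    by (rule aff_dim_le_card) (rule polygonD(6)[OF Q])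
  finally show ?thesis by (simp add: card_edge_set[OF Q])
qed

text \<open>
  Edges of a polytope are exposed, so one of the two orientations has the polygon on its left.
\<close>

lemma edge_is_oriented:
  assumes Q: "polygon Q" and e: "e edge_of Q"
  shows "e \<in> (\<lambda>(a, b). closed_segment a b) ` oriented_edges Q"
proof -
  have f: "e face_of Q" and d: "aff_dim e = 1" using e by (auto simp: edge_of_def)
  have "collinear e" using d by (simp add: collinear_aff_dim)
  moreover have "compact e" "convex e" "e \<noteq> {}"
    using face_of_imp_compact[OF polygonD(1,2)[OF Q] f] face_of_imp_convex[OF f] d by auto
  ultimately obtain a b where ab: "e = closed_segment a b"
    using compact_convex_collinear_segment[of e] by blast
  then have "a \<noteq> b" using d by auto
  have "e exposed_face_of Q" using f exposed_face_of_polyhedron[OF polygonD(3)[OF Q]] by simp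
  then obtain n k where n: "Q \<subseteq> {x. n \<bullet> x \<le> k}" "e = Q \<inter> {x. n \<bullet> x = k}"
    unfolding exposed_face_of_def by blast
  have "n \<noteq> 0"
  proof
    assume "n = 0"
    then have "e = Q" using n \<open>e \<noteq> {}\<close> by auto
    then show False using Q d by (simp add: polygon_def)
  qed
  have "a \<in> e" "b \<in> e" using ab by auto
  then have "n \<bullet> (b - a) = 0" using n(2) by (simp add: inner_diff_right)
  then have "det2 (b - a) (perp n) = 0"
    by (simp add: det2_def perp_def inner_vec_def sum_2 algebra_simps)
  then obtain c where c: "perp n = c *\<^sub>R (b - a)"
    using \<open>a \<noteq> b\<close> det2_eq_0_imp_scale by (metis right_minus_eq)
  have "c \<noteq> 0" using c \<open>n \<noteq> 0\<close> by auto
  have nx: "n \<bullet> x = - c * det2 (b - a) x" for x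
  proof -
    have "n \<bullet> x = - det2 (perp n) x"
      by (simp add: det2_def perp_def inner_vec_def sum_2 algebra_simps)
    then show ?thesis unfolding c by simp
  qed
  have le: "- c * det2 (b - a) x \<le> - c * det2 (b - a) a" if "x \<in> Q" for x
  proof -
    have "n \<bullet> x \<le> n \<bullet> a" using n \<open>a \<in> e\<close> that by auto
    then show ?thesis unfolding nx .
  qed
  show ?thesis
  proof (cases "c > 0")
    case True
    then have "det2 (b - a) (x - a) \<ge> 0" if "x \<in> Q" for x
      using le[OF that] by (simp only: det2_simps) (simp add: mult_le_cancel_left)
    then have "(a, b) \<in> oriented_edges Q"
      using e unfolding ab oriented_edges_def det_vector_eq_det2 by auto
    then show ?thesis using ab by force
  next
    case False
    then have "c < 0" using \<open>c \<noteq> 0\<close> by simp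
    then have "det2 (b - a) x \<le> det2 (b - a) a" if "x \<in> Q" for x
      using le[OF that] by (simp add: mult_le_cancel_left)
    then have "det2 (a - b) (x - b) \<ge> 0" if "x \<in> Q" for x
      using that det2_commute[of a b] by fastforce
    then have "(b, a) \<in> oriented_edges Q"
      using e unfolding ab oriented_edges_def det_vector_eq_det2
      by (auto simp: closed_segment_commute)
    then have "(\<lambda>(a, b). closed_segment a b) (b, a) \<in> (\<lambda>(a, b). closed_segment a b) ` oriented_edges Q"
      by (rule imageI)
    then show ?thesis using ab by (simp add: closed_segment_commute)
  qed
qed

lemma num_edges_eq:
  assumes Q: "polygon Q"
  shows "num_edges Q = card (edge_set Q)"
proof -
  have "bij_betw (\<lambda>(a, b). closed_segment a b) (oriented_edges Q) {e. e edge_of Q}"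
    unfolding bij_betw_def
  proof
    have "(a, b) = (a', b')"
      if ab: "(a, b) \<in> oriented_edges Q" "(a', b') \<in> oriented_edges Q"
        "closed_segment a b = closed_segment a' b'" for a b a' b'
    proof (rule ccontr)
      assume "(a, b) \<noteq> (a', b')"
      then have *: "a' = b" "b' = a"
        using ab(3) by (auto simp: closed_segment_eq doubleton_eq_iff)
      have u: "b - a \<noteq> 0" using oriented_edgeD(1)[OF ab(1)] by simp
      show False
        using opposite_supports_False[OF Q u, of "-1" a] oriented_edgeD(6)[OF ab(1)]
          oriented_edge_left_of_end[OF ab(2)] unfolding * by simp
    qed
    then show "inj_on (\<lambda>(a, b). closed_segment a b) (oriented_edges Q)"
      unfolding inj_on_def by fastforce
    note edge_is_oriented[OF Q]
    moreover have "closed_segment a b edge_of Q" if "(a, b) \<in> oriented_edges Q" for a b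
      using oriented_edgeD(4)[OF that] .
    ultimately show "(\<lambda>(a, b). closed_segment a b) ` oriented_edges Q = {e. e edge_of Q}"
      by auto
  qed
  then show ?thesis
    unfolding num_edges_def edge_set_def card_image[OF inj_on_edge_vector[OF Q]]
    by (simp add: bij_betw_same_card)
qed

section \<open>Polygons are determined by their edge vectors\<close>

definition angle :: "real^2 \<Rightarrow> real" where
  "angle v = Arg2pi (Complex (v $ 1) (v $ 2))"

lemma angle_bounds: "0 \<le> angle v" "angle v < 2 * pi"
  using Arg2pi by (auto simp: angle_def)

lemma polar:
  "v $ 1 = norm v * cos (angle v)" "v $ 2 = norm v * sin (angle v)"
proof -
  have "norm v = cmod (Complex (v $ 1) (v $ 2))"
    by (simp add: norm_vec_def L2_set_def sum_2 cmod_def)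
  then show "v $ 1 = norm v * cos (angle v)" "v $ 2 = norm v * sin (angle v)"
    using cos_Arg2pi[of "Complex (v $ 1) (v $ 2)"] sin_Arg2pi[of "Complex (v $ 1) (v $ 2)"]
    by (simp_all add: angle_def)
qed

lemma det2_eq_sin: "det2 u v = norm u * norm v * sin (angle v - angle u)"
proof -
  have "det2 u v = (norm u * cos (angle u)) * (norm v * sin (angle v))
      - (norm u * sin (angle u)) * (norm v * cos (angle v))"
    using polar[of u] polar[of v] by (simp add: det2_def)
  then show ?thesis by (simp add: sin_diff algebra_simps)
qed

text \<open>
  The sign of the determinant in terms of the two angles in \<open>[0, 2 \<pi>)\<close>. With it, all statements
  about the cyclic order of directions become linear arithmetic.
\<close>

lemma det2_pos_iff:
  assumes "u \<noteq> 0" "v \<noteq> 0"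
  shows "det2 u v > 0 \<longleftrightarrow> angle u < angle v \<and> angle v < angle u + pi \<or> angle v < angle u - pi"
proof -
  let ?d = "angle v - angle u"
  have d: "- (2 * pi) < ?d" "?d < 2 * pi" using angle_bounds[of u] angle_bounds[of v] by auto
  have "sin ?d > 0 \<longleftrightarrow> 0 < ?d \<and> ?d < pi \<or> ?d < - pi"
  proof -
    consider "?d < - pi" | "-pi \<le> ?d" "?d \<le> 0" | "0 < ?d" "?d < pi" | "pi \<le> ?d" by linarith
    then show ?thesis
    proof cases
      case 1
      then have "sin (?d + 2 * pi) > 0" using d by (intro sin_gt_zero) auto
      then show ?thesis using 1 by (simp only: sin_periodic) simp
    next
      case 2
      then have "sin (- ?d) \<ge> 0" by (intro sin_ge_zero) auto
      then show ?thesis using 2 by (simp only: sin_minus) auto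
    next
      case 3 then show ?thesis using sin_gt_zero by auto
    next
      case 4 then show ?thesis using sin_le_zero[of ?d] d by auto
    qed
  qed
  moreover have "norm u * norm v > 0" using assms by simp
  then have "det2 u v > 0 \<longleftrightarrow> sin ?d > 0"
    using zero_less_mult_pos mult_pos_pos unfolding det2_eq_sin by blast
  ultimately show ?thesis by auto
qed

lemma det2_neg_iff:
  assumes "u \<noteq> 0" "v \<noteq> 0"
  shows "det2 u v < 0 \<longleftrightarrow> angle v < angle u \<and> angle u < angle v + pi \<or> angle u < angle v - pi"
  using det2_pos_iff[OF assms(2,1)] det2_commute[of u v] by simp

lemma angle_eq_imp_scale:
  assumes "angle u = angle v" "u \<noteq> 0" "v \<noteq> 0"
  obtains c where "c > 0" "v = c *\<^sub>R u"
proof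
  show "norm v / norm u > 0" using assms by simp
  have "v $ 1 = norm v / norm u * u $ 1" "v $ 2 = norm v / norm u * u $ 2"
    unfolding polar[of u] polar[of v] using assms by simp_all
  then show "v = (norm v / norm u) *\<^sub>R u" by (simp add: vec_eq_iff forall_2)
qed

lemma edge_set_nonzero: "0 \<notin> edge_set Q"
  using oriented_edgeD(1) by (force simp: edge_set_def)

lemma inj_on_angle_edge_set:
  assumes Q: "polygon Q"
  shows "inj_on angle (edge_set Q)"
proof (rule inj_onI)
  fix u v assume uv: "u \<in> edge_set Q" "v \<in> edge_set Q" "angle u = angle v"
  then obtain a b a' b' where
    ab: "(a, b) \<in> oriented_edges Q" "u = b - a" "(a', b') \<in> oriented_edges Q" "v = b' - a'"
    by (auto simp: edge_set_def)
  obtain c where "c > 0" "v = c *\<^sub>R u"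
    using angle_eq_imp_scale[OF uv(3)] uv edge_set_nonzero by metis
  then have "a' = a \<and> b' = b"
    unfolding ab(2,4) using oriented_edge_direction_unique[OF Q ab(1,3)] by blast
  then show "u = v" using ab by simp
qed

text \<open>
  When the boundary is traversed counterclockwise, the edge vectors appear by increasing angle.
  The edge \<open>e\<close> therefore starts at the sum of all edge vectors of smaller angle, up to one
  translation common to all edges.
\<close>

definition chain_vertex :: "(real^2) set \<Rightarrow> real^2 \<Rightarrow> real^2" where
  "chain_vertex E e = \<Sum>{g \<in> E. angle g < angle e}"

lemma chain_vertex_successor:
  assumes "finite E" "inj_on angle E" "f \<in> E" "angle f < angle e"
    "\<And>g. g \<in> E \<Longrightarrow> angle f < angle g \<Longrightarrow> \<not> angle g < angle e"
  shows "chain_vertex E e = chain_vertex E f + f"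
proof -
  have "{g \<in> E. angle g < angle e} = insert f {g \<in> E. angle g < angle f}"
    using assms by (auto dest: inj_onD) (metis inj_onD linorder_neqE_linordered_idom)
  then show ?thesis using assms(1) by (simp add: chain_vertex_def add.commute)
qed

text \<open>
  Of two consecutive edges \<open>f\<close> and \<open>e\<close> meeting at \<open>v\<close>, no edge vector \<open>g\<close> points strictly between:
  the polygon lies in the cone at \<open>v\<close> spanned by the two edges, on which the functional of \<open>g\<close> is
  minimal only at the apex, whereas an edge in direction \<open>g\<close> needs two minimal points.
\<close>

lemma outgoing_edge_is_successor:
  assumes Q: "polygon Q" and f: "(a, v) \<in> oriented_edges Q" and e': "(v, w) \<in> oriented_edges Q"
  shows "det2 (v - a) (w - v) > 0"
    "\<And>g. g \<in> edge_set Q \<Longrightarrow> \<not> (det2 (v - a) g > 0 \<and> det2 g (w - v) > 0)"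
proof -
  let ?f = "v - a" and ?e = "w - v"
  have nz: "?f \<noteq> 0" "?e \<noteq> 0" using oriented_edgeD(1)[OF f] oriented_edgeD(1)[OF e'] by auto
  have "det2 ?f ?e \<ge> 0" using oriented_edge_left_of_end[OF f oriented_edgeD(3)[OF e']] by simp
  moreover have "det2 ?f ?e \<noteq> 0"
  proof
    assume "det2 ?f ?e = 0"
    then obtain c where c: "?e = c *\<^sub>R ?f" using det2_eq_0_imp_scale nz by blast
    then have "c \<noteq> 0" using nz by auto
    moreover have "\<not> c < 0"
      using opposite_supports_False[OF Q nz(1), of c v] oriented_edge_left_of_end[OF f]
        oriented_edgeD(6)[OF e'] unfolding c by blast
    ultimately have "v = a" using oriented_edge_direction_unique[OF Q f e' c] by linarith
    then show False using nz by simp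
  qed
  ultimately show pos: "det2 ?f ?e > 0" by linarith
  fix g assume "g \<in> edge_set Q"
  then obtain c d where g: "g = d - c" "(c, d) \<in> oriented_edges Q" by (auto simp: edge_set_def)
  show "\<not> (det2 ?f g > 0 \<and> det2 g ?e > 0)"
  proof
    assume *: "det2 ?f g > 0 \<and> det2 g ?e > 0"
    \<comment> \<open>By Cramer's rule, positivity of the determinants puts the polygon in the cone at the
        vertex, on which the functional of \<open>g\<close> is minimal only at the apex.\<close>
    have cramer: "det2 ?f ?e * det2 g y = det2 ?f y * det2 g ?e + det2 ?f g * det2 ?e y" for y
      by (simp add: det2_def algebra_simps)
    have only_v: "x = v" if x: "x \<in> Q" "det2 g x \<le> det2 g v" for x
    proof -
      have "det2 ?f (x - v) \<ge> 0" "det2 ?e (x - v) \<ge> 0"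
        using oriented_edge_left_of_end[OF f x(1)] oriented_edgeD(6)[OF e' x(1)] by simp_all
      moreover have "det2 ?f ?e * det2 g (x - v) \<le> 0"
        using pos x(2) by (intro mult_nonneg_nonpos) auto
      moreover have "det2 ?f (x - v) * det2 g ?e \<ge> 0" "det2 ?f g * det2 ?e (x - v) \<ge> 0"
        using * calculation(1,2) by (simp_all only: mult_nonneg_nonneg less_imp_le)
      ultimately have "det2 ?f (x - v) * det2 g ?e = 0" "det2 ?f g * det2 ?e (x - v) = 0"
        using cramer[of "x - v"] by linarith+
      then have 0: "det2 ?f (x - v) = 0" "det2 ?e (x - v) = 0" using * by auto
      then obtain t where t: "x - v = t *\<^sub>R ?f" using det2_eq_0_imp_scale nz by blast
      then have "t * det2 ?e ?f = 0" using 0(2) by (metis det2_simps(6))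
      then have "t = 0" using pos det2_commute[of ?f ?e] by auto
      then show ?thesis using t by simp
    qed
    have "v \<in> Q" using oriented_edgeD(3)[OF f] .
    then have "det2 g c \<le> det2 g v" using oriented_edgeD(6)[OF g(2)] g(1) by blast
    moreover have "det2 g d = det2 g c" using g(1) det2_commute[of c d] by simp
    ultimately have "c = v" "d = v"
      using only_v[of c] only_v[of d] oriented_edgeD(2,3)[OF g(2)] by simp_all
    then show False using oriented_edgeD(1)[OF g(2)] by simp
  qed
qed

lemma consecutive_edges:
  assumes Q: "polygon Q" and f: "(a, v) \<in> oriented_edges Q" and e: "e \<in> edge_set Q"
    and less: "angle (v - a) < angle e"
    and gap: "\<And>g. g \<in> edge_set Q \<Longrightarrow> angle (v - a) < angle g \<Longrightarrow> \<not> angle g < angle e"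
  shows "(v, v + e) \<in> oriented_edges Q"
proof -
  obtain w where w: "(v, w) \<in> oriented_edges Q"
    using outgoing_edge_exists[OF Q oriented_edge_extreme(2)[OF f]] by blast
  let ?f = "v - a" and ?e' = "w - v"
  note s = outgoing_edge_is_successor[OF Q f w]
  have E: "?f \<in> edge_set Q" "?e' \<in> edge_set Q" using f w by (force simp: edge_set_def)+
  have nz: "?f \<noteq> 0" "?e' \<noteq> 0" "e \<noteq> 0" using E e edge_set_nonzero by metis+
  have "?e' = e"
  proof (rule ccontr)
    assume "?e' \<noteq> e"
    then have ne: "angle ?e' \<noteq> angle e" using inj_on_angle_edge_set[OF Q] E e by (auto dest: inj_onD)
    have *: "\<not> (det2 ?f e > 0 \<and> det2 e ?e' > 0)" using s(2)[OF e] .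
    have **: "angle ?f < angle ?e' \<Longrightarrow> angle e \<le> angle ?e'" using gap[OF E(2)] by auto
    show False
      using s(1) * ** ne less angle_bounds[of e] angle_bounds[of ?f] angle_bounds[of ?e']
      unfolding det2_pos_iff[OF nz(1,2)] det2_pos_iff[OF nz(1,3)] det2_pos_iff[OF nz(3,2)]
      by linarith
  qed
  then show ?thesis using w by (metis add.commute diff_add_cancel)
qed

text \<open>
  By induction over the edges in the order of their angle, starting with the edge of least angle.
\<close>

lemma edge_start_eq_chain_vertex:
  assumes Q: "polygon Q"
  obtains c where "\<And>a b. (a, b) \<in> oriented_edges Q \<Longrightarrow> a = c + chain_vertex (edge_set Q) (b - a)"
proof -
  let ?E = "edge_set Q" and ?p = "chain_vertex (edge_set Q)"
  have fin: "finite ?E" using Q by (rule finite_edge_set)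
  have "?E \<noteq> {}" using card_edge_set_ge_3[OF Q] by auto
  then have "Min (angle ` ?E) \<in> angle ` ?E" using fin by (intro Min_in) auto
  then obtain e0 where e0: "e0 \<in> ?E" "angle e0 = Min (angle ` ?E)" by auto
  have e0_min: "angle e0 \<le> angle g" if "g \<in> ?E" for g using that e0 fin by simp
  obtain a0 b0 where a0: "(a0, b0) \<in> oriented_edges Q" "e0 = b0 - a0"
    using e0 by (auto simp: edge_set_def)
  have "a = a0 + ?p (b - a)" if "(a, b) \<in> oriented_edges Q" for a b
    using that
  proof (induction "card {g \<in> ?E. angle g < angle (b - a)}" arbitrary: a b rule: less_induct)
    case less
    let ?e = "b - a" and ?L = "{g \<in> ?E. angle g < angle (b - a)}"
    have e: "?e \<in> ?E" using less(2) by (force simp: edge_set_def)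
    show ?case
    proof (cases "?L = {}")
      case True
      then have "angle ?e \<le> angle e0" using e0(1) by force
      then have "?e = e0"
        using e0_min[OF e] inj_on_angle_edge_set[OF Q] e e0(1) by (meson inj_onD order_antisym)
      then have "a = a0" using oriented_edge_vector_unique[OF Q a0(1) less(2)] a0(2) by simp
      moreover have "?p ?e = 0" unfolding chain_vertex_def True by simp
      ultimately show ?thesis by simp
    next
      case False
      then have "Max (angle ` ?L) \<in> angle ` ?L" using fin by (intro Max_in) auto
      then obtain f where f: "f \<in> ?L" "angle f = Max (angle ` ?L)" by auto
      have gap: "\<not> angle g < angle ?e" if "g \<in> ?E" "angle f < angle g" for g
      proof
        assume "angle g < angle ?e"
        then have "angle g \<le> angle f" using that fin f(2) by simp
        then show False using that by simp
      qed
      obtain a' v where f': "(a', v) \<in> oriented_edges Q" "f = v - a'"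
        using f(1) by (auto simp: edge_set_def)
      have "(v, v + ?e) \<in> oriented_edges Q"
        using consecutive_edges[OF Q f'(1) e] f(1) gap f'(2) by simp
      then have "v = a" using oriented_edge_vector_unique[OF Q less(2)] by simp
      moreover have "{g \<in> ?E. angle g < angle f} \<subset> ?L" using f(1) by auto
      then have "card {g \<in> ?E. angle g < angle (v - a')} < card ?L"
        unfolding f'(2) using fin by (intro psubset_card_mono) auto
      then have "a' = a0 + ?p f" using less(1)[OF _ f'(1)] f'(2) by simp
      moreover have "?p ?e = ?p f + f"
        using chain_vertex_successor[OF fin inj_on_angle_edge_set[OF Q], of f ?e] f(1) gap by simp
      moreover have "v = a' + f" using f'(2) by simp
      ultimately show ?thesis by (simp only: add.assoc)
    qed
  qed
  then show ?thesis using that by blast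
qed

theorem polygon_eq_translate_of_chain_hull:
  assumes Q: "polygon Q"
  obtains c where "Q = (+) c ` (convex hull (chain_vertex (edge_set Q) ` edge_set Q))"
    "\<And>e. e \<in> edge_set Q \<Longrightarrow> (c + chain_vertex (edge_set Q) e) extreme_point_of Q"
proof -
  let ?E = "edge_set Q"
  obtain c where c: "\<And>a b. (a, b) \<in> oriented_edges Q \<Longrightarrow> a = c + chain_vertex ?E (b - a)"
    using edge_start_eq_chain_vertex[OF Q] by blast
  have "{v. v extreme_point_of Q} = fst ` oriented_edges Q"
    using bij_betw_edge_start[OF Q] by (simp add: bij_betw_def)
  also have "\<dots> = (+) c ` chain_vertex ?E ` ?E"
    unfolding edge_set_def image_image using c by (intro image_cong) (auto simp: edge_set_def)
  finally have ext: "{v. v extreme_point_of Q} = (+) c ` chain_vertex ?E ` ?E" .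
  then have "Q = (+) c ` (convex hull (chain_vertex ?E ` ?E))"
    using polygonD(5)[OF Q] by (simp add: convex_hull_translation)
  moreover have "(c + chain_vertex ?E e) extreme_point_of Q" if "e \<in> ?E" for e
    using ext that by blast
  ultimately show ?thesis using that by blast
qed

section \<open>Polygons with prescribed edge vectors\<close>

locale closed_edge_system =
  fixes E :: "(real^2) set"
  assumes fin: "finite E" and zero_notin: "0 \<notin> E" and inj_angle: "inj_on angle E"
    and sum_zero: "\<Sum>E = 0" and noncollinear: "\<exists>e\<in>E. \<exists>g\<in>E. det2 e g \<noteq> 0"
begin

abbreviation "p \<equiv> chain_vertex E"

abbreviation "P \<equiv> convex hull (p ` E)"

lemma chain_vertex_diff:
  assumes "angle e \<le> angle f"
  shows "p f - p e = \<Sum>{g \<in> E. angle e \<le> angle g \<and> angle g < angle f}"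
    and "p f - p e = - \<Sum>{g \<in> E. angle g < angle e \<or> angle f \<le> angle g}"
proof -
  have "{g \<in> E. angle g < angle f} =
      {g \<in> E. angle g < angle e} \<union> {g \<in> E. angle e \<le> angle g \<and> angle g < angle f}"
    using assms by auto
  then have "p f = p e + \<Sum>{g \<in> E. angle e \<le> angle g \<and> angle g < angle f}"
    unfolding chain_vertex_def using fin by (simp add: sum.union_disjoint disjoint_iff)
  then show 1: "p f - p e = \<Sum>{g \<in> E. angle e \<le> angle g \<and> angle g < angle f}" by simp
  have "E = {g \<in> E. angle e \<le> angle g \<and> angle g < angle f} \<union>
      {g \<in> E. angle g < angle e \<or> angle f \<le> angle g}"
    by auto
  then have "\<Sum>E = \<Sum>{g \<in> E. angle e \<le> angle g \<and> angle g < angle f} +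
      \<Sum>{g \<in> E. angle g < angle e \<or> angle f \<le> angle g}"
    using fin by (subst (1) \<open>E = _\<close>, subst sum.union_disjoint) (auto simp: disjoint_iff)
  then show "p f - p e = - \<Sum>{g \<in> E. angle g < angle e \<or> angle f \<le> angle g}"
    using 1 sum_zero by (simp add: eq_neg_iff_add_eq_0)
qed

lemma same_angle_eq: "e \<in> E \<Longrightarrow> g \<in> E \<Longrightarrow> angle e = angle g \<Longrightarrow> e = g"
  using inj_angle by (auto dest: inj_onD)

text \<open>
  All candidates for vertices lie to the left of the candidate for the edge \<open>e\<close>. The difference of
  two candidates is a sum of edge vectors over an interval of angles, and, because all vectors sum
  to zero, also minus the sum over the complementary interval. For one of the two, all summands
  lie on the same side of \<open>e\<close>.
\<close>

lemma det2_chain_vertex: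
  assumes e: "e \<in> E" and f: "f \<in> E"
  shows "det2 e (p f - p e) > 0 \<or> p f = p e \<or> p f = p e + e"
proof -
  have nz: "g \<noteq> 0" if "g \<in> E" for g using that zero_notin by auto
  note pos = det2_pos_iff[OF nz[OF e] nz] and neg = det2_neg_iff[OF nz[OF e] nz]
  have bd: "0 \<le> angle g" "angle g < 2 * pi" for g by (rule angle_bounds)+
  have sum_pos: ?thesis
    if "p f - p e = e + \<Sum>S" "S \<subseteq> E" "\<And>g. g \<in> S \<Longrightarrow> det2 e g > 0" for S
  proof (cases "S = {}")
    case True
    then show ?thesis using that(1) by (simp add: algebra_simps)
  next
    case False
    then have "0 < (\<Sum>g\<in>S. det2 e g)"
      using that fin by (intro sum_pos) (auto intro: finite_subset)
    then show ?thesis unfolding that(1) by (simp add: det2_sum_right)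
  qed
  have sum_neg: ?thesis
    if "p f - p e = - \<Sum>S" "S \<subseteq> E" "\<And>g. g \<in> S \<Longrightarrow> det2 e g < 0" "f \<in> S" for S
  proof -
    have "0 < (\<Sum>g\<in>S. - det2 e g)"
      using that fin by (intro Groups_Big.sum_pos) (auto intro: finite_subset)
    then show ?thesis unfolding that(1) by (simp add: det2_sum_right sum_negf)
  qed
  consider "f = e" | "angle e < angle f" "det2 e f \<ge> 0" | "angle e < angle f" "det2 e f < 0"
    | "angle f < angle e" "det2 e f < 0" | "angle f < angle e" "det2 e f \<ge> 0"
    using same_angle_eq[OF e f] by fastforce
  then show ?thesis
  proof cases
    case 1 then show ?thesis by simp
  next
    case 2
    let ?S = "{g \<in> E. angle e < angle g \<and> angle g < angle f}"
    have "{g \<in> E. angle e \<le> angle g \<and> angle g < angle f} = insert e ?S"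
      using 2 e same_angle_eq by fastforce
    then have "p f - p e = e + \<Sum>?S" using chain_vertex_diff(1)[of e f] 2 fin by simp
    moreover have "det2 e g > 0" if "g \<in> ?S" for g
      using 2 that bd[of f] bd[of e] bd[of g] neg[OF f] pos[of g] by (auto simp: not_less[symmetric])
    ultimately show ?thesis by (intro sum_pos[of ?S]) auto
  next
    case 3
    show ?thesis
    proof (rule sum_neg)
      show "p f - p e = - \<Sum>{g \<in> E. angle g < angle e \<or> angle f \<le> angle g}"
        using chain_vertex_diff(2)[of e f] 3 by simp
    next
      fix g assume g: "g \<in> {g \<in> E. angle g < angle e \<or> angle f \<le> angle g}"
      then have "angle f > angle e + pi" using 3 neg[OF f] by auto
      then show "det2 e g < 0" using g bd[of f] bd[of e] bd[of g] neg[of g] by auto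
    qed (use f in auto)
  next
    case 4
    show ?thesis
    proof (rule sum_neg)
      show "p f - p e = - \<Sum>{g \<in> E. angle f \<le> angle g \<and> angle g < angle e}"
        using chain_vertex_diff(1)[of f e] 4 by (simp add: algebra_simps)
    next
      fix g assume g: "g \<in> {g \<in> E. angle f \<le> angle g \<and> angle g < angle e}"
      then show "det2 e g < 0" using 4 bd[of f] bd[of e] bd[of g] neg[of g] neg[OF f] by auto
    qed (use f 4 in auto)
  next
    case 5
    let ?S = "{g \<in> E. angle g < angle f \<or> angle e < angle g}"
    have "{g \<in> E. angle g < angle f \<or> angle e \<le> angle g} = insert e ?S"
      using 5 e same_angle_eq by fastforce
    moreover have "p f - p e = \<Sum>{g \<in> E. angle g < angle f \<or> angle e \<le> angle g}"
      using chain_vertex_diff(2)[of f e] 5 by (simp add: algebra_simps)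
    ultimately have "p f - p e = e + \<Sum>?S" using 5 fin by simp
    moreover have "det2 e g > 0" if "g \<in> ?S" for g
      using 5 that bd[of f] bd[of e] bd[of g] neg[OF f] pos[of g] by (auto simp: not_less[symmetric])
    ultimately show ?thesis by (intro sum_pos[of ?S]) auto
  qed
qed

text \<open>
  The end of an edge is the start of the next one; after the edge of largest angle the chain
  closes at the origin.
\<close>

lemma chain_vertex_plus_edge:
  assumes e: "e \<in> E"
  shows "p e + e \<in> p ` E"
proof (cases "{g \<in> E. angle e < angle g} = {}")
  case True
  have "Min (angle ` E) \<in> angle ` E" using fin e by (intro Min_in) auto
  then obtain f where f: "f \<in> E" "angle f = Min (angle ` E)" by auto
  then have "{g \<in> E. angle g < angle f} = {}" using fin by (auto simp: not_less)
  then have "p f = 0" unfolding chain_vertex_def by (simp only: sum.empty)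
  moreover have "E = insert e {g \<in> E. angle g < angle e}"
    using True e same_angle_eq by (fastforce simp: not_less order_le_less)
  then have "\<Sum>E = e + p e" unfolding chain_vertex_def using fin
    by (metis (no_types, lifting) finite_insert mem_Collect_eq order_less_irrefl sum.insert)
  ultimately show ?thesis using f(1) sum_zero by (metis add.commute imageI)
next
  case False
  let ?U = "{g \<in> E. angle e < angle g}"
  have "Min (angle ` ?U) \<in> angle ` ?U" using fin False by (intro Min_in) auto
  then obtain f where f: "f \<in> ?U" "angle f = Min (angle ` ?U)" by auto
  have "\<not> angle g < angle f" if "g \<in> E" "angle e < angle g" for g
  proof -
    have "angle f \<le> angle g" unfolding f(2) using that fin by (intro Min_le) auto
    then show ?thesis by simp
  qed
  then have "p f = p e + e"
    using chain_vertex_successor[OF fin inj_angle e, of f] f(1) by blast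
  then show ?thesis using f(1) by (metis (no_types, lifting) imageI mem_Collect_eq)
qed

lemma chain_hull_polygon: "polygon P"
proof -
  have "\<not> aff_dim P \<le> 1"
  proof
    assume "aff_dim P \<le> 1"
    then have "collinear P" by (simp add: collinear_aff_dim)
    then obtain u where u: "\<And>x y. x \<in> P \<Longrightarrow> y \<in> P \<Longrightarrow> \<exists>c. x - y = c *\<^sub>R u"
      unfolding collinear_def by blast
    have "\<exists>c. e = c *\<^sub>R u" if "e \<in> E" for e
      using u[of "p e + e" "p e"] that chain_vertex_plus_edge[OF that] by (simp add: hull_inc)
    then have "det2 e g = 0" if "e \<in> E" "g \<in> E" for e g
      using that by (metis det2_simps(5,6,9) mult_zero_right)
    then show False using noncollinear by blast
  qed
  then have "aff_dim P = 2" using aff_dim_le_DIM[of P] by simp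
  then show ?thesis unfolding polygon_def using fin by (auto intro: polytope_convex_hull)
qed

text \<open>
  The face of the hull in direction \<open>e\<close> is spanned by the candidates on the line of \<open>e\<close>, and these
  are just the two ends.
\<close>

lemma chain_hull_oriented_edge:
  assumes e: "e \<in> E"
  shows "(p e, p e + e) \<in> oriented_edges P"
proof -
  have "det2 e (p f - p e) \<ge> 0" if "f \<in> E" for f
    using det2_chain_vertex[OF e that] by auto
  then have "p ` E \<subseteq> {x. perp e \<bullet> x \<ge> perp e \<bullet> p e}"
    by (auto simp flip: det2_inner)
  then have "P \<subseteq> {x. perp e \<bullet> x \<ge> perp e \<bullet> p e}"
    by (rule hull_minimal) (rule convex_halfspace_ge)
  then have left: "det2 e (p e) \<le> det2 e x" if "x \<in> P" for x
    using that by (auto simp: det2_inner)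
  let ?F = "P \<inter> {x. det2 e x = det2 e (p e)}"
  have "e \<noteq> 0" using e zero_notin by auto
  note F = line_face_le(1)[OF chain_hull_polygon this left]
  obtain S where S: "S \<subseteq> p ` E" "?F = convex hull S"
    using face_of_convex_hull_subset[OF _ F] fin by (metis finite_imageI finite_imp_compact)
  have "S \<subseteq> {p e, p e + e}"
  proof
    fix x assume x: "x \<in> S"
    then obtain f where f: "f \<in> E" "x = p f" using S by auto
    have "x \<in> ?F" using x S hull_inc by metis
    then show "x \<in> {p e, p e + e}" using det2_chain_vertex[OF e f(1)] f(2) by auto
  qed
  then have "?F \<subseteq> closed_segment (p e) (p e + e)"
    unfolding S(2) segment_convex_hull by (rule hull_mono)
  moreover have "p e \<in> ?F" "p e + e \<in> ?F"
    using e chain_vertex_plus_edge[OF e] by (auto intro: hull_inc)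
  then have "closed_segment (p e) (p e + e) \<subseteq> ?F"
    by (intro closed_segment_subset face_of_imp_convex[OF F])
  ultimately have "closed_segment (p e) (p e + e) face_of P" using F by simp
  moreover have "p e \<noteq> p e + e" using \<open>e \<noteq> 0\<close> by simp
  then have "aff_dim (closed_segment (p e) (p e + e)) = 1"
    unfolding segment_convex_hull aff_dim_convex_hull aff_dim_2 by simp
  ultimately have "closed_segment (p e) (p e + e) edge_of P" by (simp add: edge_of_def)
  then show ?thesis
    unfolding oriented_edges_def det_vector_eq_det2 mem_Collect_eq prod.case
    using left by (simp del: convex_hull_eq_empty)
qed

theorem edge_set_chain_hull: "edge_set P = E"
proof
  show "E \<subseteq> edge_set P"
  proof
    fix e assume "e \<in> E"
    then have "(\<lambda>(a, b). b - a) (p e, p e + e) \<in> edge_set P"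
      unfolding edge_set_def by (intro imageI chain_hull_oriented_edge)
    then show "e \<in> edge_set P" by simp
  qed
  show "edge_set P \<subseteq> E"
  proof
    fix v assume "v \<in> edge_set P"
    then obtain a b where ab: "(a, b) \<in> oriented_edges P" "v = b - a" by (auto simp: edge_set_def)
    then have "a \<in> p ` E" using oriented_edge_extreme(1) extreme_point_of_convex_hull by blast
    then obtain e where e: "e \<in> E" "a = p e" by auto
    then have "b = p e + e"
      using outgoing_edge_unique[OF chain_hull_polygon chain_hull_oriented_edge[OF e(1)]] ab by blast
    then show "v \<in> E" using ab e by simp
  qed
qed

lemma oriented_edges_chain_hull: "oriented_edges P = (\<lambda>e. (p e, p e + e)) ` E"
proof
  show "(\<lambda>e. (p e, p e + e)) ` E \<subseteq> oriented_edges P"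
    using chain_hull_oriented_edge by blast
  show "oriented_edges P \<subseteq> (\<lambda>e. (p e, p e + e)) ` E"
  proof
    fix z assume z: "z \<in> oriented_edges P"
    obtain a b where ab: "z = (a, b)" by (cases z)
    then have "a \<in> p ` E" using z oriented_edge_extreme(1) extreme_point_of_convex_hull by blast
    then obtain e where e: "e \<in> E" "a = p e" by auto
    then have "b = p e + e"
      using outgoing_edge_unique[OF chain_hull_polygon chain_hull_oriented_edge[OF e(1)]] ab z by blast
    then show "z \<in> (\<lambda>e. (p e, p e + e)) ` E" using ab e by simp
  qed
qed

end

section \<open>Interior points and affine images\<close>

text \<open>
  The open half planes of all edges meet in a convex set that avoids the frontier, which is
  covered by the edges, and that contains interior points of the polygon. Being connected, it lies
  inside the polygon.
\<close>

lemma polygon_interior: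
  assumes Q: "polygon Q"
  shows "interior Q = {x. \<forall>(a, b)\<in>oriented_edges Q. 0 < det2 (b - a) (x - a)}" (is "_ = ?O")
proof
  show "interior Q \<subseteq> ?O"
  proof safe
    fix x a b assume x: "x \<in> interior Q" and ab: "(a, b) \<in> oriented_edges Q"
    have "Q \<subseteq> {x. perp (b - a) \<bullet> x \<ge> perp (b - a) \<bullet> a}"
      using oriented_edgeD(6)[OF ab] by (auto simp: det2_inner)
    then have "x \<in> interior {x. perp (b - a) \<bullet> x \<ge> perp (b - a) \<bullet> a}"
      using x interior_mono by blast
    then show "0 < det2 (b - a) (x - a)"
      using oriented_edgeD(1)[OF ab] by (simp add: det2_inner inner_diff_right)
  qed
  have aff: "affine hull Q = UNIV" using Q aff_dim_eq_full[of Q] by (simp add: polygon_def)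
  have O: "?O = (\<Inter>(a, b)\<in>oriented_edges Q. {x. perp (b - a) \<bullet> x > perp (b - a) \<bullet> a})"
    by (auto simp: det2_inner inner_diff_right)
  have "convex ?O" unfolding O by (intro convex_INT) (auto simp: convex_halfspace_gt)
  then have "connected ?O" by (rule convex_connected)
  moreover have "open ?O"
    unfolding O using finite_oriented_edges[OF Q] by (intro open_INT) (auto simp: open_halfspace_gt)
  moreover have "?O \<inter> frontier Q = {}"
  proof (rule ccontr)
    assume "?O \<inter> frontier Q \<noteq> {}"
    then obtain x where x: "x \<in> ?O" "x \<in> frontier Q" by blast
    have "frontier Q = \<Union>{F. F facet_of Q}"
      using rel_frontier_of_polyhedron[OF polygonD(3)[OF Q]] rel_frontier_frontier[OF aff] by simp
    then obtain F where F: "F facet_of Q" "x \<in> F" using x by auto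
    then have "F edge_of Q" using Q by (auto simp: facet_of_def edge_of_def polygon_def)
    then obtain a b where ab: "(a, b) \<in> oriented_edges Q" "F = closed_segment a b"
      using edge_is_oriented[OF Q, of F] by auto
    then have "det2 (b - a) x = det2 (b - a) a"
      using oriented_edge_eq_line_face[OF Q ab(1)] F(2) by auto
    then show False using x(1) ab(1) by force
  qed
  moreover have "?O \<inter> Q \<noteq> {}"
  proof -
    have "interior Q \<noteq> {}"
      using rel_interior_interior[OF aff] rel_interior_eq_empty[OF polygonD(1)[OF Q]] polygonD(4)[OF Q]
      by simp
    then show ?thesis using \<open>interior Q \<subseteq> ?O\<close> interior_subset by blast
  qed
  ultimately have "?O \<subseteq> Q" using connected_Int_frontier by blast
  then show "?O \<subseteq> interior Q" using \<open>open ?O\<close> by (rule interior_maximal)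
qed

lemma det2_matrix: "det2 (M *v u) (M *v v) = det M * det2 u v"
  by (simp add: det2_def det_2 matrix_vector_mult_def sum_2 algebra_simps)

lemma affine_image_split: "(\<lambda>x. M *v x + t) ` S = (+) t ` ((*v) M ` S)"
  by (auto simp: add.commute)

lemma
  fixes M :: "real^2^2"
  assumes M: "det M \<noteq> 0"
  shows affine_image_face_of:
      "(\<lambda>x. M *v x + t) ` S face_of (\<lambda>x. M *v x + t) ` Q \<longleftrightarrow> S face_of Q"
    and affine_image_aff_dim: "aff_dim ((\<lambda>x. M *v x + t) ` S) = aff_dim S"
proof -
  have "inj ((*v) M)" using M by (simp add: inj_matrix_vector_mult invertible_det_nz)
  then show "(\<lambda>x. M *v x + t) ` S face_of (\<lambda>x. M *v x + t) ` Q \<longleftrightarrow> S face_of Q"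
    and "aff_dim ((\<lambda>x. M *v x + t) ` S) = aff_dim S"
    unfolding affine_image_split
    by (simp_all add: face_of_linear_image aff_dim_translation_eq aff_dim_injective_linear_image
        matrix_vector_mul_linear)
qed

lemma affine_image_closed_segment:
  fixes M :: "real^2^2"
  shows "closed_segment (M *v a + t) (M *v b + t) = (\<lambda>x. M *v x + t) ` closed_segment a b"
  unfolding affine_image_split
  by (metis add.commute closed_segment_linear_image closed_segment_translation_eq
      matrix_vector_mul_linear closed_segment_translation)

lemma polygon_affine_image:
  fixes M :: "real^2^2"
  assumes "det M \<noteq> 0" "polygon Q"
  shows "polygon ((\<lambda>x. M *v x + t) ` Q)"
  using assms affine_image_aff_dim[OF assms(1), of t Q]
  by (simp add: polygon_def affine_image_split polytope_translation_eq polytope_linear_image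
      matrix_vector_mul_linear)

lemma affine_image_oriented_edge:
  fixes M :: "real^2^2"
  assumes M: "det M \<noteq> 0"
  shows "(M *v a + t, M *v b + t) \<in> oriented_edges ((\<lambda>x. M *v x + t) ` Q) \<longleftrightarrow>
    closed_segment a b edge_of Q \<and> (\<forall>x\<in>Q. 0 \<le> det M * det2 (b - a) (x - a))"
  unfolding oriented_edges_def det_vector_eq_det2 edge_of_def
  by (simp add: affine_image_closed_segment affine_image_face_of[OF M] affine_image_aff_dim[OF M]
      det2_matrix matrix_vector_mult_diff_distrib[symmetric] del: det2_simps)

text \<open>
  A transformation of negative determinant reverses the orientation of the edges, which accounts
  for the factor \<open>det M\<close>.
\<close>

theorem edge_set_affine_image:
  fixes M :: "real^2^2"
  assumes M: "\<bar>det M\<bar> = 1"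
  shows "edge_set ((\<lambda>x. M *v x + t) ` Q) = (\<lambda>v. det M *\<^sub>R (M *v v)) ` edge_set Q"
proof -
  let ?T = "\<lambda>x. M *v x + t"
  have nz: "det M \<noteq> 0" using M by auto
  have "inj ((*v) M)" using nz by (simp add: inj_matrix_vector_mult invertible_det_nz)
  then have "surj ((*v) M)"
    by (intro linear_injective_imp_surjective) (simp_all add: matrix_vector_mul_linear)
  then have T: "\<exists>x. ?T x = y" for y by (metis diff_add_cancel surjD)
  consider "det M = 1" | "det M = -1" using M by linarith
  then show ?thesis
  proof cases
    case 1
    have eq: "(M *v a + t, M *v b + t) \<in> oriented_edges (?T ` Q) \<longleftrightarrow> (a, b) \<in> oriented_edges Q" for a b
      unfolding affine_image_oriented_edge[OF nz] 1 oriented_edges_def[of Q] det_vector_eq_det2 by simp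
    have edges: "oriented_edges (?T ` Q) = map_prod ?T ?T ` oriented_edges Q"
    proof (intro equalityI subsetI)
      fix z assume z: "z \<in> oriented_edges (?T ` Q)"
      obtain a b where ab: "z = (M *v a + t, M *v b + t)" using T by (metis prod.collapse)
      then have "(a, b) \<in> oriented_edges Q" using z eq by simp
      then have "map_prod ?T ?T (a, b) \<in> map_prod ?T ?T ` oriented_edges Q" by (rule imageI)
      then show "z \<in> map_prod ?T ?T ` oriented_edges Q" using ab by simp
    qed (use eq in auto)
    show ?thesis
      unfolding edge_set_def edges image_image 1
      by (intro image_cong) (auto simp: matrix_vector_mult_diff_distrib)
  next
    case 2
    have eq: "(M *v a + t, M *v b + t) \<in> oriented_edges (?T ` Q) \<longleftrightarrow> (b, a) \<in> oriented_edges Q" for a b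
      unfolding affine_image_oriented_edge[OF nz] 2 oriented_edges_def[of Q] det_vector_eq_det2
      using det2_commute[of a b] by (simp add: closed_segment_commute algebra_simps)
    have edges: "oriented_edges (?T ` Q) = (\<lambda>(a, b). (?T b, ?T a)) ` oriented_edges Q"
    proof (intro equalityI subsetI)
      fix z assume z: "z \<in> oriented_edges (?T ` Q)"
      obtain a b where ab: "z = (M *v a + t, M *v b + t)" using T by (metis prod.collapse)
      then have "(b, a) \<in> oriented_edges Q" using z eq by simp
      then have "(\<lambda>(a, b). (?T b, ?T a)) (b, a) \<in> (\<lambda>(a, b). (?T b, ?T a)) ` oriented_edges Q" by (rule imageI)
      then show "z \<in> (\<lambda>(a, b). (?T b, ?T a)) ` oriented_edges Q" using ab by simp
    qed (use eq in auto)
    show ?thesis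
      unfolding edge_set_def edges image_image 2
      by (intro image_cong) (auto simp: matrix_vector_mult_diff_distrib)
  qed
qed

section \<open>Lattice polygons up to unimodular equivalence\<close>

type_synonym ivec = "int \<times> int"

definition vec_of :: "ivec \<Rightarrow> real^2" where
  "vec_of v = vector [of_int (fst v), of_int (snd v)]"

definition idet :: "ivec \<Rightarrow> ivec \<Rightarrow> int" where
  "idet u v = fst u * snd v - snd u * fst v"

lemma vec_of_component [simp]: "vec_of v $ 1 = of_int (fst v)" "vec_of v $ 2 = of_int (snd v)"
  by (simp_all add: vec_of_def)

lemma vec_of_simps:
  "vec_of (u + v) = vec_of u + vec_of v" "vec_of (u - v) = vec_of u - vec_of v"
  "vec_of (- v) = - vec_of v" "vec_of 0 = 0"
  by (simp_all add: vec_eq_iff forall_2)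

lemma inj_vec_of: "inj vec_of"
  by (auto simp: inj_def vec_eq_iff forall_2 prod_eq_iff)

lemma vec_of_eq_iff [simp]: "vec_of u = vec_of v \<longleftrightarrow> u = v"
  using inj_vec_of by (auto dest: injD)

lemma vec_of_eq_0_iff [simp]: "vec_of v = 0 \<longleftrightarrow> v = 0"
  using vec_of_eq_iff[of v 0] by (simp add: vec_of_simps)

lemma det2_vec_of: "det2 (vec_of u) (vec_of v) = of_int (idet u v)"
  by (simp add: det2_def idet_def)

lemma lattice2_eq_range: "lattice2 = range vec_of"
proof
  show "lattice2 \<subseteq> range vec_of"
  proof
    fix x assume "x \<in> lattice2"
    then have "x $ 1 \<in> \<int>" "x $ 2 \<in> \<int>" by (auto simp: lattice2_def)
    then obtain a b where "x $ 1 = of_int a" "x $ 2 = of_int b" by (auto elim!: Ints_cases)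
    then have "x = vec_of (a, b)" by (simp add: vec_eq_iff forall_2)
    then show "x \<in> range vec_of" by blast
  qed
qed (auto simp: lattice2_def forall_2)

lemma lattice2_closed:
  "0 \<in> lattice2" "x \<in> lattice2 \<Longrightarrow> y \<in> lattice2 \<Longrightarrow> x + y \<in> lattice2"
  "x \<in> lattice2 \<Longrightarrow> y \<in> lattice2 \<Longrightarrow> x - y \<in> lattice2" "x \<in> lattice2 \<Longrightarrow> - x \<in> lattice2"
  by (auto simp: lattice2_def)

lemma lattice2_sum: "(\<And>i. i \<in> I \<Longrightarrow> f i \<in> lattice2) \<Longrightarrow> sum f I \<in> lattice2"
  by (induction I rule: infinite_finite_induct) (auto intro: lattice2_closed)

definition unimodular :: "real^2^2 \<Rightarrow> bool" where
  "unimodular M \<longleftrightarrow> (\<forall>i j. M $ i $ j \<in> \<int>) \<and> \<bar>det M\<bar> = 1"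

lemma unimodular_equiv_iff:
  "(P, Q) \<in> unimodular_equiv \<longleftrightarrow>
    (\<exists>M t. unimodular M \<and> t \<in> lattice2 \<and> Q = (\<lambda>x. M *v x + t) ` P)"
  by (auto simp: unimodular_equiv_def unimodular_def)

lemma unimodular_mult_lattice2: "unimodular M \<Longrightarrow> x \<in> lattice2 \<Longrightarrow> M *v x \<in> lattice2"
  by (auto simp: unimodular_def lattice2_def matrix_vector_mult_def intro!: Ints_sum Ints_mult)

lemma unimodular_mult:
  assumes "unimodular M" "unimodular N"
  shows "unimodular (M ** N)"
proof -
  have "(M ** N) $ i $ j \<in> \<int>" for i j
    using assms by (auto simp: unimodular_def matrix_matrix_mult_def intro!: Ints_sum Ints_mult)
  then show ?thesis using assms by (simp add: unimodular_def det_mul abs_mult)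
qed

lemma unimodular_one: "unimodular (mat 1)"
proof -
  have "(mat 1 :: real^2^2) $ i $ j \<in> \<int>" for i j by (simp add: mat_def)
  then show ?thesis by (simp add: unimodular_def)
qed

lemma det_scaleR_2: "det (c *\<^sub>R (M :: real^2^2)) = c * c * det M"
  by (simp add: det_2 algebra_simps)

lemma unimodular_det:
  assumes "unimodular M"
  shows "det M \<noteq> 0" "det M * det M = 1" "det M \<in> \<int>" "det (det M *\<^sub>R M) = det M"
proof -
  have "det M = 1 \<or> det M = -1" using assms by (auto simp: unimodular_def)
  then show "det M \<noteq> 0" "det M * det M = 1" "det M \<in> \<int>" "det (det M *\<^sub>R M) = det M"
    unfolding det_scaleR_2 by auto
qed

text \<open>
  The inverse of a matrix of determinant \<open>1\<close> or \<open>-1\<close>, written so that its entries are visibly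
  integral.
\<close>

definition adj2 :: "real^2^2 \<Rightarrow> real^2^2" where
  "adj2 M = det M *\<^sub>R vector [vector [M $ 2 $ 2, - (M $ 1 $ 2)], vector [- (M $ 2 $ 1), M $ 1 $ 1]]"

lemma unimodular_inverse:
  assumes "unimodular M"
  shows "unimodular (adj2 M)" "adj2 M *v (M *v x) = x" "M *v (adj2 M *v x) = x"
proof -
  have M: "M $ i $ j \<in> \<int>" "det M = 1 \<or> det M = -1" for i j
    using assms by (auto simp: unimodular_def)
  then have d: "det M * det M = 1" by auto
  have "det (adj2 M) = det M * det M * det M"
    by (simp add: adj2_def det_2 algebra_simps)
  then have "\<bar>det (adj2 M)\<bar> = 1" using M(2) by auto
  moreover have "adj2 M $ i $ j \<in> \<int>" for i j
    using M(1) M(2) exhaust_2[of i] exhaust_2[of j] by (auto simp: adj2_def)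
  ultimately show "unimodular (adj2 M)" by (simp add: unimodular_def)
  have "adj2 M *v (M *v x) = (det M * det M) *\<^sub>R x"
    by (simp add: adj2_def matrix_vector_mult_def vec_eq_iff forall_2 sum_2 det_2 algebra_simps)
  then show "adj2 M *v (M *v x) = x" using d by simp
  have "M *v (adj2 M *v x) = (det M * det M) *\<^sub>R x"
    by (simp add: adj2_def matrix_vector_mult_def vec_eq_iff forall_2 sum_2 det_2 algebra_simps)
  then show "M *v (adj2 M *v x) = x" using d by simp
qed

lemma unimodular_det_scale:
  assumes "unimodular M"
  shows "unimodular (det M *\<^sub>R M)"
proof -
  have "(det M *\<^sub>R M) $ i $ j \<in> \<int>" for i j
    using assms unimodular_det(3)[OF assms] by (simp add: unimodular_def Ints_mult)
  then show ?thesis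
    using assms unimodular_det(4)[OF assms] by (simp add: unimodular_def)
qed

lemma unimodular_inj: "unimodular M \<Longrightarrow> inj ((*v) M)"
  by (metis injI unimodular_inverse(2))

lemma equiv_unimodular_equiv: "equiv UNIV unimodular_equiv"
proof (rule equivI)
  show "unimodular_equiv \<subseteq> UNIV \<times> UNIV" by simp
  show "refl unimodular_equiv"
  proof (rule refl_onI)
    fix P :: "(real^2) set"
    have "P = (\<lambda>x. mat 1 *v x + 0) ` P" by simp
    then show "(P, P) \<in> unimodular_equiv"
      unfolding unimodular_equiv_iff using unimodular_one lattice2_closed(1) by blast
  qed
  show "sym unimodular_equiv"
  proof (rule symI)
    fix P Q assume "(P, Q) \<in> unimodular_equiv"
    then obtain M t where M: "unimodular M" "t \<in> lattice2" "Q = (\<lambda>x. M *v x + t) ` P"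
      by (auto simp: unimodular_equiv_iff)
    let ?N = "adj2 M"
    have "P = (\<lambda>x. ?N *v x + - (?N *v t)) ` Q"
      unfolding M(3) image_image using unimodular_inverse(2)[OF M(1)]
      by (simp add: matrix_vector_right_distrib)
    moreover have "- (?N *v t) \<in> lattice2"
      using unimodular_mult_lattice2[OF unimodular_inverse(1)[OF M(1)] M(2)]
      by (rule lattice2_closed)
    ultimately show "(Q, P) \<in> unimodular_equiv"
      unfolding unimodular_equiv_iff using unimodular_inverse(1)[OF M(1)] by blast
  qed
  show "trans unimodular_equiv"
  proof (rule transI)
    fix P Q R assume "(P, Q) \<in> unimodular_equiv" "(Q, R) \<in> unimodular_equiv"
    then obtain M t N s where
      M: "unimodular M" "t \<in> lattice2" "Q = (\<lambda>x. M *v x + t) ` P"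
      and N: "unimodular N" "s \<in> lattice2" "R = (\<lambda>x. N *v x + s) ` Q"
      by (auto simp: unimodular_equiv_iff)
    have "R = (\<lambda>x. (N ** M) *v x + (N *v t + s)) ` P"
      unfolding N(3) M(3) image_image
      by (simp add: matrix_vector_right_distrib matrix_vector_mul_assoc add.assoc)
    then show "(P, R) \<in> unimodular_equiv"
      unfolding unimodular_equiv_iff
      using unimodular_mult[OF N(1) M(1)] lattice2_closed(2)[OF unimodular_mult_lattice2[OF N(1) M(2)] N(2)]
      by blast
  qed
qed

lemma unimodular_equiv_sym: "(P, Q) \<in> unimodular_equiv \<Longrightarrow> (Q, P) \<in> unimodular_equiv"
  using equiv_unimodular_equiv by (auto simp: equiv_def dest: symD)

lemma unimodular_equiv_trans:
  "(P, Q) \<in> unimodular_equiv \<Longrightarrow> (Q, R) \<in> unimodular_equiv \<Longrightarrow> (P, R) \<in> unimodular_equiv"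
  using equiv_unimodular_equiv by (auto simp: equiv_def dest: transD)

lemma lattice_polygon_iff:
  "lattice_polygon Q \<longleftrightarrow> polygon Q \<and> (\<forall>x. x extreme_point_of Q \<longrightarrow> x \<in> lattice2)"
  by (auto simp: lattice_polygon_def polygon_def)

lemma edge_set_lattice: "lattice_polygon Q \<Longrightarrow> edge_set Q \<subseteq> lattice2"
  by (auto simp: edge_set_def lattice_polygon_iff intro!: lattice2_closed dest: oriented_edge_extreme)

lemma chain_vertex_lattice: "E \<subseteq> lattice2 \<Longrightarrow> chain_vertex E e \<in> lattice2"
  unfolding chain_vertex_def by (intro lattice2_sum) auto

lemma extreme_point_affine_image:
  fixes M :: "real^2^2"
  assumes "det M \<noteq> 0"
  shows "(M *v x + t) extreme_point_of (\<lambda>x. M *v x + t) ` Q \<longleftrightarrow> x extreme_point_of Q"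
  using affine_image_face_of[OF assms, of t "{x}" Q] by (simp add: face_of_singleton)

lemma lattice_polygon_affine_image:
  assumes M: "unimodular M" and t: "t \<in> lattice2" and Q: "lattice_polygon Q"
  shows "lattice_polygon ((\<lambda>x. M *v x + t) ` Q)"
proof -
  have nz: "det M \<noteq> 0" using M by (auto simp: unimodular_def)
  have "y \<in> lattice2" if y: "y extreme_point_of (\<lambda>x. M *v x + t) ` Q" for y
  proof -
    obtain x where x: "y = M *v x + t" using y by (auto simp: extreme_point_of_def)
    then have "x \<in> lattice2" using y extreme_point_affine_image[OF nz] Q by (auto simp: lattice_polygon_iff)
    then show ?thesis unfolding x using M t by (intro lattice2_closed unimodular_mult_lattice2)
  qed
  then show ?thesis using polygon_affine_image[OF nz] Q by (auto simp: lattice_polygon_iff)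
qed

lemma lattice_polygon_translate_of_chain_hull:
  assumes Q: "lattice_polygon Q"
  obtains c where "c \<in> lattice2"
    "Q = (+) c ` (convex hull (chain_vertex (edge_set Q) ` edge_set Q))"
proof -
  let ?E = "edge_set Q"
  have P: "polygon Q" using Q by (simp add: lattice_polygon_iff)
  obtain c where c: "Q = (+) c ` (convex hull (chain_vertex ?E ` ?E))"
    "\<And>e. e \<in> ?E \<Longrightarrow> (c + chain_vertex ?E e) extreme_point_of Q"
    using polygon_eq_translate_of_chain_hull[OF P] by metis
  obtain e where "e \<in> ?E" using card_edge_set_ge_3[OF P] by fastforce
  then have "c + chain_vertex ?E e \<in> lattice2" using c(2) Q by (auto simp: lattice_polygon_iff)
  then have "(c + chain_vertex ?E e) - chain_vertex ?E e \<in> lattice2"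
    using chain_vertex_lattice[OF edge_set_lattice[OF Q]] by (rule lattice2_closed)
  then show ?thesis using that c(1) by simp
qed

text \<open>
  The translation between two polygons with the same edge vectors is integral, because both have
  lattice vertices. The sign in the action on edge sets is harmless, since \<open>det M *\<^sub>R M\<close> is
  unimodular together with \<open>M\<close>.
\<close>

theorem unimodular_equiv_iff_edge_set:
  assumes P: "lattice_polygon P" and Q: "lattice_polygon Q"
  shows "(P, Q) \<in> unimodular_equiv \<longleftrightarrow> (\<exists>M. unimodular M \<and> edge_set Q = (*v) M ` edge_set P)"
proof
  assume "(P, Q) \<in> unimodular_equiv"
  then obtain M t where M: "unimodular M" "Q = (\<lambda>x. M *v x + t) ` P"
    by (auto simp: unimodular_equiv_iff)
  have "edge_set Q = (\<lambda>v. det M *\<^sub>R (M *v v)) ` edge_set P"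
    unfolding M(2) using M(1) by (intro edge_set_affine_image) (simp add: unimodular_def)
  also have "\<dots> = (*v) (det M *\<^sub>R M) ` edge_set P"
    by (simp add: scaleR_matrix_vector_assoc)
  finally show "\<exists>M. unimodular M \<and> edge_set Q = (*v) M ` edge_set P"
    using unimodular_det_scale[OF M(1)] by blast
next
  assume "\<exists>M. unimodular M \<and> edge_set Q = (*v) M ` edge_set P"
  then obtain M where M: "unimodular M" "edge_set Q = (*v) M ` edge_set P" by blast
  let ?N = "det M *\<^sub>R M"
  let ?P = "(\<lambda>x. ?N *v x + 0) ` P"
  have N: "unimodular ?N" using M(1) by (rule unimodular_det_scale)
  note dd = unimodular_det(2,4)[OF M(1)]
  have "edge_set ?P = (\<lambda>v. det ?N *\<^sub>R (?N *v v)) ` edge_set P"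
    using N by (intro edge_set_affine_image) (simp add: unimodular_def)
  also have "\<dots> = edge_set Q"
    unfolding M(2) dd(2) using dd(1) by (simp flip: scaleR_matrix_vector_assoc)
  finally have E: "edge_set ?P = edge_set Q" .
  have "lattice_polygon ?P" using N P by (intro lattice_polygon_affine_image lattice2_closed)
  then obtain c where c: "c \<in> lattice2"
    "?P = (+) c ` (convex hull (chain_vertex (edge_set Q) ` edge_set Q))"
    using lattice_polygon_translate_of_chain_hull[of ?P] unfolding E by blast
  obtain d where d: "d \<in> lattice2"
    "Q = (+) d ` (convex hull (chain_vertex (edge_set Q) ` edge_set Q))"
    using lattice_polygon_translate_of_chain_hull[OF Q] by blast
  have "Q = (+) (d - c) ` ?P"
    unfolding c(2) by (subst d(2)) (simp add: image_image)
  then have "Q = (\<lambda>x. ?N *v x + (d - c)) ` P"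
    by (simp add: image_image add.commute)
  then show "(P, Q) \<in> unimodular_equiv"
    unfolding unimodular_equiv_iff using N lattice2_closed(3)[OF d(1) c(1)] by blast
qed

lemma unimodular_equiv_lattice_polygon:
  "(P, Q) \<in> unimodular_equiv \<Longrightarrow> lattice_polygon P \<Longrightarrow> lattice_polygon Q"
  by (auto simp: unimodular_equiv_iff intro: lattice_polygon_affine_image)

text \<open>
  A unimodular affine map is a bijection on lattice points and on extreme points.
\<close>

lemma terminal_cone_mono:
  assumes "(P, Q) \<in> unimodular_equiv" "terminal_cone P"
  shows "terminal_cone Q"
  unfolding terminal_cone_iff
proof
  obtain M t where M: "unimodular M" "t \<in> lattice2" "Q = (\<lambda>x. M *v x + t) ` P"
    using assms(1) by (auto simp: unimodular_equiv_iff)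
  have nz: "det M \<noteq> 0" using M by (auto simp: unimodular_def)
  fix y assume y: "y \<in> Q \<inter> lattice2"
  then obtain x where x: "x \<in> P" "y = M *v x + t" using M by auto
  have "adj2 M *v (y - t) \<in> lattice2"
    using y M by (intro unimodular_mult_lattice2 unimodular_inverse lattice2_closed) auto
  then have "x \<in> lattice2" using x unimodular_inverse(2)[OF M(1)] by simp
  then have "x extreme_point_of P" using x assms(2) by (auto simp: terminal_cone_iff)
  then show "y extreme_point_of Q" unfolding x M(3) extreme_point_affine_image[OF nz] .
qed

lemma terminal_cone_cong: "(P, Q) \<in> unimodular_equiv \<Longrightarrow> terminal_cone P \<longleftrightarrow> terminal_cone Q"
  using terminal_cone_mono unimodular_equiv_sym by blast

lemma interior_lattice_point_not_terminal:
  assumes "x \<in> interior Q" "x \<in> lattice2"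
  shows "\<not> terminal_cone Q"
  using assms interior_subset extreme_point_not_in_interior unfolding terminal_cone_iff by blast

lemma edge_vectors_equiv:
  assumes P: "lattice_polygon P" and PQ: "(P, Q) \<in> unimodular_equiv"
  obtains M where "unimodular M" "edge_vectors Q = image_mset ((*v) M) (edge_vectors P)"
proof -
  have Q: "lattice_polygon Q" using unimodular_equiv_lattice_polygon[OF PQ P] .
  obtain M where M: "unimodular M" "edge_set Q = (*v) M ` edge_set P"
    using PQ unimodular_equiv_iff_edge_set[OF P Q] by blast
  have "edge_vectors Q = image_mset ((*v) M) (edge_vectors P)"
    using P Q M(2) image_mset_mset_set[OF inj_on_subset[OF unimodular_inj[OF M(1)]], of "edge_set P"]
    by (simp add: lattice_polygon_iff edge_vectors_eq_mset_set)
  then show ?thesis using that M(1) by blast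
qed

lemma sum_mset_matrix_image: "\<Sum>\<^sub># (image_mset ((*v) M) F) = (M :: real^2^2) *v \<Sum>\<^sub># F"
  by (induction F) (simp_all add: matrix_vector_right_distrib)

lemma has_zero_sum_part_matrix_image:
  assumes "has_zero_sum_part E"
  shows "has_zero_sum_part (image_mset ((*v) (M :: real^2^2)) E)"
proof -
  obtain F where F: "F \<subset># E" "F \<noteq> {#}" "\<Sum>\<^sub># F = 0"
    using assms by (auto simp: has_zero_sum_part_def)
  then show ?thesis
    unfolding has_zero_sum_part_def
    by (intro exI[of _ "image_mset ((*v) M) F"])
      (auto simp: image_mset_subset_mono sum_mset_matrix_image)
qed

lemma has_smoothing_partition_matrix_image:
  assumes "has_smoothing_partition E" "unimodular M"
  shows "has_smoothing_partition (image_mset ((*v) M) E)"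
proof -
  obtain \<P> where P: "\<Sum>\<^sub># \<P> = E" "\<And>B. B \<in># \<P> \<Longrightarrow> opposite_pair B \<or> unimodular_triple B"
    using assms(1) by (auto simp: has_smoothing_partition_def)
  have "\<Sum>\<^sub># (image_mset (image_mset ((*v) M)) \<P>) = image_mset ((*v) M) (\<Sum>\<^sub># \<P>)"
    by (induction \<P>) auto
  moreover have "opposite_pair (image_mset ((*v) M) B)" if B: "opposite_pair B" for B
  proof -
    obtain v where "B = {#v, - v#}" using B by (auto simp: opposite_pair_def)
    then have "image_mset ((*v) M) B = {#M *v v, - (M *v v)#}"
      using matrix_vector_mult_diff_distrib[of M 0 v] by simp
    then show ?thesis by (auto simp: opposite_pair_def)
  qed
  moreover have "unimodular_triple (image_mset ((*v) M) B)" if B: "unimodular_triple B" for B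
  proof -
    obtain a b c where "B = {#a, b, c#}" "a + b + c = 0" "\<bar>det (vector [a, b] :: real^2^2)\<bar> = 1"
      using B by (auto simp: unimodular_triple_def)
    moreover from this have "M *v a + M *v b + M *v c = 0"
      by (metis matrix_vector_mult_0_right matrix_vector_right_distrib)
    ultimately show ?thesis
      unfolding unimodular_triple_def using assms(2)
      by (intro exI[of _ "M *v a"] exI[of _ "M *v b"] exI[of _ "M *v c"])
        (auto simp: det_vector_eq_det2 det2_matrix unimodular_def abs_mult)
  qed
  ultimately show ?thesis
    unfolding has_smoothing_partition_def using P
    by (intro exI[of _ "image_mset (image_mset ((*v) M)) \<P>"]) auto
qed

lemma types_cong:
  assumes "lattice_polygon P" "(P, Q) \<in> unimodular_equiv"
  shows "reduced_rigid P \<longleftrightarrow> reduced_rigid Q"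
    "deformable_non_smoothable P \<longleftrightarrow> deformable_non_smoothable Q"
    "smoothable P \<longleftrightarrow> smoothable Q"
proof -
  have *: "has_zero_sum_part (edge_vectors P) \<Longrightarrow> has_zero_sum_part (edge_vectors Q)"
    "has_smoothing_partition (edge_vectors P) \<Longrightarrow> has_smoothing_partition (edge_vectors Q)"
    if "lattice_polygon P" "(P, Q) \<in> unimodular_equiv" for P Q
    using edge_vectors_equiv[OF that] has_zero_sum_part_matrix_image
      has_smoothing_partition_matrix_image by metis+
  have "lattice_polygon Q" "(Q, P) \<in> unimodular_equiv"
    using assms unimodular_equiv_lattice_polygon unimodular_equiv_sym by blast+
  note 1 = *[OF assms] and 2 = *[OF this]
  show "reduced_rigid P \<longleftrightarrow> reduced_rigid Q"
    "deformable_non_smoothable P \<longleftrightarrow> deformable_non_smoothable Q"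
    "smoothable P \<longleftrightarrow> smoothable Q"
    unfolding reduced_rigid_def deformable_non_smoothable_def smoothable_def using 1 2 by blast+
qed

section \<open>Polygons from lists of integer vectors\<close>

text \<open>
  The second condition says that the counterclockwise step from \<open>u\<close> to \<open>v\<close> does not cross the
  positive horizontal axis, where the angle jumps from \<open>2 \<pi>\<close> to \<open>0\<close>.
\<close>

fun ccw_step :: "ivec \<Rightarrow> ivec \<Rightarrow> bool" where
  "ccw_step u v \<longleftrightarrow> idet u v > 0 \<and> (snd u \<ge> 0 \<or> snd v < 0)"

text \<open>
  Lists of edge vectors, starting with the least angle, for which \<open>closed_edge_system\<close> holds:
  consecutive vectors turn strictly to the left, so they are nonzero, distinct in direction and
  not all parallel.
\<close>

definition ccw_closed :: "ivec list \<Rightarrow> bool" where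
  "ccw_closed A \<longleftrightarrow> 2 \<le> length A \<and> successively ccw_step A \<and> sum_list A = 0"

fun partial_sums :: "ivec \<Rightarrow> ivec list \<Rightarrow> ivec list" where
  "partial_sums c [] = []"
| "partial_sums c (v # vs) = c # partial_sums (c + v) vs"

definition polygon_of :: "ivec list \<Rightarrow> (real^2) set" where
  "polygon_of A = convex hull (vec_of ` set (partial_sums 0 A))"

lemma ccw_step_angle:
  assumes "ccw_step u v"
  shows "angle (vec_of u) < angle (vec_of v)"
proof (rule ccontr)
  assume c: "\<not> ?thesis"
  have pos: "det2 (vec_of u) (vec_of v) > 0" using assms by (simp add: det2_vec_of)
  then have nz: "vec_of u \<noteq> 0" "vec_of v \<noteq> 0" by (metis det2_simps(10,11) less_irrefl)+
  have less: "angle (vec_of v) < angle (vec_of u) - pi"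
    using det2_pos_iff[OF nz] pos c by auto
  show False
  proof (cases "snd u \<ge> 0")
    case True
    then have "angle (vec_of u) \<le> pi" by (simp add: angle_def Arg2pi_le_pi)
    then show False using less angle_bounds[of "vec_of v"] by simp
  next
    case False
    then have "\<not> angle (vec_of v) \<le> pi" using assms by (simp add: angle_def Arg2pi_le_pi)
    then show False using less angle_bounds[of "vec_of u"] by simp
  qed
qed

lemma successively_ccw_sorted:
  "successively ccw_step A \<Longrightarrow> sorted_wrt (\<lambda>u v. angle (vec_of u) < angle (vec_of v)) A"
proof -
  assume "successively ccw_step A"
  then have "successively (\<lambda>u v. angle (vec_of u) < angle (vec_of v)) A"
    by (rule successively_mono) (rule ccw_step_angle)
  moreover have "transp (\<lambda>u v. angle (vec_of u) < angle (vec_of v))"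
    by (auto intro: transpI)
  ultimately show ?thesis by (simp add: successively_iff_sorted_wrt_strong transp_on_def
      successively_conv_sorted_wrt)
qed

lemma ccw_closed_distinct: "ccw_closed A \<Longrightarrow> distinct A"
proof -
  assume "ccw_closed A"
  then have "sorted_wrt (\<lambda>u v. angle (vec_of u) < angle (vec_of v)) A"
    by (simp add: ccw_closed_def successively_ccw_sorted)
  then show ?thesis by (induction A) auto
qed

lemma sum_vec_of_list: "distinct A \<Longrightarrow> \<Sum>(vec_of ` set A) = vec_of (sum_list A)"
  by (induction A) (auto simp: vec_of_simps image_iff)

lemma ccw_closed_edge_system:
  assumes A: "ccw_closed A"
  shows "closed_edge_system (vec_of ` set A)"
proof
  note sorted = successively_ccw_sorted[of A]
  have s: "sorted_wrt (\<lambda>u v. angle (vec_of u) < angle (vec_of v)) A"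
    using A by (simp add: ccw_closed_def sorted)
  show "finite (vec_of ` set A)" by simp
  obtain u v B where B: "A = u # v # B"
    using A by (cases A rule: remdups_adj.cases) (auto simp: ccw_closed_def)
  have nz: "\<forall>w\<in>set A. w \<noteq> 0" if "successively ccw_step A" "2 \<le> length A" for A
    using that
  proof (induction A rule: induct_list012)
    case (3 x y zs)
    then have "ccw_step x y" by simp
    then have "x \<noteq> 0" "y \<noteq> 0" by (auto simp: idet_def)
    then show ?case using 3 by (cases zs) auto
  qed auto
  show "0 \<notin> vec_of ` set A" using A nz by (auto simp: ccw_closed_def)
  show "inj_on angle (vec_of ` set A)"
  proof (rule inj_onI, clarify)
    fix a b aa ba
    assume "(a, b) \<in> set A" "(aa, ba) \<in> set A" "angle (vec_of (a, b)) = angle (vec_of (aa, ba))"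
    moreover have "distinct (map (\<lambda>u. angle (vec_of u)) A)"
      using s by (induction A) auto
    ultimately show "vec_of (a, b) = vec_of (aa, ba)"
      by (auto simp: distinct_map dest: inj_onD)
  qed
  show "\<Sum>(vec_of ` set A) = 0"
    using A ccw_closed_distinct[OF A] by (simp add: sum_vec_of_list ccw_closed_def vec_of_simps)
  have "ccw_step u v" using A B by (simp add: ccw_closed_def)
  then have "det2 (vec_of u) (vec_of v) \<noteq> 0" by (simp add: det2_vec_of)
  then show "\<exists>e\<in>vec_of ` set A. \<exists>g\<in>vec_of ` set A. det2 e g \<noteq> 0" using B by auto
qed

lemma chain_vertex_partial_sums:
  assumes "sorted_wrt (\<lambda>u v. angle (vec_of u) < angle (vec_of v)) (B @ A)" "distinct (B @ A)"
  shows "map (\<lambda>v. chain_vertex (vec_of ` set (B @ A)) (vec_of v)) A =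
    map vec_of (partial_sums (sum_list B) A)"
  using assms
proof (induction A arbitrary: B)
  case (Cons v A)
  have "{g \<in> vec_of ` set (B @ v # A). angle g < angle (vec_of v)} = vec_of ` set B"
    using Cons.prems(1) by (auto simp: sorted_wrt_append)
  then have "chain_vertex (vec_of ` set (B @ v # A)) (vec_of v) = vec_of (sum_list B)"
    unfolding chain_vertex_def using Cons.prems(2) by (simp add: sum_vec_of_list)
  then show ?case using Cons.IH[of "B @ [v]"] Cons.prems by simp
qed simp

lemma chain_vertex_ccw_closed:
  assumes "ccw_closed A"
  shows "map (\<lambda>v. chain_vertex (vec_of ` set A) (vec_of v)) A = map vec_of (partial_sums 0 A)"
  using chain_vertex_partial_sums[of "[]" A] assms ccw_closed_distinct[OF assms]
  by (simp add: ccw_closed_def successively_ccw_sorted)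

lemma polygon_of_eq_chain_hull:
  assumes "ccw_closed A"
  shows "polygon_of A = convex hull (chain_vertex (vec_of ` set A) ` vec_of ` set A)"
  using chain_vertex_ccw_closed[OF assms, THEN arg_cong, of set]
  by (simp add: polygon_of_def image_image)

lemma
  assumes A: "ccw_closed A"
  shows polygon_polygon_of: "polygon (polygon_of A)"
    and edge_set_polygon_of: "edge_set (polygon_of A) = vec_of ` set A"
    and edge_vectors_polygon_of: "edge_vectors (polygon_of A) = mset (map vec_of A)"
    and lattice_polygon_polygon_of: "lattice_polygon (polygon_of A)"
proof -
  interpret closed_edge_system "vec_of ` set A" by (rule ccw_closed_edge_system[OF A])
  show p: "polygon (polygon_of A)"
    unfolding polygon_of_eq_chain_hull[OF A] by (rule chain_hull_polygon)
  show e: "edge_set (polygon_of A) = vec_of ` set A"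
    unfolding polygon_of_eq_chain_hull[OF A] by (rule edge_set_chain_hull)
  have "edge_vectors (polygon_of A) = image_mset vec_of (mset_set (set A))"
    using edge_vectors_eq_mset_set[OF p] e
    by (simp add: image_mset_mset_set inj_on_subset[OF inj_vec_of])
  then show "edge_vectors (polygon_of A) = mset (map vec_of A)"
    using ccw_closed_distinct[OF A] by (simp add: mset_set_set)
  show "lattice_polygon (polygon_of A)"
    using p extreme_point_of_convex_hull
    unfolding lattice_polygon_iff polygon_of_def lattice2_eq_range by blast
qed

text \<open>
  Here \<open>c\<close> runs through the starting points of the edges.
\<close>

fun left_of_all :: "ivec \<Rightarrow> ivec \<Rightarrow> ivec list \<Rightarrow> bool" where
  "left_of_all x c [] = True"
| "left_of_all x c (v # vs) = (if idet v (x - c) > 0 then left_of_all x (c + v) vs else False)"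

lemma left_of_all_iff:
  "left_of_all x c A \<longleftrightarrow> (\<forall>(v, q)\<in>set (zip A (partial_sums c A)). idet v (x - q) > 0)"
  by (induction A arbitrary: c) auto

lemma interior_polygon_of:
  assumes A: "ccw_closed A"
  shows "vec_of x \<in> interior (polygon_of A) \<longleftrightarrow> left_of_all x 0 A"
proof -
  interpret closed_edge_system "vec_of ` set A" by (rule ccw_closed_edge_system[OF A])
  let ?p = "chain_vertex (vec_of ` set A)"
  have len: "length (partial_sums c A) = length A" for c A by (induction A arbitrary: c) auto
  have nth: "?p (vec_of (A ! i)) = vec_of (partial_sums 0 A ! i)" if "i < length A" for i
    using chain_vertex_ccw_closed[OF A] that len by (metis (no_types, lifting) nth_map)
  have "vec_of x \<in> interior (polygon_of A) \<longleftrightarrow>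
      (\<forall>e\<in>vec_of ` set A. 0 < det2 e (vec_of x - ?p e))"
    unfolding polygon_of_eq_chain_hull[OF A] polygon_interior[OF chain_hull_polygon]
      oriented_edges_chain_hull by (simp del: det2_simps)
  also have "\<dots> \<longleftrightarrow> (\<forall>i<length A. 0 < det2 (vec_of (A ! i)) (vec_of x - ?p (vec_of (A ! i))))"
    by (simp add: all_set_conv_all_nth del: det2_simps)
  also have "\<dots> \<longleftrightarrow> (\<forall>i<length A. 0 < idet (A ! i) (x - partial_sums 0 A ! i))"
    by (simp add: nth det2_vec_of del: det2_simps flip: vec_of_simps)
  also have "\<dots> \<longleftrightarrow> left_of_all x 0 A"
    unfolding left_of_all_iff by (simp add: all_set_conv_all_nth len split_beta)
  finally show ?thesis .
qed

lemma num_edges_polygon_of: "ccw_closed A \<Longrightarrow> num_edges (polygon_of A) = length A"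
  using ccw_closed_distinct[of A]
  by (simp add: num_edges_eq polygon_polygon_of edge_set_polygon_of card_image
      inj_on_subset[OF inj_vec_of] distinct_card)

definition grid :: "int \<Rightarrow> ivec list" where
  "grid m = List.product [- m..m] [- m..m]"

lemma num_interior_polygon_of:
  assumes A: "ccw_closed A"
    and box: "\<forall>(a, b)\<in>set (partial_sums 0 A). \<bar>a\<bar> \<le> m \<and> \<bar>b\<bar> \<le> m"
  shows "num_interior (polygon_of A) = length (filter (\<lambda>x. left_of_all x 0 A) (grid m))"
proof -
  have "convex {x :: real^2. \<bar>x $ 1\<bar> \<le> of_int m \<and> \<bar>x $ 2\<bar> \<le> of_int m}" for m
  proof -
    have "{x :: real^2. \<bar>x $ 1\<bar> \<le> of_int m \<and> \<bar>x $ 2\<bar> \<le> of_int m} = cbox (vector [- m, - m]) (vector [m, m])"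
      by (auto simp: mem_box_cart forall_2)
    then show ?thesis by simp
  qed
  then have sub: "polygon_of A \<subseteq> {x. \<bar>x $ 1\<bar> \<le> of_int m \<and> \<bar>x $ 2\<bar> \<le> of_int m}"
    unfolding polygon_of_def using box by (intro hull_minimal) fastforce+
  have "interior (polygon_of A) \<inter> lattice2 = vec_of ` set (filter (\<lambda>x. left_of_all x 0 A) (grid m))"
  proof (intro equalityI subsetI)
    fix y assume y: "y \<in> interior (polygon_of A) \<inter> lattice2"
    then obtain x where x: "y = vec_of x" by (auto simp: lattice2_eq_range)
    have "y \<in> polygon_of A" using y interior_subset by auto
    then have "\<bar>fst x\<bar> \<le> m" "\<bar>snd x\<bar> \<le> m" using sub x by (auto simp flip: of_int_abs)
    then have "x \<in> set (grid m)" by (cases x) (auto simp: grid_def)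
    then show "y \<in> vec_of ` set (filter (\<lambda>x. left_of_all x 0 A) (grid m))"
      using y x interior_polygon_of[OF A] by auto
  qed (auto simp: interior_polygon_of[OF A] lattice2_eq_range)
  moreover have "distinct (grid m)" by (simp add: grid_def distinct_product)
  ultimately show ?thesis
    unfolding num_interior_def
    by (simp add: card_image inj_on_subset[OF inj_vec_of] distinct_card[symmetric] flip: set_filter)
qed

section \<open>Enumeration of zero-sum sets\<close>

text \<open>
  The functions that follow are meant to be evaluated by rewriting on more than a thousand lists.
  Rewriting revisits the arguments of a conditional and enters the body of an abstraction, so
  loops that carry large tables are written with plain connectives or dispatch on a Boolean
  argument by pattern matching.
\<close>

fun mem :: "ivec \<Rightarrow> ivec list \<Rightarrow> bool" where
  "mem v [] = False"
| "mem v (w # ws) = (v = w \<or> mem v ws)"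

lemma mem_iff [simp]: "mem v ws \<longleftrightarrow> v \<in> set ws"
  by (induction ws) auto

fun subset_list :: "ivec list \<Rightarrow> ivec list \<Rightarrow> bool" where
  "subset_list [] B = True"
| "subset_list (v # vs) B = (mem v B \<and> subset_list vs B)"

lemma subset_list_iff: "subset_list A B \<longleftrightarrow> set A \<subseteq> set B"
  by (induction A) auto

text \<open>
  Every axis \<open>v\<close> contributes \<open>v\<close>, \<open>- v\<close>, nothing, or both. The last two cases leave the required
  sum unchanged, so that the list \<open>L\<close> of completions is computed only once.
\<close>

fun extend_lists :: "ivec \<Rightarrow> ivec list list \<Rightarrow> ivec list list \<Rightarrow> ivec list list \<Rightarrow> ivec list list" where
  "extend_lists v P N L = map ((#) v) P @ map ((#) (- v)) N @ L @ map ((#) v) (map ((#) (- v)) L)"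

text \<open>
  All sets \<open>S\<close> of vectors from \<open>vs\<close> and their negatives whose sum, added to \<open>s\<close>, vanishes.
\<close>

fun zero_sum_lists :: "ivec list \<Rightarrow> ivec \<Rightarrow> ivec list list" where
  "zero_sum_lists [] s = (if s = 0 then [[]] else [])"
| "zero_sum_lists (v # vs) s =
    extend_lists v (zero_sum_lists vs (s + v)) (zero_sum_lists vs (s - v)) (zero_sum_lists vs s)"

lemma zero_sum_lists_complete:
  assumes "S \<subseteq> set vs \<union> uminus ` set vs" "distinct (vs @ map uminus vs)" "s + \<Sum>S = 0"
  shows "\<exists>L\<in>set (zero_sum_lists vs s). set L = S"
  using assms
proof (induction vs arbitrary: s S)
  case (Cons v vs)
  let ?S = "S - {v, - v}"
  have fin: "finite S" using Cons.prems(1) by (rule finite_subset) simp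
  have sub: "?S \<subseteq> set vs \<union> uminus ` set vs" using Cons.prems(1) by auto
  have dist: "distinct (vs @ map uminus vs)" using Cons.prems(2) by auto
  have ne: "v \<noteq> - v" using Cons.prems(2) by auto
  note IH = Cons.IH[OF sub dist]
  consider "v \<in> S" "- v \<in> S" | "v \<in> S" "- v \<notin> S" | "v \<notin> S" "- v \<in> S" | "v \<notin> S" "- v \<notin> S"
    by blast
  then show ?case
  proof cases
    case 1
    then have S: "S = insert v (insert (- v) ?S)" by auto
    have "\<Sum>S = \<Sum>?S" using fin ne by (subst S) simp
    then obtain L where "L \<in> set (zero_sum_lists vs s)" "set L = ?S"
      using IH[of s] Cons.prems(3) by metis
    then show ?thesis using S by (intro bexI[of _ "v # - v # L"]) auto
  next
    case 2
    then have S: "S = insert v ?S" by auto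
    have "\<Sum>S = v + \<Sum>?S" using fin by (subst S) simp
    then obtain L where "L \<in> set (zero_sum_lists vs (s + v))" "set L = ?S"
      using IH[of "s + v"] Cons.prems(3) by (auto simp: add.assoc)
    then show ?thesis using S by (intro bexI[of _ "v # L"]) auto
  next
    case 3
    then have S: "S = insert (- v) ?S" by auto
    have "\<Sum>S = - v + \<Sum>?S" using fin by (subst S) simp
    then have "s - v + \<Sum>?S = 0" using Cons.prems(3) by (simp only: diff_conv_add_uminus add.assoc)
    then obtain L where "L \<in> set (zero_sum_lists vs (s - v))" "set L = ?S" using IH by metis
    then show ?thesis using S by (intro bexI[of _ "- v # L"]) auto
  next
    case 4
    then have S: "S = ?S" by auto
    then obtain L where "L \<in> set (zero_sum_lists vs s)" "set L = S"
      using IH[of s] Cons.prems(3) by auto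
    then show ?thesis by (intro bexI[of _ L]) auto
  qed
qed simp

type_synonym imat = "int \<times> int \<times> int \<times> int"

fun iact :: "imat \<Rightarrow> ivec \<Rightarrow> ivec" where
  "iact (a, b, c, d) (x, y) = (a * x + b * y, c * x + d * y)"

fun mat_of :: "imat \<Rightarrow> real^2^2" where
  "mat_of (a, b, c, d) = vector [vector [of_int a, of_int b], vector [of_int c, of_int d]]"

fun is_unimodular :: "imat \<Rightarrow> bool" where
  "is_unimodular (a, b, c, d) \<longleftrightarrow> \<bar>a * d - b * c\<bar> = 1"

lemma mat_of_mult: "mat_of M *v vec_of v = vec_of (iact M v)"
  by (cases M; cases v) (simp add: vec_eq_iff forall_2 matrix_vector_mult_def sum_2)

lemma unimodular_mat_of: "is_unimodular M \<Longrightarrow> unimodular (mat_of M)"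
  by (cases M) (auto simp: unimodular_def det_2 forall_2 simp flip: of_int_mult of_int_diff of_int_abs)

fun short :: "ivec list \<Rightarrow> bool" where
  "short (a # b # c # S) = False"
| "short _ = True"

lemma short_iff: "short S \<longleftrightarrow> length S < 3"
  by (induction S rule: short.induct) auto

section \<open>A separating invariant\<close>

fun square_row :: "ivec \<Rightarrow> ivec list \<Rightarrow> int" where
  "square_row v [] = 0"
| "square_row v (w # ws) = (idet v w)\<^sup>2 + square_row v ws"

fun square_rows :: "ivec list \<Rightarrow> ivec list \<Rightarrow> int list" where
  "square_rows [] B = []"
| "square_rows (v # vs) B = square_row v B # square_rows vs B"

fun weighted_row :: "ivec \<Rightarrow> ivec list \<Rightarrow> int list \<Rightarrow> int" where
  "weighted_row v (w # ws) (t # ts) = idet v w * t + weighted_row v ws ts"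
| "weighted_row v _ _ = 0"

fun moment_sum :: "ivec list \<Rightarrow> int list \<Rightarrow> ivec list \<Rightarrow> int list \<Rightarrow> int" where
  "moment_sum (v # vs) (s # ss) A T = s ^ 3 + (weighted_row v A T)\<^sup>2 + moment_sum vs ss A T"
| "moment_sum _ _ A T = 0"

fun moment_with :: "ivec list \<Rightarrow> int list \<Rightarrow> int" where
  "moment_with A T = moment_sum A T A T"

text \<open>
  For a set of vectors \<open>A\<close> put \<open>T v = (\<Sum>w\<in>A. det(v, w)\<^sup>2)\<close>. The moment is the sum over \<open>v \<in> A\<close> of
  \<open>T v ^ 3 + (\<Sum>w\<in>A. det(v, w) * T w)\<^sup>2\<close>. The inner sum is odd in the determinant and occurs
  squared, so a unimodular map of either sign preserves the moment. This signed sum separates edge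
  sets whose determinants agree only up to individual signs. The list \<open>T\<close> of row values is passed
  along in order to be computed once.
\<close>

definition moment :: "ivec list \<Rightarrow> int" where
  "moment A = moment_with A (square_rows A A)"

definition row_moment :: "(real^2) set \<Rightarrow> real^2 \<Rightarrow> real" where
  "row_moment S v = (\<Sum>w\<in>S. (det2 v w)\<^sup>2)"

definition set_moment :: "(real^2) set \<Rightarrow> real" where
  "set_moment S = (\<Sum>v\<in>S. row_moment S v ^ 3 + (\<Sum>w\<in>S. det2 v w * row_moment S w)\<^sup>2)"

text \<open>
  A unimodular map multiplies every determinant by the same sign.
\<close>

lemma set_moment_unimodular_image:
  assumes M: "unimodular M"
  shows "set_moment ((*v) M ` S) = set_moment S"
proof -
  have inj: "inj_on ((*v) M) S" using unimodular_inj[OF M] by (rule inj_on_subset) simp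
  have d: "det M = 1 \<or> det M = -1" using M by (auto simp: unimodular_def)
  then have sq: "(det M * x)\<^sup>2 = x\<^sup>2" for x by auto
  have row: "row_moment ((*v) M ` S) (M *v v) = row_moment S v" for v
    unfolding row_moment_def by (simp add: sum.reindex[OF inj] det2_matrix sq)
  have "(\<Sum>w\<in>S. det M * det2 v w * row_moment S w) = det M * (\<Sum>w\<in>S. det2 v w * row_moment S w)" for v
    by (simp add: sum_distrib_left mult.assoc)
  then show ?thesis
    unfolding set_moment_def by (simp add: sum.reindex[OF inj] det2_matrix row sq)
qed

lemma square_row_eq: "square_row v A = (\<Sum>w\<leftarrow>A. (idet v w)\<^sup>2)"
  by (induction A) auto

lemma square_rows_eq: "square_rows A B = map (\<lambda>v. square_row v B) A"
  by (induction A) auto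

lemma weighted_row_eq: "weighted_row v A (map t A) = (\<Sum>w\<leftarrow>A. idet v w * t w)"
  by (induction A) auto

lemma moment_sum_eq:
  "moment_sum A (map t A) B T = (\<Sum>v\<leftarrow>A. t v ^ 3 + (weighted_row v B T)\<^sup>2)"
  by (induction A) auto

lemma moment_eq_set_moment:
  assumes "distinct A"
  shows "of_int (moment A) = set_moment (vec_of ` set A)"
proof -
  have inj: "inj_on vec_of S" for S using inj_vec_of by (rule inj_on_subset) simp
  have *: "(\<Sum>w\<leftarrow>A. f w) = (\<Sum>w\<in>set A. f w)" for f :: "ivec \<Rightarrow> int"
    using assms by (simp add: sum_list_distinct_conv_sum_set)
  show ?thesis
    unfolding moment_def moment_with.simps square_rows_eq moment_sum_eq weighted_row_eq
      square_row_eq * set_moment_def row_moment_def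
    by (simp add: sum.reindex[OF inj] det2_vec_of)
qed

section \<open>Matching zero-sum sets with representatives\<close>

text \<open>
  A search tree for the representatives, keyed by their moments: a zero-sum set can only be
  equivalent to the representative of the same moment, so that one comparison suffices.
\<close>

datatype table = Leaf | Branch table int "ivec list" table

fun table_entries :: "table \<Rightarrow> ivec list set" where
  "table_entries Leaf = {}"
| "table_entries (Branch l k R r) = table_entries l \<union> {R} \<union> table_entries r"

fun join_tables :: "table \<Rightarrow> ivec list \<Rightarrow> table \<times> ivec list list \<Rightarrow> table \<times> ivec list list" where
  "join_tables l R (r, Rs) = (Branch l (moment R) R r, Rs)"

fun attach_table :: "(ivec list list \<Rightarrow> table \<times> ivec list list) \<Rightarrow> table \<times> ivec list list \<Rightarrow>
    table \<times> ivec list list" where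
  "attach_table f (l, []) = (l, [])"
| "attach_table f (l, R # Rs) = join_tables l R (f Rs)"

text \<open>
  Builds a balanced tree of depth at most \<open>d\<close> from a list that is sorted by moment, and returns
  the unused rest of the list.
\<close>

fun build_table :: "nat \<Rightarrow> ivec list list \<Rightarrow> table \<times> ivec list list" where
  "build_table 0 Rs = (Leaf, Rs)"
| "build_table (Suc d) Rs = attach_table (build_table d) (build_table d Rs)"

lemma build_table_entries:
  "build_table d Rs = (t, Rs') \<Longrightarrow> table_entries t \<subseteq> set Rs \<and> set Rs' \<subseteq> set Rs"
proof (induction d arbitrary: Rs t Rs')
  case (Suc d)
  obtain l Rs1 where l: "build_table d Rs = (l, Rs1)" by fastforce
  show ?case
  proof (cases Rs1)
    case Nil
    then show ?thesis using Suc.prems Suc.IH[OF l] l by auto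
  next
    case (Cons R Rs2)
    obtain r Rs3 where r: "build_table d Rs2 = (r, Rs3)" by fastforce
    have "t = Branch l (moment R) R r" "Rs' = Rs3" using Suc.prems l r Cons by simp_all
    then show ?thesis using Suc.IH[OF l] Suc.IH[OF r] Cons by auto
  qed
qed simp

text \<open>
  Depth 8 leaves room for 255 entries.
\<close>

fun table_of :: "ivec list list \<Rightarrow> table" where
  "table_of Rs = fst (build_table 8 Rs)"

lemma table_of_entries: "table_entries (table_of Rs) \<subseteq> set Rs"
  using build_table_entries[of 8 Rs] by (cases "build_table 8 Rs") auto

text \<open>
  The empty list stands for a failed search; no set of three vectors is mapped onto it.
\<close>

function (sequential) entry :: "int \<Rightarrow> table \<Rightarrow> ivec list"
  and descend :: "bool \<Rightarrow> bool \<Rightarrow> int \<Rightarrow> table \<Rightarrow> ivec list \<Rightarrow> table \<Rightarrow> ivec list" where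
  "entry m Leaf = []"
| "entry m (Branch l k R r) = descend (m = k) (m < k) m l R r"
| "descend True b m l R r = R"
| "descend False True m l R r = entry m l"
| "descend False False m l R r = entry m r"
  by pat_completeness auto
termination
  by (relation "Wellfounded.measure (case_sum (\<lambda>(m, t). 2 * size t)
    (\<lambda>(a, b, m, l, R, r). 2 * (size l + size r) + 1))") auto

lemma entry_in_entries:
  "entry m t \<in> insert [] (table_entries t)"
  "descend a b m l R r \<in> insert [] (table_entries l \<union> {R} \<union> table_entries r)"
  by (induction m t and a b m l R r rule: entry_descend.induct) auto

function (sequential) maps_into :: "imat \<Rightarrow> ivec list \<Rightarrow> ivec list \<Rightarrow> bool"
  and maps_rest :: "bool \<Rightarrow> imat \<Rightarrow> ivec list \<Rightarrow> ivec list \<Rightarrow> bool" where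
  "maps_into M [] R = True"
| "maps_into M (v # vs) R = maps_rest (mem (iact M v) R) M vs R"
| "maps_rest False M vs R = False"
| "maps_rest True M vs R = maps_into M vs R"
  by pat_completeness auto
termination
  by (relation "Wellfounded.measure (case_sum (\<lambda>(M, vs, R). 2 * length vs)
    (\<lambda>(b, M, vs, R). 2 * length vs + 1))") auto

lemma maps_into_iff:
  "maps_into M S R \<longleftrightarrow> iact M ` set S \<subseteq> set R"
  "maps_rest b M S R \<longleftrightarrow> b \<and> iact M ` set S \<subseteq> set R"
  by (induction M S R and b M S R rule: maps_into_maps_rest.induct) auto

text \<open>
  A matrix that maps \<open>S\<close> into \<open>R\<close> decides the search: either it is onto, or the sizes differ and
  no other matrix can succeed.
\<close>

function (sequential) matched_by :: "imat list \<Rightarrow> ivec list \<Rightarrow> ivec list \<Rightarrow> bool"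
  and matched_rest :: "bool \<Rightarrow> imat \<Rightarrow> imat list \<Rightarrow> ivec list \<Rightarrow> ivec list \<Rightarrow> bool" where
  "matched_by [] S R = False"
| "matched_by (M # Ms) S R = matched_rest (maps_into M S R) M Ms S R"
| "matched_rest False M Ms S R = matched_by Ms S R"
| "matched_rest True M Ms S R = subset_list R (map (iact M) S)"
  by pat_completeness auto
termination
  by (relation "Wellfounded.measure (case_sum (\<lambda>(Ms, S, R). 2 * length Ms)
    (\<lambda>(b, M, Ms, S, R). 2 * length Ms + 1))") auto

lemma matched_byD:
  "matched_by Ms S R \<Longrightarrow> \<exists>M\<in>set Ms. iact M ` set S = set R"
  "matched_rest b M Ms S R \<Longrightarrow> (b \<longrightarrow> maps_into M S R) \<Longrightarrow> \<exists>M\<in>set (M # Ms). iact M ` set S = set R"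
  by (induction Ms S R and b M Ms S R rule: matched_by_matched_rest.induct)
    (auto simp: maps_into_iff subset_list_iff)

fun all_matched :: "imat list \<Rightarrow> table \<Rightarrow> ivec list \<Rightarrow> ivec list list \<Rightarrow> bool" where
  "all_matched Ms t P [] = True"
| "all_matched Ms t P (S # Ss) =
    ((short (P @ S) \<or> matched_by Ms (P @ S) (entry (moment (P @ S)) t)) \<and> all_matched Ms t P Ss)"

lemma all_matchedD:
  assumes "all_matched Ms t P Ss" "S \<in> set Ss" "3 \<le> length (P @ S)"
  shows "\<exists>M\<in>set Ms. \<exists>R\<in>table_entries t. iact M ` set (P @ S) = set R"
proof -
  have "matched_by Ms (P @ S) (entry (moment (P @ S)) t)"
    using assms by (induction Ss) (auto simp: short_iff)
  moreover have "set (P @ S) \<noteq> {}" using assms(3) by auto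
  ultimately show ?thesis
    using entry_in_entries(1)[of "moment (P @ S)" t] by (fastforce dest: matched_byD(1))
qed

text \<open>
  The choices on the first \<open>n\<close> axes are made by branching, and only the completions on the
  remaining axes are listed. This keeps the intermediate lists short.
\<close>

fun sweep :: "nat \<Rightarrow> imat list \<Rightarrow> table \<Rightarrow> ivec list \<Rightarrow> ivec list \<Rightarrow> ivec \<Rightarrow> bool" where
  "sweep (Suc n) Ms t P (v # vs) s =
    (sweep n Ms t P vs s \<and> sweep n Ms t (v # P) vs (s + v) \<and>
     sweep n Ms t (- v # P) vs (s - v) \<and> sweep n Ms t (v # - v # P) vs s)"
| "sweep n Ms t P vs s = all_matched Ms t P (zero_sum_lists vs s)"

lemma sweepD:
  assumes "sweep n Ms t P vs s" "L \<in> set (zero_sum_lists vs s)" "3 \<le> length (P @ L)"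
  shows "\<exists>M\<in>set Ms. \<exists>R\<in>table_entries t. iact M ` set (P @ L) = set R"
  using assms
proof (induction n Ms t P vs s arbitrary: L rule: sweep.induct)
  case (1 n Ms t P v vs s)
  then consider L' where "L = v # L'" "L' \<in> set (zero_sum_lists vs (s + v))"
    | L' where "L = - v # L'" "L' \<in> set (zero_sum_lists vs (s - v))"
    | "L \<in> set (zero_sum_lists vs s)"
    | L' where "L = v # - v # L'" "L' \<in> set (zero_sum_lists vs s)"
    by auto
  then show ?case
  proof cases
    case 1
    then show ?thesis using "1.IH"(2)[of L'] "1.prems" by (auto simp: insert_commute)
  next
    case 2
    then show ?thesis using "1.IH"(3)[of L'] "1.prems" by (auto simp: insert_commute)
  next
    case 3
    then show ?thesis using "1.IH"(1)[of L] "1.prems" by simp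
  next
    case 4
    then show ?thesis using "1.IH"(4)[of L'] "1.prems" by (auto simp: insert_commute)
  qed
qed (metis all_matchedD sweep.simps(2), metis all_matchedD sweep.simps(3))

fun increasing :: "int list \<Rightarrow> bool" where
  "increasing (x # y # zs) = (if x < y then increasing (y # zs) else False)"
| "increasing _ = True"

lemma increasing_sorted: "increasing xs \<Longrightarrow> sorted_wrt (<) xs"
proof (induction xs rule: increasing.induct)
  case (1 x y zs)
  then show ?case by (auto split: if_splits)
qed auto

section \<open>Deciding the types\<close>

fun subset_sum :: "ivec list \<Rightarrow> ivec \<Rightarrow> bool" where
  "subset_sum [] s \<longleftrightarrow> s = 0"
| "subset_sum (v # vs) s = (if subset_sum vs s then True else subset_sum vs (s - v))"

text \<open>
  Opposite pairs are looked for first, as they decide most instances.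
\<close>

fun zero_sum_part :: "ivec list \<Rightarrow> bool" where
  "zero_sum_part [] = False"
| "zero_sum_part (v # vs) =
    (if mem (- v) vs then True else if subset_sum vs (- v) then True else zero_sum_part vs)"

text \<open>
  The complement of a zero-sum part is again one, so it suffices to look at parts that avoid the
  first vector.
\<close>

fun is_rigid :: "ivec list \<Rightarrow> bool" where
  "is_rigid [] = True"
| "is_rigid (v # vs) = (if zero_sum_part vs then False else True)"

lemma subseteq_add_mset: "F \<subseteq># G \<Longrightarrow> F \<subseteq># add_mset v G"
  by (metis add_mset_add_single mset_subset_eq_add_left subset_mset.order_trans)

lemma subset_add_mset: "F \<subseteq># G \<Longrightarrow> F \<subset># add_mset v G"
  using size_mset_mono[of F G] by (auto simp: subset_mset.less_le subseteq_add_mset)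

lemma subseteq_mset_of_add_mset: "v \<notin># F \<Longrightarrow> F \<subseteq># add_mset v G \<Longrightarrow> F \<subseteq># G"
  using subset_eq_diff_conv[of F "{#v#}" G] by (simp add: diff_single_trivial)

lemma subset_sum_iff: "subset_sum vs s \<longleftrightarrow> (\<exists>F. F \<subseteq># mset vs \<and> \<Sum>\<^sub># F = s)"
proof (induction vs arbitrary: s)
  case (Cons v vs)
  have "(\<exists>F. F \<subseteq># mset (v # vs) \<and> \<Sum>\<^sub># F = s) \<longleftrightarrow>
      (\<exists>F. F \<subseteq># mset vs \<and> \<Sum>\<^sub># F = s) \<or> (\<exists>F. F \<subseteq># mset vs \<and> \<Sum>\<^sub># F = s - v)" (is "?l \<longleftrightarrow> ?r1 \<or> ?r2")
  proof
    assume ?l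
    then obtain F where F: "F \<subseteq># add_mset v (mset vs)" "\<Sum>\<^sub># F = s" by auto
    show "?r1 \<or> ?r2"
    proof (cases "v \<in># F")
      case True
      then obtain G where "F = add_mset v G" by (metis multi_member_split)
      then show ?thesis using F by (intro disjI2 exI[of _ G]) auto
    next
      case False
      then have "F \<subseteq># mset vs" using F(1) by (rule subseteq_mset_of_add_mset)
      then show ?thesis using F by blast
    qed
  next
    assume "?r1 \<or> ?r2"
    then show ?l
    proof
      assume ?r2
      then obtain F where "F \<subseteq># mset vs" "\<Sum>\<^sub># F = s - v" by blast
      then show ?l by (intro exI[of _ "add_mset v F"]) auto
    qed (auto intro: subseteq_add_mset)
  qed
  then show ?case by (simp only: subset_sum.simps Cons) auto
qed auto

lemma zero_sum_part_iff: "zero_sum_part vs \<longleftrightarrow> (\<exists>F. F \<subseteq># mset vs \<and> F \<noteq> {#} \<and> \<Sum>\<^sub># F = 0)"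
proof (induction vs)
  case (Cons v vs)
  have "zero_sum_part (v # vs) \<longleftrightarrow> subset_sum vs (- v) \<or> zero_sum_part vs"
  proof -
    have "subset_sum vs (- v)" if "- v \<in> set vs"
      unfolding subset_sum_iff using that by (intro exI[of _ "{#- v#}"]) auto
    then show ?thesis by auto
  qed
  also have "\<dots> \<longleftrightarrow> (\<exists>F. F \<subseteq># mset (v # vs) \<and> F \<noteq> {#} \<and> \<Sum>\<^sub># F = 0)" (is "?l \<longleftrightarrow> ?r")
  proof
    assume ?l
    then show ?r
    proof
      assume "subset_sum vs (- v)"
      then obtain F where "F \<subseteq># mset vs" "\<Sum>\<^sub># F = - v" by (auto simp: subset_sum_iff)
      then show ?r by (intro exI[of _ "add_mset v F"]) auto
    next
      assume "zero_sum_part vs"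
      then show ?r unfolding Cons by (auto intro: subseteq_add_mset)
    qed
  next
    assume ?r
    then obtain F where F: "F \<subseteq># add_mset v (mset vs)" "F \<noteq> {#}" "\<Sum>\<^sub># F = 0" by auto
    show ?l
    proof (cases "v \<in># F")
      case True
      then obtain G where G: "F = add_mset v G" by (metis multi_member_split)
      then have "\<Sum>\<^sub># G = - v" using F(3) by (simp add: eq_neg_iff_add_eq_0 add.commute)
      then have "subset_sum vs (- v)" unfolding subset_sum_iff using F(1) G by auto
      then show ?thesis ..
    next
      case False
      then have "F \<subseteq># mset vs" using F(1) by (rule subseteq_mset_of_add_mset)
      then show ?thesis unfolding Cons using F by blast
    qed
  qed
  finally show ?case .
qed auto

lemma vec_of_submultiset:
  assumes "F \<subseteq># image_mset vec_of E"
  obtains G where "G \<subseteq># E" "F = image_mset vec_of G"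
proof
  let ?g = "inv vec_of"
  have gv: "?g (vec_of v) = v" for v using inj_vec_of by (rule inv_f_f)
  show "image_mset ?g F \<subseteq># E"
    using image_mset_subseteq_mono[OF assms, of ?g] by (simp add: multiset.map_comp comp_def gv)
  have "vec_of (?g x) = x" if "x \<in># F" for x
    using that mset_subset_eqD[OF assms] by (intro f_inv_into_f) auto
  then show "F = image_mset vec_of (image_mset ?g F)"
    by (simp add: multiset.map_comp comp_def multiset.map_ident_strong)
qed

lemma sum_mset_vec_of: "\<Sum>\<^sub># (image_mset vec_of F) = vec_of (\<Sum>\<^sub># F)"
  by (induction F) (simp_all add: vec_of_simps)

lemma is_rigid_iff:
  assumes "sum_list A = 0" "A \<noteq> []"
  shows "is_rigid A \<longleftrightarrow> \<not> has_zero_sum_part (mset (map vec_of A))"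
proof -
  obtain v vs where A: "A = v # vs" using assms(2) by (cases A) auto
  have sA: "\<Sum>\<^sub># (mset A) = 0" using assms(1) by (simp add: sum_mset_sum_list)
  have "has_zero_sum_part (mset (map vec_of A)) \<longleftrightarrow> (\<exists>F. F \<subset># mset A \<and> F \<noteq> {#} \<and> \<Sum>\<^sub># F = 0)"
  proof
    assume "has_zero_sum_part (mset (map vec_of A))"
    then obtain F where F: "F \<subset># image_mset vec_of (mset A)" "F \<noteq> {#}" "\<Sum>\<^sub># F = 0"
      by (auto simp: has_zero_sum_part_def)
    then obtain G where G: "G \<subseteq># mset A" "F = image_mset vec_of G"
      using vec_of_submultiset subset_mset.less_imp_le by metis
    then have "G \<subset># mset A" using F(1) by (auto simp: subset_mset.less_le)
    moreover have "\<Sum>\<^sub># G = 0" using F(3) G(2) by (simp add: sum_mset_vec_of)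
    ultimately show "\<exists>F. F \<subset># mset A \<and> F \<noteq> {#} \<and> \<Sum>\<^sub># F = 0" using F(2) G(2) by auto
  next
    assume "\<exists>F. F \<subset># mset A \<and> F \<noteq> {#} \<and> \<Sum>\<^sub># F = 0"
    then obtain F where "F \<subset># mset A" "F \<noteq> {#}" "\<Sum>\<^sub># F = 0" by blast
    then show "has_zero_sum_part (mset (map vec_of A))"
      unfolding has_zero_sum_part_def
      by (intro exI[of _ "image_mset vec_of F"])
        (simp add: image_mset_subset_mono sum_mset_vec_of vec_of_simps)
  qed
  also have "\<dots> \<longleftrightarrow> (\<exists>F. F \<subseteq># mset vs \<and> F \<noteq> {#} \<and> \<Sum>\<^sub># F = 0)"
  proof
    assume "\<exists>F. F \<subset># mset A \<and> F \<noteq> {#} \<and> \<Sum>\<^sub># F = 0"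
    then obtain F where F: "F \<subset># mset A" "F \<noteq> {#}" "\<Sum>\<^sub># F = 0" by blast
    let ?G = "mset A - F"
    have FG: "mset A = F + ?G" using F(1) by (simp add: subset_mset.less_imp_le)
    have G: "?G \<noteq> {#}" "\<Sum>\<^sub># ?G = 0"
      using F sA FG by (auto simp: Diff_eq_empty_iff_mset dest: subset_mset.leD)
        (metis FG add_0 sum_mset.union)
    have "F \<subseteq># mset vs \<or> ?G \<subseteq># mset vs"
    proof -
      have "v \<in># F + ?G" using FG A by (metis list.set_intros(1) set_mset_mset)
      then consider "v \<in># F" | "v \<in># ?G" by auto
      then show ?thesis
      proof cases
        case 1
        then obtain F' where "F = add_mset v F'" by (metis multi_member_split)
        then have "add_mset v (mset vs) = add_mset v (F' + ?G)" using FG A by simp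
        then have "mset vs = F' + ?G" by simp
        then show ?thesis by simp
      next
        case 2
        then obtain G' where "?G = add_mset v G'" by (metis multi_member_split)
        then have "add_mset v (mset vs) = add_mset v (F + G')" using FG A by simp
        then have "mset vs = F + G'" by simp
        then show ?thesis by simp
      qed
    qed
    then show "\<exists>F. F \<subseteq># mset vs \<and> F \<noteq> {#} \<and> \<Sum>\<^sub># F = 0" using F G by blast
  next
    assume "\<exists>F. F \<subseteq># mset vs \<and> F \<noteq> {#} \<and> \<Sum>\<^sub># F = 0"
    then show "\<exists>F. F \<subset># mset A \<and> F \<noteq> {#} \<and> \<Sum>\<^sub># F = 0"
      unfolding A by (auto intro: subset_add_mset)
  qed
  finally show ?thesis unfolding A by (simp add: zero_sum_part_iff)
qed

fun cons_all :: "ivec \<Rightarrow> ivec list list \<Rightarrow> ivec list list" where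
  "cons_all y [] = []"
| "cons_all y (r # rs) = (y # r) # cons_all y rs"

lemma set_cons_all [simp]: "set (cons_all y rs) = (#) y ` set rs"
  by (induction rs) auto

text \<open>
  All ways to remove two vectors that complete \<open>x\<close> to a unimodular triple.
\<close>

fun remove_triple :: "ivec \<Rightarrow> ivec list \<Rightarrow> ivec list list" where
  "remove_triple x [] = []"
| "remove_triple x (y # ys) =
    (if \<bar>idet x y\<bar> = 1 then
       (if mem (- x - y) ys then remove1 (- x - y) ys # cons_all y (remove_triple x ys)
        else cons_all y (remove_triple x ys))
     else cons_all y (remove_triple x ys))"

fun remove_blocks :: "ivec \<Rightarrow> ivec list \<Rightarrow> ivec list list" where
  "remove_blocks x ys =
    (if mem (- x) ys then remove1 (- x) ys # remove_triple x ys else remove_triple x ys)"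

fun any_true :: "('a \<Rightarrow> bool) \<Rightarrow> 'a list \<Rightarrow> bool" where
  "any_true p [] = False"
| "any_true p (x # xs) = (if p x then True else any_true p xs)"

lemma any_true_iff: "any_true p xs \<longleftrightarrow> (\<exists>x\<in>set xs. p x)"
  by (induction xs) auto

text \<open>
  Search for a partition into opposite pairs and unimodular triples: the first vector lies in some
  block, and every block that contains it is tried. The number \<open>n\<close> bounds the depth of the search.
\<close>

primrec has_block_partition :: "nat \<Rightarrow> ivec list \<Rightarrow> bool" where
  "has_block_partition 0 xs = (case xs of [] \<Rightarrow> True | _ \<Rightarrow> False)"
| "has_block_partition (Suc n) xs =
    (case xs of [] \<Rightarrow> True | x # ys \<Rightarrow> any_true (has_block_partition n) (remove_blocks x ys))"

lemma remove_triple_sound: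
  "r \<in> set (remove_triple x ys) \<Longrightarrow>
    \<exists>y z. x + y + z = 0 \<and> \<bar>idet x y\<bar> = 1 \<and> mset ys = add_mset y (add_mset z (mset r))"
proof (induction ys arbitrary: r)
  case (Cons y ys)
  consider "\<bar>idet x y\<bar> = 1" "- x - y \<in> set ys" "r = remove1 (- x - y) ys"
    | r' where "r' \<in> set (remove_triple x ys)" "r = y # r'"
    using Cons.prems by (auto split: if_splits)
  then show ?case
  proof cases
    case 1
    then show ?thesis by (intro exI[of _ y] exI[of _ "- x - y"]) simp
  next
    case 2
    then show ?thesis using Cons.IH[of r'] by fastforce
  qed
qed simp

lemma remove_triple_complete:
  "x + y + z = 0 \<Longrightarrow> \<bar>idet x y\<bar> = 1 \<Longrightarrow> mset ys = add_mset y (add_mset z G) \<Longrightarrow>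
    \<exists>r\<in>set (remove_triple x ys). mset r = G"
proof (induction ys arbitrary: G)
  case (Cons w ys)
  have dz: "idet x z = - idet x y" if "x + y + z = 0" for y z
  proof -
    have z: "z = - x - y" using that by (simp add: algebra_simps eq_neg_iff_add_eq_0)
    show ?thesis unfolding z by (simp add: idet_def algebra_simps)
  qed
  have first: ?case if "w = y'" "x + y' + z' = 0" "\<bar>idet x y'\<bar> = 1" "mset ys = add_mset z' G" for y' z'
  proof -
    have "z' = - x - w" using that by (simp add: algebra_simps eq_neg_iff_add_eq_0)
    moreover from this have "- x - w \<in> set ys" using that(4) by (metis set_mset_mset union_single_eq_member)
    moreover have "mset (remove1 (- x - w) ys) = G" using that(4) calculation(1) by simp
    ultimately show ?thesis using that by auto
  qed
  consider "w = y" "mset ys = add_mset z G" | "w = z" "mset ys = add_mset y G"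
    | G' where "G = add_mset w G'" "mset ys = add_mset y (add_mset z G')"
  proof -
    have eq: "add_mset w (mset ys) = add_mset y (add_mset z G)" using Cons.prems(3) by simp
    show ?thesis
    proof (cases "w = y \<or> w = z")
      case True
      then show ?thesis using eq that(1,2) by (auto simp: add_mset_commute)
    next
      case False
      moreover have "w \<in># add_mset y (add_mset z G)" unfolding eq[symmetric] by simp
      ultimately have "w \<in># G" by auto
      then obtain G' where G': "G = add_mset w G'" by (metis multi_member_split)
      then have "mset ys = add_mset y (add_mset z G')" using eq by (simp add: add_mset_commute)
      then show ?thesis using that(3) G' by blast
    qed
  qed
  then show ?case
  proof cases
    case 1 then show ?thesis using first[of y z] Cons.prems by blast
  next
    case 2 then show ?thesis using first[of z y] Cons.prems dz[of y z] by (simp add: add.commute add.left_commute)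
  next
    case 3
    then obtain r where "r \<in> set (remove_triple x ys)" "mset r = G'"
      using Cons.IH[of G'] Cons.prems by blast
    then show ?thesis using 3 by (intro bexI[of _ "w # r"]) auto
  qed
qed simp

lemma has_block_partition_sound:
  "has_block_partition n xs \<Longrightarrow> has_smoothing_partition (mset (map vec_of xs))"
proof (induction n arbitrary: xs)
  case 0
  then have "xs = []" by (cases xs) auto
  then show ?case unfolding has_smoothing_partition_def by (intro exI[of _ "{#}"]) simp
next
  case (Suc n)
  show ?case
  proof (cases xs)
    case Nil
    then show ?thesis unfolding has_smoothing_partition_def by (intro exI[of _ "{#}"]) simp
  next
    case (Cons x ys)
    then obtain r where r: "r \<in> set (remove_blocks x ys)" "has_block_partition n r"
      using Suc.prems by (auto simp: any_true_iff)
    obtain \<P> where P: "\<Sum>\<^sub># \<P> = mset (map vec_of r)" "\<forall>B\<in>#\<P>. opposite_pair B \<or> unimodular_triple B"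
      using Suc.IH[OF r(2)] unfolding has_smoothing_partition_def by blast
    have "\<exists>B. (opposite_pair B \<or> unimodular_triple B) \<and> mset (map vec_of xs) = B + mset (map vec_of r)"
    proof -
      consider "- x \<in> set ys" "r = remove1 (- x) ys" | "r \<in> set (remove_triple x ys)"
        using r(1) by (auto split: if_splits)
      then show ?thesis
      proof cases
        case 1
        then have "mset ys = add_mset (- x) (mset r)" by simp
        then have "mset (map vec_of xs) = {#vec_of x, - vec_of x#} + mset (map vec_of r)"
          using Cons by (simp add: vec_of_simps)
        then show ?thesis unfolding opposite_pair_def by blast
      next
        case 2
        then obtain y z where yz: "x + y + z = 0" "\<bar>idet x y\<bar> = 1"
          "mset ys = add_mset y (add_mset z (mset r))" using remove_triple_sound by blast
        have "vec_of x + vec_of y + vec_of z = 0" using yz(1) by (simp flip: vec_of_simps)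
        moreover have "\<bar>det (vector [vec_of x, vec_of y] :: real^2^2)\<bar> = 1"
          using yz(2) by (simp add: det_vector_eq_det2 det2_vec_of flip: of_int_abs)
        ultimately have "unimodular_triple {#vec_of x, vec_of y, vec_of z#}"
          unfolding unimodular_triple_def by blast
        moreover have "mset (map vec_of xs) = {#vec_of x, vec_of y, vec_of z#} + mset (map vec_of r)"
          using Cons yz(3) by simp
        ultimately show ?thesis by blast
      qed
    qed
    then obtain B where "opposite_pair B \<or> unimodular_triple B"
      "mset (map vec_of xs) = B + mset (map vec_of r)" by blast
    then show ?thesis
      unfolding has_smoothing_partition_def using P by (intro exI[of _ "add_mset B \<P>"]) auto
  qed
qed

text \<open>
  All three pairs in a unimodular triple have the same determinant up to sign, so that any member
  may be listed first.
\<close>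

lemma unimodular_triple_member:
  assumes "unimodular_triple B" "x \<in># B"
  obtains y z where "B = {#x, y, z#}" "x + y + z = 0" "\<bar>det2 x y\<bar> = 1"
proof -
  obtain a b c where B: "B = {#a, b, c#}" "a + b + c = 0" "\<bar>det2 a b\<bar> = 1"
    using assms(1) by (auto simp: unimodular_triple_def det_vector_eq_det2)
  have c: "c = - a - b" using B(2) by (simp add: algebra_simps eq_neg_iff_add_eq_0)
  have "\<bar>det2 b c\<bar> = 1" "\<bar>det2 c a\<bar> = 1" using B(3) det2_commute[of a b] by (auto simp: c)
  note dets = this
  consider "x = a" | "x = b" | "x = c" using assms(2) B(1) by auto
  then show ?thesis
  proof cases
    case 1 then show ?thesis using B by (intro that[of b c]) simp_all
  next
    case 2 then show ?thesis using B dets by (intro that[of c a]) (simp_all add: add_mset_commute algebra_simps)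
  next
    case 3 then show ?thesis using B dets by (intro that[of a b]) (simp_all add: add_mset_commute algebra_simps)
  qed
qed

lemma has_block_partition_complete:
  "has_smoothing_partition (mset (map vec_of xs)) \<Longrightarrow> length xs \<le> n \<Longrightarrow> has_block_partition n xs"
proof (induction n arbitrary: xs)
  case 0
  then show ?case by simp
next
  case (Suc n)
  show ?case
  proof (cases xs)
    case Nil
    then show ?thesis by simp
  next
    case (Cons x ys)
    obtain \<P> where P: "\<Sum>\<^sub># \<P> = mset (map vec_of xs)" "\<forall>B\<in>#\<P>. opposite_pair B \<or> unimodular_triple B"
      using Suc.prems(1) unfolding has_smoothing_partition_def by blast
    have "vec_of x \<in># \<Sum>\<^sub># \<P>" using P(1) Cons by simp
    then obtain B where B: "B \<in># \<P>" "vec_of x \<in># B" by auto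
    then obtain \<Q> where \<Q>: "\<P> = add_mset B \<Q>" by (metis multi_member_split)
    have sub: "mset (map vec_of xs) = B + \<Sum>\<^sub># \<Q>" using P(1) \<Q> by simp
    then have "\<Sum>\<^sub># \<Q> \<subseteq># image_mset vec_of (mset xs)" by simp
    then obtain R where R: "\<Sum>\<^sub># \<Q> = image_mset vec_of R" using vec_of_submultiset by metis
    have hQ: "has_smoothing_partition (image_mset vec_of R)"
      unfolding has_smoothing_partition_def using P(2) \<Q> R by (intro exI[of _ \<Q>]) auto
    have "\<exists>r\<in>set (remove_blocks x ys). mset r = R"
      using P(2) B(1)
    proof (elim ballE disjE)
      assume "opposite_pair B"
      then obtain v where v: "B = {#v, - v#}" by (auto simp: opposite_pair_def)
      then have "B = {#vec_of x, vec_of (- x)#}"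
        using B(2) by (auto simp: vec_of_simps)
      then have "image_mset vec_of (mset ys) = image_mset vec_of (add_mset (- x) R)"
        using sub R Cons by simp
      then have "mset ys = add_mset (- x) R" by (rule injD[OF multiset.inj_map[OF inj_vec_of]])
      then have "- x \<in> set ys" "mset (remove1 (- x) ys) = R"
        by (metis set_mset_mset union_single_eq_member, simp)
      then show ?thesis by auto
    next
      assume "unimodular_triple B"
      then obtain y' z' where B': "B = {#vec_of x, y', z'#}" "vec_of x + y' + z' = 0" "\<bar>det2 (vec_of x) y'\<bar> = 1"
        using unimodular_triple_member B(2) by blast
      have "{#vec_of x, y', z'#} \<subseteq># image_mset vec_of (mset xs)" using sub B'(1) by simp
      then have "set_mset {#vec_of x, y', z'#} \<subseteq> set_mset (image_mset vec_of (mset xs))"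
        by (rule set_mset_mono)
      then obtain y z where yz: "y' = vec_of y" "z' = vec_of z" by auto
      have "image_mset vec_of (mset ys) = image_mset vec_of (add_mset y (add_mset z R))"
        using sub R Cons B'(1) yz by simp
      then have "mset ys = add_mset y (add_mset z R)" by (rule injD[OF multiset.inj_map[OF inj_vec_of]])
      moreover have "x + y + z = 0" using B'(2) unfolding yz by (simp flip: vec_of_simps)
      moreover have "\<bar>idet x y\<bar> = 1"
        using B'(3) unfolding yz by (simp add: det2_vec_of flip: of_int_abs)
      ultimately obtain r where "r \<in> set (remove_triple x ys)" "mset r = R"
        using remove_triple_complete by blast
      then show ?thesis by auto
    qed auto
    then obtain r where r: "r \<in> set (remove_blocks x ys)" "mset r = R" by blast
    have "size (mset (map vec_of xs)) = size B + size (image_mset vec_of R)" unfolding sub R by simp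
    moreover have "size B > 0" using B(2) by (metis empty_not_add_mset multi_member_split nonempty_has_size)
    ultimately have "length r \<le> n" using Suc.prems(2) by (simp flip: r(2))
    then have "has_block_partition n r" using Suc.IH[of r] hQ r(2) by simp
    then show ?thesis using Cons r(1) by (auto simp: any_true_iff simp del: remove_blocks.simps)
  qed
qed

lemma has_block_partition_iff:
  "has_block_partition (length xs) xs \<longleftrightarrow> has_smoothing_partition (mset (map vec_of xs))"
  using has_block_partition_sound has_block_partition_complete by blast

fun is_smoothable :: "ivec list \<Rightarrow> bool" where
  "is_smoothable xs = has_block_partition (length xs) xs"

section \<open>The table of representatives\<close>

text \<open>
  One vector from each pair of opposite primitive vectors with coordinates in \<open>[-2, 2]\<close>.
\<close>

definition axes :: "ivec list" where
  "axes = [(2, 1), (1, 2), (-1, 2), (-2, 1), (1, 1), (-1, 1), (1, 0), (0, 1)]"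

text \<open>
  The primitive vectors with coordinates in \<open>[-2, 2]\<close>, counterclockwise from angle 0.
\<close>

definition directions :: "ivec list" where
  "directions = [
    (1, 0), (2, 1), (1, 1), (1, 2), (0, 1), (-1, 2), (-1, 1), (-2, 1), (-1, 0), (-2, -1), (-1, -1),
    (-1, -2), (0, -1), (1, -2), (1, -1), (2, -1)]"

text \<open>
  One edge list for every class, including the standard triangle, which comes first; the unit
  square comes second. The lists are sorted by their moments, and their members are given by their
  positions in \<open>directions\<close>.
\<close>

definition representatives :: "ivec list list" where
  "representatives = map (map ((!) directions)) [
    [0, 6, 12], [0, 4, 8, 12], [0, 2, 4, 8, 10, 12], [0, 2, 4, 8, 11], [0, 3, 8, 11],
    [0, 1, 4, 8, 9, 12], [0, 3, 9, 12], [0, 2, 4, 6, 8, 10, 12, 14], [0, 1, 6, 8, 10, 12],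
    [3, 9, 14], [0, 1, 6, 9, 12], [1, 6, 9, 14], [0, 1, 6, 8, 9, 14], [0, 1, 6, 8, 11],
    [0, 2, 4, 6, 8, 10, 13], [0, 1, 4, 6, 10, 11], [2, 6, 9, 15], [0, 2, 5, 8, 10, 13],
    [2, 4, 8, 9, 15], [0, 1, 4, 6, 8, 11, 12], [0, 1, 7, 8, 10, 14], [0, 1, 4, 6, 9, 10, 14],
    [0, 1, 4, 6, 8, 9, 12, 14], [0, 1, 2, 4, 6, 8, 10, 11, 12], [0, 2, 4, 7, 10, 13],
    [0, 1, 7, 9, 14], [0, 1, 3, 4, 8, 9, 11, 12], [0, 2, 5, 8, 11, 14],
    [0, 1, 2, 4, 6, 8, 9, 10, 12, 14], [0, 1, 4, 7, 8, 10, 12, 14], [1, 7, 9, 15],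
    [0, 1, 6, 7, 10, 12, 14], [0, 1, 2, 4, 6, 9, 11, 12], [0, 1, 7, 8, 9, 15], [3, 8, 9, 15],
    [0, 1, 4, 7, 9, 12, 14], [0, 2, 4, 6, 9, 13], [0, 2, 5, 6, 11, 13], [0, 1, 3, 6, 9, 11, 12],
    [0, 1, 2, 7, 8, 9, 12, 14], [3, 6, 9, 12, 15], [0, 1, 2, 7, 9, 10, 14], [0, 3, 5, 8, 11, 13],
    [0, 1, 4, 7, 11, 12], [1, 3, 6, 9, 11, 14], [3, 4, 9, 10, 15], [0, 1, 4, 7, 8, 9, 12, 15],
    [0, 1, 2, 4, 6, 8, 9, 11, 14], [0, 1, 4, 7, 9, 10, 15], [0, 2, 5, 9, 13], [0, 3, 6, 9, 10, 15],
    [1, 2, 7, 9, 10, 15], [0, 1, 2, 7, 8, 11, 12], [0, 1, 4, 7, 8, 10, 13], [0, 1, 2, 7, 10, 11],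
    [0, 1, 6, 7, 11, 14], [0, 1, 3, 6, 8, 9, 11, 14], [0, 1, 2, 7, 8, 9, 10, 15],
    [0, 1, 2, 4, 7, 9, 10, 12, 14], [0, 1, 3, 4, 6, 9, 10, 11, 14], [0, 1, 4, 6, 8, 9, 13],
    [0, 1, 4, 5, 8, 10, 11, 14], [0, 2, 3, 6, 9, 10, 13], [1, 5, 9, 13], [0, 1, 5, 9, 10, 14],
    [0, 1, 5, 6, 10, 11, 14], [0, 1, 4, 6, 7, 11, 12, 14], [0, 1, 3, 4, 6, 8, 9, 11, 12, 14],
    [0, 1, 2, 4, 7, 10, 11, 12], [0, 2, 3, 5, 8, 10, 11, 13], [0, 1, 2, 4, 7, 8, 10, 11, 14],
    [0, 1, 4, 5, 9, 10, 12, 14], [0, 1, 4, 7, 9, 13], [0, 1, 2, 6, 7, 8, 10, 12, 13],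
    [0, 1, 2, 4, 7, 8, 9, 10, 12, 15], [0, 1, 2, 6, 7, 9, 10, 12, 15], [1, 2, 6, 7, 9, 10, 14, 15],
    [0, 1, 2, 6, 7, 10, 11, 14], [1, 2, 7, 9, 13], [0, 2, 3, 7, 10, 11, 14], [0, 1, 5, 8, 9, 13],
    [0, 1, 2, 3, 4, 6, 8, 9, 10, 11, 12, 14], [0, 1, 2, 6, 7, 8, 9, 10, 14, 15],
    [0, 1, 4, 5, 9, 11, 14], [1, 2, 5, 9, 11, 14], [0, 1, 5, 6, 8, 11, 13], [0, 1, 2, 7, 8, 9, 13],
    [0, 1, 4, 5, 8, 9, 12, 13], [0, 1, 2, 4, 6, 7, 10, 11, 12, 14], [0, 1, 4, 5, 9, 10, 13],
    [0, 1, 2, 4, 6, 8, 9, 10, 13], [0, 1, 2, 4, 7, 9, 11, 14], [1, 2, 5, 9, 10, 13],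
    [1, 2, 6, 7, 11, 13], [0, 1, 2, 5, 9, 11, 12], [0, 1, 4, 6, 7, 11, 13],
    [0, 2, 3, 5, 6, 8, 10, 11, 13, 14], [0, 1, 5, 7, 11, 12, 14], [1, 2, 5, 6, 10, 11, 13],
    [0, 1, 3, 7, 8, 10, 11, 14], [0, 1, 2, 6, 7, 9, 12, 13], [0, 1, 4, 6, 7, 9, 13, 14],
    [0, 1, 4, 6, 7, 10, 11, 15], [0, 1, 3, 7, 9, 10, 12, 14], [0, 1, 2, 4, 7, 8, 9, 12, 13],
    [0, 1, 2, 4, 6, 7, 8, 9, 10, 12, 14, 15], [0, 1, 2, 5, 8, 9, 11, 14],
    [0, 1, 5, 6, 8, 9, 13, 14], [0, 1, 2, 4, 7, 9, 10, 13], [0, 1, 5, 6, 8, 10, 11, 15],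
    [0, 1, 2, 5, 8, 9, 10, 13], [0, 1, 2, 6, 7, 8, 9, 13, 14], [0, 1, 2, 6, 7, 8, 11, 13],
    [0, 1, 5, 7, 11, 13], [0, 1, 2, 4, 5, 8, 9, 11, 12, 14], [0, 1, 2, 5, 6, 8, 10, 11, 13],
    [0, 1, 2, 4, 5, 9, 10, 11, 14], [0, 2, 3, 5, 9, 11, 13], [0, 1, 3, 7, 9, 11, 14],
    [1, 2, 5, 6, 9, 10, 13, 14], [0, 1, 2, 5, 6, 9, 10, 12, 13], [0, 1, 2, 5, 6, 9, 11, 12, 14],
    [0, 1, 2, 4, 5, 8, 9, 10, 12, 13], [0, 1, 2, 4, 6, 7, 8, 11, 12, 13],
    [0, 1, 2, 4, 6, 7, 10, 11, 13], [0, 1, 2, 4, 5, 6, 8, 10, 11, 12, 13], [0, 1, 5, 7, 9, 13, 14],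
    [0, 1, 3, 7, 8, 9, 12, 13], [0, 1, 3, 7, 9, 10, 13], [0, 1, 5, 6, 9, 11, 15],
    [0, 1, 2, 4, 7, 8, 9, 11, 15], [0, 1, 2, 4, 6, 7, 9, 10, 13, 14], [0, 1, 2, 6, 7, 9, 11, 15],
    [0, 1, 2, 5, 6, 8, 9, 10, 13, 14], [0, 1, 2, 5, 7, 10, 11, 12, 14],
    [0, 1, 3, 4, 6, 8, 9, 11, 13], [0, 1, 3, 5, 9, 10, 11, 14], [1, 3, 5, 9, 11, 13],
    [0, 1, 3, 4, 7, 8, 10, 11, 13], [0, 1, 3, 6, 7, 10, 11, 13], [0, 1, 2, 5, 7, 8, 11, 12, 13],
    [0, 1, 2, 4, 5, 8, 9, 11, 13], [0, 1, 2, 5, 6, 9, 11, 13], [0, 1, 5, 6, 7, 11, 13, 14],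
    [0, 1, 2, 3, 7, 8, 9, 11, 12, 14], [0, 1, 2, 5, 7, 10, 11, 13],
    [0, 1, 2, 4, 5, 6, 8, 9, 10, 12, 13, 14], [0, 1, 2, 3, 7, 9, 10, 11, 14],
    [0, 1, 2, 4, 6, 7, 9, 11, 12, 15], [0, 1, 3, 7, 8, 9, 11, 15], [0, 2, 3, 5, 6, 9, 11, 13, 14],
    [0, 1, 2, 5, 6, 8, 9, 11, 12, 15], [0, 1, 2, 4, 5, 6, 9, 11, 12, 13],
    [0, 1, 3, 5, 8, 9, 11, 13], [0, 1, 2, 5, 6, 9, 10, 11, 15], [0, 1, 2, 3, 7, 8, 9, 10, 12, 13],
    [0, 1, 3, 6, 7, 9, 10, 13, 14], [0, 1, 2, 4, 5, 7, 10, 11, 12, 13],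
    [0, 1, 2, 5, 7, 9, 10, 13, 14], [0, 1, 2, 3, 4, 6, 8, 9, 10, 11, 13],
    [0, 1, 2, 4, 6, 7, 8, 9, 10, 13, 15], [0, 1, 3, 4, 5, 9, 10, 11, 13],
    [0, 1, 3, 4, 5, 8, 9, 11, 12, 13], [0, 1, 3, 4, 7, 9, 11, 13], [1, 2, 3, 5, 9, 10, 11, 13],
    [1, 2, 3, 7, 9, 11, 13], [0, 1, 2, 3, 6, 7, 8, 10, 11, 12, 13], [0, 1, 3, 5, 6, 9, 11, 12, 13],
    [0, 1, 2, 4, 5, 7, 8, 10, 11, 13, 14], [0, 1, 2, 5, 6, 7, 10, 11, 13, 14],
    [1, 2, 5, 7, 9, 10, 13, 15], [0, 1, 2, 4, 5, 6, 8, 9, 11, 13, 14],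
    [0, 1, 2, 3, 7, 8, 9, 10, 11, 15], [0, 1, 2, 3, 7, 8, 9, 11, 13], [1, 2, 5, 7, 9, 11, 14, 15],
    [0, 1, 2, 3, 6, 7, 8, 9, 10, 12, 13, 14], [0, 1, 2, 3, 5, 8, 9, 10, 11, 13],
    [0, 1, 2, 5, 7, 8, 9, 10, 13, 15], [0, 1, 2, 5, 7, 9, 11, 12, 15],
    [0, 1, 3, 5, 6, 8, 9, 11, 13, 14], [0, 1, 2, 3, 4, 5, 8, 9, 10, 11, 12, 13],
    [0, 1, 2, 3, 4, 7, 8, 9, 11, 12, 13], [0, 1, 2, 3, 6, 7, 9, 11, 12, 13],
    [0, 1, 2, 3, 5, 6, 9, 10, 11, 12, 13], [1, 2, 3, 6, 7, 9, 11, 13, 14],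
    [0, 1, 2, 5, 7, 8, 9, 11, 14, 15], [0, 1, 2, 3, 4, 7, 9, 10, 11, 13],
    [1, 2, 3, 5, 6, 9, 10, 11, 13, 14], [0, 1, 3, 4, 6, 7, 9, 11, 13, 14],
    [0, 1, 2, 5, 6, 7, 9, 10, 12, 13, 15], [0, 1, 3, 5, 7, 8, 10, 11, 13, 14],
    [0, 1, 2, 4, 5, 7, 8, 9, 10, 12, 13, 15], [0, 1, 2, 3, 6, 7, 8, 9, 10, 11, 14, 15],
    [0, 1, 2, 3, 6, 7, 8, 9, 11, 13, 14], [0, 1, 2, 4, 5, 7, 9, 11, 13, 14],
    [0, 1, 2, 4, 5, 7, 8, 9, 11, 12, 14, 15], [0, 1, 2, 4, 5, 7, 9, 10, 11, 14, 15],
    [0, 1, 2, 3, 5, 6, 8, 9, 10, 11, 13, 14], [0, 1, 2, 3, 4, 6, 7, 8, 9, 11, 12, 13, 14],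
    [0, 1, 2, 3, 4, 5, 6, 8, 9, 10, 11, 12, 13, 14], [0, 1, 2, 3, 4, 6, 7, 9, 10, 11, 13, 14],
    [0, 1, 3, 5, 7, 9, 11, 13, 14], [0, 1, 2, 4, 5, 7, 8, 9, 11, 13, 15],
    [0, 1, 2, 5, 6, 7, 9, 11, 13, 15], [1, 3, 5, 7, 9, 11, 13, 15],
    [0, 1, 2, 3, 5, 7, 8, 9, 11, 12, 13, 14], [0, 1, 2, 3, 5, 7, 9, 10, 11, 13, 14],
    [0, 1, 3, 5, 7, 8, 9, 11, 13, 15], [0, 1, 2, 3, 4, 5, 7, 9, 10, 11, 12, 13, 14],
    [0, 1, 3, 4, 5, 7, 8, 9, 11, 12, 13, 15], [0, 1, 3, 4, 5, 7, 9, 10, 11, 13, 15],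
    [1, 2, 3, 5, 7, 9, 10, 11, 13, 15], [0, 1, 2, 3, 5, 7, 8, 9, 10, 11, 13, 15],
    [0, 1, 2, 3, 4, 5, 7, 8, 9, 10, 11, 12, 13, 15], [0, 1, 2, 3, 5, 6, 7, 9, 10, 11, 12, 13, 15],
    [1, 2, 3, 5, 6, 7, 9, 10, 11, 13, 14, 15], [0, 1, 2, 3, 5, 6, 7, 8, 9, 10, 11, 13, 14, 15],
    [0, 1, 2, 3, 4, 5, 6, 7, 8, 9, 10, 11, 12, 13, 14, 15]]"

text \<open>
  Unimodular matrices that carry every zero-sum set of at least three small vectors to its
  representative. The first eight are the symmetries of the square, which settle most sets.
\<close>

definition matrices :: "imat list" where
  "matrices = [
    (-1, 0, 0, -1), (-1, 0, 0, 1), (0, -1, -1, 0), (0, -1, 1, 0), (0, 1, -1, 0), (0, 1, 1, 0),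
    (1, 0, 0, -1), (1, 0, 0, 1), (-1, -1, -1, 0), (-1, -1, 0, -1), (-1, -1, 0, 1), (-1, -1, 1, 0),
    (-1, 0, -1, -1), (-1, 0, -1, 1), (-1, 0, 1, -1), (-1, 0, 1, 1), (-1, 1, -1, 0), (-1, 1, 0, -1),
    (-1, 1, 0, 1), (-1, 1, 1, 0), (0, -1, -1, -1), (0, -1, -1, 1), (0, -1, 1, -1), (0, -1, 1, 1),
    (0, 1, -1, -1), (0, 1, -1, 1), (0, 1, 1, -1), (0, 1, 1, 1), (1, -1, -1, 0), (1, -1, 0, -1),
    (1, -1, 0, 1), (1, -1, 1, 0), (1, 0, -1, -1), (1, 0, -1, 1), (1, 0, 1, -1), (1, 0, 1, 1),
    (1, 1, -1, 0), (1, 1, 0, -1), (1, 1, 0, 1), (1, 1, 1, 0), (-2, -1, -1, 0), (-2, 1, -1, 0),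
    (-1, -2, 0, -1), (-1, 0, -2, -1), (-1, 0, -2, 1), (-1, 2, 0, -1), (0, -1, -1, -2),
    (0, -1, 1, -2), (0, 1, -1, 2), (0, 1, 1, 2), (1, 0, 2, -1), (1, 0, 2, 1), (-2, -1, -1, -1),
    (-2, 1, -1, 1), (-1, -2, -1, -1), (-1, 1, -1, 2)]"

text \<open>
  The reduced-rigid representatives in the order of the classification.
\<close>

definition rigid_representatives :: "ivec list list" where
  "rigid_representatives = [
    [(1, 2), (-2, -1), (1, -1)], [(1, 0), (1, 2), (-2, -1), (0, -1)],
    [(1, 2), (-1, 0), (-2, -1), (2, -1)], [(1, 1), (-1, 1), (-2, -1), (2, -1)],
    [(1, 1), (0, 1), (-1, 0), (-2, -1), (2, -1)], [(1, 2), (0, 1), (-2, -1), (-1, -1), (2, -1)],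
    [(1, 2), (-1, 1), (-2, -1), (0, -1), (2, -1)],
    [(1, 0), (1, 2), (-1, 1), (-2, -1), (-1, -1), (2, -1)]]"

lemma enumeration_matched: "sweep 3 matrices (table_of representatives) [] axes 0"
  by code_simp

lemma representatives_moments: "increasing (map moment representatives)"
  by code_simp

section \<open>The ordinary double point\<close>

lemma poly_mapping_add_induct [case_names zero single add]:
  fixes p :: "'a \<Rightarrow>\<^sub>0 'b::comm_monoid_add"
  assumes "P 0" "\<And>k c. P (Poly_Mapping.single k c)" "\<And>p q. P p \<Longrightarrow> P q \<Longrightarrow> P (p + q)"
  shows "P p"
proof -
  have "p = (\<Sum>k\<in>Poly_Mapping.keys p. Poly_Mapping.single k (Poly_Mapping.lookup p k))"
    by (intro poly_mapping_eqI)
      (simp add: lookup_sum lookup_single when_def sum.delta' in_keys_iff)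
  moreover have "P (\<Sum>k\<in>K. Poly_Mapping.single k (Poly_Mapping.lookup p k))" if "finite K" for K
    using that by induction (use assms in auto)
  ultimately show ?thesis by (metis finite_keys)
qed

text \<open>
  The linear extension of a map of exponents. It is defined for arbitrary maps, as it is applied
  to the additive map \<open>weight\<close> and to its section \<open>normal_exponent\<close>, which is not additive.
\<close>

definition push :: "('a \<Rightarrow> 'b) \<Rightarrow> ('a \<Rightarrow>\<^sub>0 complex) \<Rightarrow> ('b \<Rightarrow>\<^sub>0 complex)" where
  "push h p = (\<Sum>k\<in>Poly_Mapping.keys p. Poly_Mapping.single (h k) (Poly_Mapping.lookup p k))"

lemma push_superset:
  assumes "finite K" "Poly_Mapping.keys p \<subseteq> K"
  shows "push h p = (\<Sum>k\<in>K. Poly_Mapping.single (h k) (Poly_Mapping.lookup p k))"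
  unfolding push_def by (rule sum.mono_neutral_left) (use assms in \<open>auto simp: in_keys_iff\<close>)

lemma push_add: "push h (p + q) = push h p + push h q"
proof -
  let ?K = "Poly_Mapping.keys p \<union> Poly_Mapping.keys q"
  have "push h f = (\<Sum>k\<in>?K. Poly_Mapping.single (h k) (Poly_Mapping.lookup f k))"
    if "f = p \<or> f = q \<or> f = p + q" for f
    using that keys_add[of p q] by (intro push_superset) auto
  then show ?thesis by (simp add: lookup_add single_add sum.distrib)
qed

lemma push_zero [simp]: "push h 0 = 0"
  by (simp add: push_def)

lemma push_single [simp]: "push h (Poly_Mapping.single k c) = Poly_Mapping.single (h k) c"
  by (simp add: push_def)

lemma push_diff: "push h (p - q) = push h p - push h q"
  using push_add[of h "p - q" q] by simp

lemma push_push: "push h (push k p) = push (h \<circ> k) p"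
  by (induction p rule: poly_mapping_add_induct) (simp_all add: push_add)

lemma push_cong_id:
  assumes "\<And>k. k \<in> Poly_Mapping.keys p \<Longrightarrow> h k = k"
  shows "push h p = p"
proof -
  have "push h p = push id p" unfolding push_def using assms by simp
  also have "push id p = p" by (induction p rule: poly_mapping_add_induct) (simp_all add: push_add)
  finally show ?thesis .
qed

lemma keys_push: "Poly_Mapping.keys (push h p) \<subseteq> h ` Poly_Mapping.keys p"
proof -
  have "Poly_Mapping.keys (\<Sum>k\<in>K. Poly_Mapping.single (h k) (f k)) \<subseteq> h ` K" if "finite K" for K and f :: "_ \<Rightarrow> complex"
    using that
  proof induction
    case (insert x F)
    then show ?case
      using keys_add[of "Poly_Mapping.single (h x) (f x)" "\<Sum>k\<in>F. Poly_Mapping.single (h k) (f k)"]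
      by (auto split: if_splits)
  qed simp
  then show ?thesis unfolding push_def by simp
qed

lemma push_mult:
  fixes h :: "'a::monoid_add \<Rightarrow> 'b::monoid_add"
  assumes "\<And>a b. h (a + b) = h a + h b"
  shows "push h (p * q) = push h p * push h q"
proof (induction p rule: poly_mapping_add_induct)
  case (single k c)
  show ?case
    by (induction q rule: poly_mapping_add_induct)
      (simp_all add: push_add mult_single assms distrib_left)
qed (simp_all add: push_add distrib_right)

type_synonym exponent = "4 \<Rightarrow>\<^sub>0 nat"

abbreviation expo :: "exponent \<Rightarrow> 4 \<Rightarrow> nat" where
  "expo \<equiv> Poly_Mapping.lookup"

definition exponent_of :: "nat \<Rightarrow> nat \<Rightarrow> nat \<Rightarrow> nat \<Rightarrow> exponent" where
  "exponent_of i j k l = Poly_Mapping.single 0 i + Poly_Mapping.single 1 j + Poly_Mapping.single 2 k +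
     Poly_Mapping.single 3 l"

lemma UNIV_4_from_0: "(UNIV :: 4 set) = {0, 1, 2, 3}"
proof -
  have "(4::4) = 0" by simp
  then show ?thesis unfolding UNIV_4 by (simp only: insert_commute)
qed

lemma lookup_exponent_of [simp]:
  "expo (exponent_of i j k l) 0 = i" "expo (exponent_of i j k l) 1 = j" "expo (exponent_of i j k l) 2 = k" "expo (exponent_of i j k l) 3 = l"
  by (simp_all add: exponent_of_def lookup_add lookup_single when_def)

lemma exponent_of_lookup: "exponent_of (expo m 0) (expo m 1) (expo m 2) (expo m 3) = m"
proof (rule poly_mapping_eqI)
  fix i :: 4
  have "i \<in> {0, 1, 2, 3}" using UNIV_4_from_0 by blast
  then show "expo (exponent_of (expo m 0) (expo m 1) (expo m 2) (expo m 3)) i = expo m i" by auto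
qed

lemma exponent_of_add: "exponent_of i j k l + exponent_of i' j' k' l' = exponent_of (i + i') (j + j') (k + k') (l + l')"
  by (simp add: exponent_of_def single_add algebra_simps)

text \<open>
  The four variables go to the lattice points \<open>(1, 0, 0)\<close>, \<open>(-1, 0, 1)\<close>, \<open>(0, 1, 0)\<close>,
  \<open>(0, -1, 1)\<close>, the primitive generators of the dual cone. They satisfy one relation: the sum of
  the first two equals the sum of the last two.
\<close>

definition weight :: "exponent \<Rightarrow> (real^2) \<times> real" where
  "weight m = (vector [real (expo m 0) - real (expo m 1), real (expo m 2) - real (expo m 3)],
     real (expo m 1) + real (expo m 3))"

lemma weight_add: "weight (m + n) = weight m + weight n"
  by (simp add: weight_def lookup_add vec_eq_iff forall_2)

lemma weight_zero [simp]: "weight 0 = 0"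
  by (simp add: weight_def vec_eq_iff forall_2 zero_prod_def)

text \<open>
  A section of \<open>weight\<close> on its range: the exponent not divisible by the product of the last two
  variables.
\<close>

definition normal_exponent :: "(real^2) \<times> real \<Rightarrow> exponent" where
  "normal_exponent = (\<lambda>(v, t). let l = nat \<lfloor>- (v $ 2)\<rfloor>; j = nat \<lfloor>t\<rfloor> - l
     in exponent_of (nat \<lfloor>v $ 1 + real j\<rfloor>) j (nat \<lfloor>v $ 2\<rfloor>) l)"

lemma normal_exponent_weight:
  defines "n m \<equiv> min (expo m 2) (expo m 3)"
  shows "normal_exponent (weight m) =
    exponent_of (expo m 0 + n m) (expo m 1 + n m) (expo m 2 - n m) (expo m 3 - n m)"
proof -
  have f: "\<lfloor>real a - real b\<rfloor> = int a - int b" for a b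
    by (metis floor_of_int of_int_diff of_int_of_nat_eq)
  have l: "nat \<lfloor>- (real (expo m 2) - real (expo m 3))\<rfloor> = expo m 3 - n m"
    using f[of "expo m 3" "expo m 2"] by (simp add: n_def)
  have j: "nat \<lfloor>real (expo m 1) + real (expo m 3)\<rfloor> - (expo m 3 - n m) = expo m 1 + n m"
  proof -
    have "nat \<lfloor>real (expo m 1) + real (expo m 3)\<rfloor> = expo m 1 + expo m 3"
      by (metis floor_of_nat nat_int of_nat_add)
    then show ?thesis by (simp add: n_def)
  qed
  have i: "nat \<lfloor>real (expo m 0) - real (expo m 1) + real (expo m 1 + n m)\<rfloor> = expo m 0 + n m"
  proof -
    have "real (expo m 0) - real (expo m 1) + real (expo m 1 + n m) = real (expo m 0 + n m)" by simp
    then show ?thesis by (metis floor_of_nat nat_int)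
  qed
  have k: "nat \<lfloor>real (expo m 2) - real (expo m 3)\<rfloor> = expo m 2 - n m"
    using f[of "expo m 2" "expo m 3"] by (simp add: n_def)
  show ?thesis
    unfolding weight_def normal_exponent_def prod.case Let_def vector_2 l j i k ..
qed

lemma weight_normal_exponent: "weight (normal_exponent (weight m)) = weight m"
  unfolding normal_exponent_weight by (simp add: weight_def of_nat_diff min_def)

abbreviation "conifold_relation \<equiv> poly_var 0 * poly_var 1 - poly_var 2 * poly_var 3"

lemma poly_var_power:
  "(poly_var 0 * poly_var 1) ^ n = Poly_Mapping.single (exponent_of n n 0 0) 1"
  "(poly_var 2 * poly_var 3) ^ n = Poly_Mapping.single (exponent_of 0 0 n n) 1"
proof -
  have 0: "exponent_of 0 0 0 0 = 0" by (simp add: exponent_of_def)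
  have v: "poly_var 0 * poly_var 1 = Poly_Mapping.single (exponent_of 1 1 0 0) 1"
    "poly_var 2 * poly_var 3 = Poly_Mapping.single (exponent_of 0 0 1 1) 1"
    by (simp_all add: poly_var_def mult_single exponent_of_def)
  show "(poly_var 0 * poly_var 1) ^ n = Poly_Mapping.single (exponent_of n n 0 0) 1"
    by (induction n) (simp_all add: 0 v mult_single exponent_of_add)
  show "(poly_var 2 * poly_var 3) ^ n = Poly_Mapping.single (exponent_of 0 0 n n) 1"
    by (induction n) (simp_all add: 0 v mult_single exponent_of_add)
qed

text \<open>
  Splitting off \<open>(zw)^n\<close> for the largest possible \<open>n\<close> and replacing it by \<open>(xy)^n\<close> changes a
  monomial by a multiple of \<open>xy - zw\<close> and leads to the normal form of its weight.
\<close>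

lemma conifold_relation_dvd_single:
  "conifold_relation dvd Poly_Mapping.single m c - Poly_Mapping.single (normal_exponent (weight m)) c"
proof -
  define n where "n = min (expo m 2) (expo m 3)"
  let ?r = "exponent_of (expo m 0) (expo m 1) (expo m 2 - n) (expo m 3 - n)"
  have "m = ?r + exponent_of 0 0 n n" unfolding exponent_of_add n_def by (simp add: exponent_of_lookup)
  moreover have "normal_exponent (weight m) = ?r + exponent_of n n 0 0"
    unfolding exponent_of_add normal_exponent_weight n_def by simp
  ultimately have "Poly_Mapping.single m c - Poly_Mapping.single (normal_exponent (weight m)) c =
      - (Poly_Mapping.single ?r c * ((poly_var 0 * poly_var 1) ^ n - (poly_var 2 * poly_var 3) ^ n))"
    unfolding poly_var_power right_diff_distrib by (simp add: mult_single)
  moreover have "conifold_relation dvd (poly_var 0 * poly_var 1) ^ n - (poly_var 2 * poly_var 3) ^ n"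
    unfolding power_diff_sumr2 by simp
  ultimately show ?thesis by simp
qed

lemma conifold_relation_dvd_normalize: "conifold_relation dvd p - push normal_exponent (push weight p)"
proof (induction p rule: poly_mapping_add_induct)
  case (single m c)
  show ?case using conifold_relation_dvd_single by simp
next
  case (add p q)
  have "p + q - push normal_exponent (push weight (p + q)) =
      (p - push normal_exponent (push weight p)) + (q - push normal_exponent (push weight q))"
    by (simp add: push_add)
  then show ?case using add by (metis dvd_add)
qed simp

text \<open>
  Every polynomial is congruent modulo the relation to its normal form, which depends only on its
  image.
\<close>

lemma push_weight_eq_0_iff: "push weight p = 0 \<longleftrightarrow> conifold_relation dvd p"
proof
  assume "push weight p = 0"
  then show "conifold_relation dvd p" using conifold_relation_dvd_normalize[of p] by simp
next
  have "weight (exponent_of 1 1 0 0) = weight (exponent_of 0 0 1 1)" by (simp add: weight_def)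
  then have "push weight conifold_relation = 0"
    using poly_var_power[of 1] by (simp add: push_diff)
  then show "push weight p = 0" if "conifold_relation dvd p"
    using that by (auto simp: push_mult[OF weight_add])
qed

lemma unit_square_bounds:
  assumes "x \<in> unit_square"
  shows "0 \<le> x $ 1" "x $ 1 \<le> 1" "0 \<le> x $ 2" "x $ 2 \<le> 1"
proof -
  have "unit_square \<subseteq> cbox (vector [0, 0]) (vector [1, 1])"
    unfolding unit_square_def by (rule hull_minimal) (auto simp: mem_box_cart forall_2)
  then show "0 \<le> x $ 1" "x $ 1 \<le> 1" "0 \<le> x $ 2" "x $ 2 \<le> 1"
    using assms by (auto simp: mem_box_cart forall_2)
qed

text \<open>
  A lattice point of the dual cone is nonnegative at the four corners of the square, which gives
  four integer inequalities; they make the exponents in the representation below nonnegative.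
\<close>

lemma dual_cone_unit_square:
  "{m \<in> lattice3. \<forall>u\<in>toric_cone unit_square. 0 \<le> m \<bullet> u} = range weight"
proof (intro equalityI subsetI)
  fix w assume "w \<in> {m \<in> lattice3. \<forall>u\<in>toric_cone unit_square. 0 \<le> m \<bullet> u}"
  then have w: "w \<in> lattice3" and pos: "\<And>u. u \<in> toric_cone unit_square \<Longrightarrow> 0 \<le> w \<bullet> u" by auto
  obtain v t where vt: "w = (v, t)" by (cases w)
  have "v $ 1 \<in> \<int>" "v $ 2 \<in> \<int>" "t \<in> \<int>" using w by (auto simp: lattice3_def lattice2_def vt)
  then obtain a b c where abc: "v $ 1 = of_int a" "v $ 2 = of_int b" "t = of_int c"
    by (auto elim!: Ints_cases)
  have corner: "0 \<le> v \<bullet> x + t"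
    if "x \<in> {vector [0, 0], vector [1, 0], vector [1, 1], vector [0, 1]}" for x
  proof -
    have "(x, 1) \<in> toric_cone unit_square"
      unfolding toric_cone_def unit_square_def using that by (intro hull_inc) (auto intro: hull_inc)
    then show ?thesis using pos[of "(x, 1)"] by (simp add: vt)
  qed
  have "0 \<le> real_of_int c" "0 \<le> real_of_int (a + c)" "0 \<le> real_of_int (a + b + c)" "0 \<le> real_of_int (b + c)"
    using corner[of "vector [0, 0]"] corner[of "vector [1, 0]"] corner[of "vector [1, 1]"]
      corner[of "vector [0, 1]"] by (simp_all add: inner_vec_def sum_2 abc)
  then have c: "0 \<le> c" "0 \<le> a + c" "0 \<le> a + b + c" "0 \<le> b + c" by linarith+
  define l where "l = max 0 (- b)"
  have l: "0 \<le> l" "0 \<le> b + l" "0 \<le> c - l" "0 \<le> a + (c - l)" using c by (auto simp: l_def)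
  have "weight (exponent_of (nat (a + (c - l))) (nat (c - l)) (nat (b + l)) (nat l)) = w"
    using l by (simp add: weight_def vt vec_eq_iff forall_2 abc)
  then show "w \<in> range weight" by (metis rangeI)
next
  fix w assume "w \<in> range weight"
  then obtain m where w: "w = weight m" by auto
  have "w \<in> lattice3" by (simp add: w weight_def lattice3_def lattice2_def forall_2)
  moreover have "0 \<le> w \<bullet> u" if u: "u \<in> toric_cone unit_square" for u
  proof -
    obtain c x where c: "c \<ge> 0" "x \<in> unit_square" "u = (c *\<^sub>R x, c)"
      using u unfolding toric_cone_def cone_hull_expl by auto
    have "w \<bullet> u = c * (real (expo m 0) * x $ 1 + real (expo m 1) * (1 - x $ 1)
        + real (expo m 2) * x $ 2 + real (expo m 3) * (1 - x $ 2))"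
      by (simp add: w weight_def c(3) inner_vec_def sum_2 algebra_simps)
    also have "\<dots> \<ge> 0" using c(1) unit_square_bounds[OF c(2)] by (intro mult_nonneg_nonneg add_nonneg_nonneg) auto
    finally show ?thesis .
  qed
  ultimately show "w \<in> {m \<in> lattice3. \<forall>u\<in>toric_cone unit_square. 0 \<le> m \<bullet> u}" by simp
qed

theorem unit_square_ordinary_double_point: "cone_is_ordinary_double_point unit_square"
proof -
  have "range (push weight) = coordinate_ring unit_square"
    unfolding coordinate_ring_def dual_cone_unit_square
  proof (intro equalityI subsetI)
    fix f assume "f \<in> {f :: ((real^2) \<times> real) \<Rightarrow>\<^sub>0 complex. Poly_Mapping.keys f \<subseteq> range weight}"
    then have "push (weight \<circ> normal_exponent) f = f"
      by (intro push_cong_id) (auto simp: weight_normal_exponent)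
    then show "f \<in> range (push weight)" by (metis push_push rangeI)
  qed (use keys_push in fastforce)
  then show ?thesis
    unfolding cone_is_ordinary_double_point_def
    using push_weight_eq_0_iff push_mult[OF weight_add]
    by (intro exI[of _ "push weight"]) (simp add: push_add)
qed

section \<open>The classes of small polygons\<close>

definition small_vectors :: "ivec list" where
  "small_vectors = axes @ map uminus axes"

lemma small_vectors_odd:
  "list_all (\<lambda>a. list_all (\<lambda>b. even a \<and> even b \<or> mem (a, b) small_vectors) [-2, -1, 0, 1, 2])
    [-2, -1, 0, 1, 2]"
  by code_simp

lemma primitive_small_iff:
  "primitive_vec v \<and> (\<forall>j. -2 \<le> v $ j \<and> v $ j \<le> 2) \<longleftrightarrow> v \<in> vec_of ` set small_vectors"
proof
  assume v: "primitive_vec v \<and> (\<forall>j. -2 \<le> v $ j \<and> v $ j \<le> 2)"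
  then obtain a b where ab: "v = vec_of (a, b)" "coprime a b"
    by (auto simp: primitive_vec_def vec_of_def)
  have "-2 \<le> v $ 1" "v $ 1 \<le> 2" "-2 \<le> v $ 2" "v $ 2 \<le> 2" using v by auto
  then have "a \<in> set [-2, -1, 0, 1, 2]" "b \<in> set [-2, -1, 0, 1, 2]"
    unfolding ab(1) vec_of_component by auto
  then have "even a \<and> even b \<or> mem (a, b) small_vectors"
    using small_vectors_odd unfolding list_all_iff by blast
  moreover have "\<not> (even a \<and> even b)" using ab(2) by (metis coprime_common_divisor odd_one)
  ultimately have "(a, b) \<in> set small_vectors" unfolding mem_iff by blast
  then show "v \<in> vec_of ` set small_vectors" using ab(1) by blast
next
  assume "v \<in> vec_of ` set small_vectors"
  then obtain a b where ab: "(a, b) \<in> set small_vectors" "v = vec_of (a, b)" by auto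
  then have "coprime a b" "\<bar>a\<bar> \<le> 2" "\<bar>b\<bar> \<le> 2" by (auto simp: small_vectors_def axes_def)
  then show "primitive_vec v \<and> (\<forall>j. -2 \<le> v $ j \<and> v $ j \<le> 2)"
    unfolding primitive_vec_def ab(2) by (auto simp: vec_of_def forall_2)
qed

fun all_valid :: "ivec list list \<Rightarrow> bool" where
  "all_valid [] = True"
| "all_valid (R # Rs) = (ccw_closed R \<and> subset_list R small_vectors \<and> all_valid Rs)"

lemma all_valid_iff: "all_valid Rs \<longleftrightarrow> (\<forall>R\<in>set Rs. ccw_closed R \<and> set R \<subseteq> set small_vectors)"
  by (induction Rs) (auto simp: subset_list_iff)

lemma representatives_valid: "all_valid representatives"
  by code_simp

lemma representativeD:
  assumes "R \<in> set representatives"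
  shows "ccw_closed R" "set R \<subseteq> set small_vectors"
  using representatives_valid assms by (auto simp: all_valid_iff)

fun all_unimodular :: "imat list \<Rightarrow> bool" where
  "all_unimodular [] = True"
| "all_unimodular (M # Ms) = (if is_unimodular M then all_unimodular Ms else False)"

lemma all_unimodular_iff: "all_unimodular Ms \<longleftrightarrow> (\<forall>M\<in>set Ms. is_unimodular M)"
  by (induction Ms) auto

lemma matrices_unimodular: "all_unimodular matrices"
  by code_simp

lemma axes_distinct: "distinct (axes @ map uminus axes)"
  by (simp add: axes_def)

lemma zero_sum_subset_matched:
  assumes "S \<subseteq> set small_vectors" "\<Sum>S = 0" "3 \<le> card S"
  shows "\<exists>M R. is_unimodular M \<and> R \<in> set representatives \<and> iact M ` S = set R"
proof -
  obtain L where L: "L \<in> set (zero_sum_lists axes 0)" "set L = S"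
    using zero_sum_lists_complete[of S axes 0] assms axes_distinct by (auto simp: small_vectors_def)
  have "3 \<le> length L" using assms(3) L(2) card_length[of L] by simp
  then have "\<exists>M\<in>set matrices. \<exists>R\<in>table_entries (table_of representatives). iact M ` set ([] @ L) = set R"
    by (intro sweepD[OF enumeration_matched L(1)]) simp
  then show ?thesis
    using L(2) table_of_entries matrices_unimodular unfolding all_unimodular_iff append_Nil by blast
qed

text \<open>
  The edge vectors of the polygon form a zero-sum set of at least three small vectors, hence one
  of the enumerated sets.
\<close>

lemma small_polygon_represented:
  assumes Q: "lattice_polygon Q" and E: "edge_set Q \<subseteq> vec_of ` set small_vectors"
  shows "\<exists>R\<in>set representatives. (Q, polygon_of R) \<in> unimodular_equiv"
proof -
  have P: "polygon Q" using Q by (simp add: lattice_polygon_iff)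
  obtain S where S: "S \<subseteq> set small_vectors" "edge_set Q = vec_of ` S"
    using E by (auto simp: subset_image_iff)
  have inj: "inj_on vec_of S" using inj_vec_of by (rule inj_on_subset) simp
  have "vec_of (\<Sum>S) = (\<Sum>s\<in>S. vec_of s)"
    by (induction S rule: infinite_finite_induct) (simp_all add: vec_of_simps)
  also have "\<dots> = \<Sum>(edge_set Q)" unfolding S(2) by (simp add: sum.reindex[OF inj])
  finally have "\<Sum>S = 0" using sum_edge_set_eq_0[OF P] by simp
  moreover have "3 \<le> card S" using card_edge_set_ge_3[OF P] S(2) inj by (simp add: card_image)
  ultimately obtain M R where MR: "is_unimodular M" "R \<in> set representatives" "iact M ` S = set R"
    using zero_sum_subset_matched[OF S(1)] by blast
  have "edge_set (polygon_of R) = vec_of ` iact M ` S"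
    using MR representativeD(1) by (simp add: edge_set_polygon_of)
  also have "\<dots> = (*v) (mat_of M) ` edge_set Q"
    unfolding S(2) image_image by (simp add: mat_of_mult)
  finally have "(Q, polygon_of R) \<in> unimodular_equiv"
    unfolding unimodular_equiv_iff_edge_set[OF Q lattice_polygon_polygon_of[OF representativeD(1)[OF MR(2)]]]
    using unimodular_mat_of[OF MR(1)] by blast
  then show ?thesis using MR(2) by blast
qed

lemma in_tl_representatives: "R \<in> set (tl representatives) \<Longrightarrow> R \<in> set representatives"
  by (metis list.set_sel(2) tl_Nil)

lemma distinct_moments: "distinct (map moment representatives)"
  using increasing_sorted[OF representatives_moments] by (simp add: strict_sorted_iff)

lemma distinct_representatives: "distinct representatives"
  using distinct_moments by (simp add: distinct_map)

lemma representatives_inequivalent: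
  assumes "R \<in> set representatives" "R' \<in> set representatives"
    "(polygon_of R, polygon_of R') \<in> unimodular_equiv"
  shows "R = R'"
proof -
  note R = representativeD(1)[OF assms(1)] and R' = representativeD(1)[OF assms(2)]
  obtain M where M: "unimodular M" "edge_set (polygon_of R') = (*v) M ` edge_set (polygon_of R)"
    using assms(3) unimodular_equiv_iff_edge_set[OF lattice_polygon_polygon_of[OF R]
        lattice_polygon_polygon_of[OF R']] by blast
  have "real_of_int (moment R') = real_of_int (moment R)"
    unfolding moment_eq_set_moment[OF ccw_closed_distinct[OF R]]
      moment_eq_set_moment[OF ccw_closed_distinct[OF R']]
    using M set_moment_unimodular_image[OF M(1)]
    by (simp add: edge_set_polygon_of R R')
  then show ?thesis using distinct_moments assms by (auto simp: distinct_map dest: inj_onD)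
qed

abbreviation "triangle_edges \<equiv> [(1, 0), (-1, 1), (0, -1)] :: ivec list"

abbreviation "square_edges \<equiv> [(1, 0), (0, 1), (-1, 0), (0, -1)] :: ivec list"

lemma representatives_eq: "representatives = triangle_edges # square_edges # drop 2 representatives"
  by (simp add: representatives_def directions_def)

lemma standard_triangle_eq: "standard_triangle = polygon_of triangle_edges"
  unfolding standard_triangle_def polygon_of_def
  by (simp add: vec_of_def zero_prod_def insert_commute)

lemma unit_square_eq: "unit_square = polygon_of square_edges"
  unfolding unit_square_def polygon_of_def
  by (simp add: vec_of_def zero_prod_def insert_commute)

definition cls :: "(real^2) set \<Rightarrow> (real^2) set set" where
  "cls Q = unimodular_equiv `` {Q}"

lemma classes_eq_image: "classes \<Q> = cls ` \<Q>"
  by (auto simp: classes_def quotient_def cls_def)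

lemma cls_eq_iff: "cls P = cls Q \<longleftrightarrow> (P, Q) \<in> unimodular_equiv"
  unfolding cls_def using equiv_class_eq_iff[OF equiv_unimodular_equiv] by blast

lemma unit_edge_polygon_of:
  assumes "R \<in> set representatives"
  shows "unit_edge_polygon (polygon_of R)"
    "\<forall>v\<in>#edge_vectors (polygon_of R). \<forall>j. -2 \<le> v $ j \<and> v $ j \<le> 2"
proof -
  have "primitive_vec v \<and> (\<forall>j. -2 \<le> v $ j \<and> v $ j \<le> 2)" if "v \<in># edge_vectors (polygon_of R)" for v
    unfolding primitive_small_iff
    using that representativeD[OF assms] by (auto simp: edge_vectors_polygon_of)
  then show "unit_edge_polygon (polygon_of R)"
    "\<forall>v\<in>#edge_vectors (polygon_of R). \<forall>j. -2 \<le> v $ j \<and> v $ j \<le> 2"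
    using lattice_polygon_polygon_of[OF representativeD(1)[OF assms]]
    by (auto simp: unit_edge_polygon_def)
qed

text \<open>
  The first representative is the standard triangle, which is why the tail of the list occurs
  here.
\<close>

lemma representative_small:
  assumes "R \<in> set (tl representatives)"
  shows "polygon_of R \<in> small_polygons"
proof -
  have R: "R \<in> set representatives" using assms by (rule in_tl_representatives)
  have "R \<noteq> triangle_edges" "triangle_edges \<in> set representatives"
    using assms distinct_representatives representatives_eq
    by (metis distinct.simps(2) list.sel(3), metis list.set_intros(1))
  then have "(polygon_of R, standard_triangle) \<notin> unimodular_equiv"
    using R representatives_inequivalent unfolding standard_triangle_eq by blast
  then show ?thesis
    unfolding small_polygons_def
    using unit_edge_polygon_of[OF R] equiv_unimodular_equiv by (auto simp: equiv_def refl_on_def)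
qed

lemma small_polygon_cases:
  assumes "Q \<in> small_polygons"
  obtains R where "lattice_polygon Q" "R \<in> set (tl representatives)" "(Q, polygon_of R) \<in> unimodular_equiv"
proof -
  obtain Q' where Q': "unit_edge_polygon Q'" "(Q, Q') \<in> unimodular_equiv"
    "\<forall>v\<in>#edge_vectors Q'. \<forall>j. -2 \<le> v $ j \<and> v $ j \<le> 2"
    and Q: "unit_edge_polygon Q" "(Q, standard_triangle) \<notin> unimodular_equiv"
    using assms by (auto simp: small_polygons_def)
  have L: "lattice_polygon Q'" "lattice_polygon Q" using Q' Q by (auto simp: unit_edge_polygon_def)
  then have P: "polygon Q'" by (simp add: lattice_polygon_iff)
  have "edge_set Q' \<subseteq> vec_of ` set small_vectors"
  proof
    fix v assume "v \<in> edge_set Q'"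
    then have "v \<in># edge_vectors Q'"
      using finite_edge_set[OF P] by (simp add: edge_vectors_eq_mset_set[OF P])
    then show "v \<in> vec_of ` set small_vectors"
      using Q' unfolding primitive_small_iff[symmetric] by (simp add: unit_edge_polygon_def)
  qed
  then obtain R where R: "R \<in> set representatives" "(Q', polygon_of R) \<in> unimodular_equiv"
    using small_polygon_represented[OF L(1)] by blast
  then have e: "(Q, polygon_of R) \<in> unimodular_equiv" using Q'(2) unimodular_equiv_trans by blast
  then have "R \<noteq> triangle_edges" using Q(2) standard_triangle_eq by auto
  then have "R \<in> set (tl representatives)"
    using R(1) representatives_eq by (metis list.sel(3) set_ConsD)
  then show ?thesis using that L(2) e by blast
qed

text \<open>
  For a property invariant under equivalence, counting classes is counting representatives.
\<close>

lemma classes_small_eq: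
  assumes "\<And>P Q. lattice_polygon P \<Longrightarrow> (P, Q) \<in> unimodular_equiv \<Longrightarrow> T P \<longleftrightarrow> T Q"
  shows "classes {Q \<in> small_polygons. T Q} =
    (cls \<circ> polygon_of) ` {R \<in> set (tl representatives). T (polygon_of R)}"
proof (intro equalityI subsetI)
  fix X assume "X \<in> classes {Q \<in> small_polygons. T Q}"
  then obtain Q where Q: "X = cls Q" "Q \<in> small_polygons" "T Q" by (auto simp: classes_eq_image)
  obtain R where R: "lattice_polygon Q" "R \<in> set (tl representatives)" "(Q, polygon_of R) \<in> unimodular_equiv"
    using small_polygon_cases[OF Q(2)] by blast
  then have "T (polygon_of R)" "X = cls (polygon_of R)" using assms Q by (auto simp: cls_eq_iff)
  then show "X \<in> (cls \<circ> polygon_of) ` {R \<in> set (tl representatives). T (polygon_of R)}" using R(2) by auto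
qed (auto simp: classes_eq_image representative_small)

lemma inj_on_cls_polygon_of: "inj_on (cls \<circ> polygon_of) (set representatives)"
  by (auto intro!: inj_onI representatives_inequivalent simp: cls_eq_iff)

fun keep :: "bool \<Rightarrow> ivec list \<Rightarrow> ivec list list \<Rightarrow> ivec list list" where
  "keep True x xs = x # xs"
| "keep False x xs = xs"

lemma keep_eq_if: "keep b x xs = (if b then x # xs else xs)"
  by simp

fun sift :: "(ivec list \<Rightarrow> bool) \<Rightarrow> ivec list list \<Rightarrow> ivec list list" where
  "sift p [] = []"
| "sift p (x # xs) = keep (p x) x (sift p xs)"

lemma sift_eq: "sift p xs = filter p xs"
  by (induction xs) (simp_all add: keep_eq_if)

lemma card_classes_small:
  assumes "\<And>P Q. lattice_polygon P \<Longrightarrow> (P, Q) \<in> unimodular_equiv \<Longrightarrow> T P \<longleftrightarrow> T Q"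
    and "\<And>R. R \<in> set (tl representatives) \<Longrightarrow> T (polygon_of R) \<longleftrightarrow> t R"
  shows "card (classes {Q \<in> small_polygons. T Q}) = length (sift t (tl representatives))"
proof -
  have eq: "{R \<in> set (tl representatives). T (polygon_of R)} = set (sift t (tl representatives))"
    using assms(2) by (auto simp: sift_eq)
  have "set (sift t (tl representatives)) \<subseteq> set representatives"
    by (auto simp: sift_eq intro: in_tl_representatives)
  note inj = inj_on_subset[OF inj_on_cls_polygon_of this]
  have "classes {Q \<in> small_polygons. T Q} = (cls \<circ> polygon_of) ` set (sift t (tl representatives))"
    unfolding eq[symmetric] by (rule classes_small_eq) (rule assms(1))
  then have "card (classes {Q \<in> small_polygons. T Q}) = card (set (sift t (tl representatives)))"
    by (simp only: card_image[OF inj])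
  also have "\<dots> = length (sift t (tl representatives))"
    unfolding sift_eq by (rule distinct_card) (simp add: distinct_representatives distinct_tl)
  finally show ?thesis .
qed

text \<open>
  Edge lists of representatives sum to zero and have at least two members, as the decision
  procedures require.
\<close>

lemma types_polygon_of:
  assumes "R \<in> set representatives"
  shows "reduced_rigid (polygon_of R) \<longleftrightarrow> is_rigid R"
    "smoothable (polygon_of R) \<longleftrightarrow> is_smoothable R"
    "deformable_non_smoothable (polygon_of R) \<longleftrightarrow> \<not> is_rigid R \<and> \<not> is_smoothable R"
proof -
  note R = representativeD(1)[OF assms]
  have "sum_list R = 0" "R \<noteq> []" using R by (auto simp: ccw_closed_def)
  note rigid = is_rigid_iff[OF this]
  show "reduced_rigid (polygon_of R) \<longleftrightarrow> is_rigid R"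
    "smoothable (polygon_of R) \<longleftrightarrow> is_smoothable R"
    "deformable_non_smoothable (polygon_of R) \<longleftrightarrow> \<not> is_rigid R \<and> \<not> is_smoothable R"
    unfolding reduced_rigid_def smoothable_def deformable_non_smoothable_def
      edge_vectors_polygon_of[OF R] rigid is_smoothable.simps has_block_partition_iff by simp_all
qed

fun is_deformable :: "ivec list \<Rightarrow> bool" where
  "is_deformable R = (if is_smoothable R then False else if is_rigid R then False else True)"

fun is_smoothable_not_square :: "ivec list \<Rightarrow> bool" where
  "is_smoothable_not_square R = (if R = square_edges then False else is_smoothable R)"

lemma length_representatives: "length (tl representatives) = 217"
  by (simp add: representatives_def)

lemma sift_rigid:
  "sift is_rigid (tl representatives) = map ((!) rigid_representatives) [1, 0, 3, 4, 2, 6, 5, 7]"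
  by code_simp

lemma set_sift_rigid: "set (sift is_rigid (tl representatives)) = set rigid_representatives"
  unfolding sift_rigid rigid_representatives_def by auto

lemma length_sift_deformable: "length (sift is_deformable (tl representatives)) = 79"
  by code_simp

lemma length_sift_smooth: "length (sift is_smoothable_not_square (tl representatives)) = 129"
  by code_simp

fun all_contain_point :: "ivec list list \<Rightarrow> bool" where
  "all_contain_point [] = True"
| "all_contain_point (R # Rs) =
    ((left_of_all (1, 1) 0 R \<or> left_of_all (0, 1) 0 R) \<and> all_contain_point Rs)"

lemma all_contain_pointD: "all_contain_point Rs \<Longrightarrow> R \<in> set Rs \<Longrightarrow> \<exists>x. left_of_all x 0 R"
  by (induction Rs) auto

text \<open>
  Apart from the standard triangle and the unit square, every representative contains \<open>(1, 1)\<close> or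
  \<open>(0, 1)\<close> in its interior. An interior lattice point is not a vertex, so none of these polygons
  is terminal.
\<close>

lemma representatives_contain_point: "all_contain_point (drop 2 representatives)"
  by code_simp

text \<open>
  The lattice points of the unit square are its four corners, and these are all extreme, because
  the square has four edges and hence four vertices.
\<close>

lemma unit_square_terminal: "terminal_cone unit_square"
  unfolding terminal_cone_iff
proof
  let ?C = "{vector [0, 0], vector [1, 0], vector [1, 1], vector [0, 1]} :: (real^2) set"
  have sq: "square_edges \<in> set representatives" using representatives_eq by (metis list.set_intros)
  note R = representativeD(1)[OF sq]
  have "card {v. v extreme_point_of unit_square} = card (vec_of ` set square_edges)"
    using card_edge_set[OF polygon_polygon_of[OF R]] edge_set_polygon_of[OF R]
    by (simp add: unit_square_eq)
  also have "\<dots> = 4" by (subst card_image) (auto intro: inj_on_subset[OF inj_vec_of])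
  finally have "card {v. v extreme_point_of unit_square} = 4" .
  moreover have "{v. v extreme_point_of unit_square} \<subseteq> ?C"
    unfolding unit_square_def using extreme_point_of_convex_hull by blast
  moreover have "card ?C \<le> 4" by (simp add: card_insert_le_m1)
  ultimately have ext: "{v. v extreme_point_of unit_square} = ?C"
    by (intro card_seteq) auto
  fix x assume x: "x \<in> unit_square \<inter> lattice2"
  then obtain a b where ab: "x = vec_of (a, b)" by (auto simp: lattice2_eq_range)
  have "a = 0 \<or> a = 1" "b = 0 \<or> b = 1"
    using unit_square_bounds[of x] x unfolding ab by auto
  then have "x \<in> ?C" unfolding ab vec_of_def by auto
  then show "x extreme_point_of unit_square" using ext by auto
qed

lemma terminal_small_iff:
  assumes "Q \<in> small_polygons"
  shows "terminal_cone Q \<longleftrightarrow> (Q, unit_square) \<in> unimodular_equiv"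
proof
  assume "(Q, unit_square) \<in> unimodular_equiv"
  then show "terminal_cone Q" using unit_square_terminal terminal_cone_cong by blast
next
  assume t: "terminal_cone Q"
  obtain R where R: "R \<in> set (tl representatives)" "(Q, polygon_of R) \<in> unimodular_equiv"
    using small_polygon_cases[OF assms] by blast
  have "R = square_edges"
  proof (rule ccontr)
    assume "R \<noteq> square_edges"
    then have "R \<in> set (drop 2 representatives)"
      using R(1) representatives_eq by (metis list.sel(3) set_ConsD)
    then obtain x where x: "left_of_all x 0 R"
      using all_contain_pointD[OF representatives_contain_point] by blast
    have "R \<in> set representatives" using R(1) by (rule in_tl_representatives)
    then have "vec_of x \<in> interior (polygon_of R)"
      using x representativeD(1) interior_polygon_of by blast
    then have "\<not> terminal_cone (polygon_of R)"
      by (rule interior_lattice_point_not_terminal) (simp add: lattice2_eq_range)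
    then show False using t terminal_cone_cong[OF R(2)] by simp
  qed
  then show "(Q, unit_square) \<in> unimodular_equiv" using R(2) by (simp add: unit_square_eq)
qed

fun points_inside :: "ivec list \<Rightarrow> ivec list \<Rightarrow> ivec list" where
  "points_inside A [] = []"
| "points_inside A (x # xs) =
    (if left_of_all x 0 A then x # points_inside A xs else points_inside A xs)"

lemma points_inside_eq: "points_inside A xs = filter (\<lambda>x. left_of_all x 0 A) xs"
  by (induction xs) auto

text \<open>
  The vertices of the eight rigid polygons have coordinates of absolute value at most 3.
\<close>

definition interior_count :: "ivec list \<Rightarrow> nat" where
  "interior_count A = length (points_inside A (grid 3))"

lemma interior_counts: "map interior_count rigid_representatives = [1, 1, 2, 2, 2, 3, 4, 5]"
  by code_simp

lemma rigid_representatives_subset: "set rigid_representatives \<subseteq> set (tl representatives)"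
  unfolding set_sift_rigid[symmetric] by (simp add: sift_eq)

lemma rigid_representatives_box:
  "A \<in> set rigid_representatives \<Longrightarrow> \<forall>(a, b)\<in>set (partial_sums 0 A). \<bar>a\<bar> \<le> 3 \<and> \<bar>b\<bar> \<le> 3"
  unfolding rigid_representatives_def by (auto simp: zero_prod_def)

lemma polygon_data_rigid:
  assumes "A \<in> set rigid_representatives"
  shows "polygon_data (polygon_of A) = (length A, interior_count A, mset (map vec_of A))"
proof -
  have A: "ccw_closed A"
    using assms rigid_representatives_subset by (intro representativeD(1) in_tl_representatives) auto
  show ?thesis
    unfolding polygon_data_def interior_count_def points_inside_eq
    using num_interior_polygon_of[OF A rigid_representatives_box[OF assms]]
    by (simp add: num_edges_polygon_of[OF A] edge_vectors_polygon_of[OF A])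
qed

lemma polygon_data_rigid_representatives:
  "map polygon_data (map polygon_of rigid_representatives) =
     [(3, 1, {#vector [-2, -1], vector [1, -1], vector [1, 2]#}),
      (4, 1, {#vector [-2, -1], vector [0, -1], vector [1, 0], vector [1, 2]#}),
      (4, 2, {#vector [-2, -1], vector [2, -1], vector [1, 2], vector [-1, 0]#}),
      (4, 2, {#vector [-2, -1], vector [2, -1], vector [1, 1], vector [-1, 1]#}),
      (5, 2, {#vector [-2, -1], vector [2, -1], vector [1, 1], vector [0, 1],
               vector [-1, 0]#}),
      (5, 3, {#vector [-2, -1], vector [-1, -1], vector [2, -1], vector [1, 2],
               vector [0, 1]#}),
      (5, 4, {#vector [-2, -1], vector [0, -1], vector [2, -1], vector [1, 2],
               vector [-1, 1]#}),
      (6, 5, {#vector [-2, -1], vector [-1, -1], vector [2, -1], vector [1, 0],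
               vector [1, 2], vector [-1, 1]#})]"
proof -
  have "map polygon_data (map polygon_of rigid_representatives) =
      map (\<lambda>A. (length A, interior_count A, mset (map vec_of A))) rigid_representatives"
    by (simp add: polygon_data_rigid)
  then show ?thesis
    using interior_counts unfolding rigid_representatives_def
    by (simp add: vec_of_def add_mset_commute)
qed

lemma square_in_tl: "square_edges \<in> set (tl representatives)"
  using representatives_eq by (metis list.sel(3) list.set_intros(1))

lemma unit_square_small: "unit_square \<in> small_polygons"
  unfolding unit_square_eq by (rule representative_small[OF square_in_tl])

lemma card_classes_types:
  "card (classes small_polygons) = 217"
  "card (classes {Q \<in> small_polygons. reduced_rigid Q}) = 8"
  "card (classes {Q \<in> small_polygons. deformable_non_smoothable Q}) = 79"
  "card (classes {Q \<in> small_polygons. smoothable Q \<and> (Q, unit_square) \<notin> unimodular_equiv}) = 129"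
proof -
  show "card (classes small_polygons) = 217"
    using card_classes_small[of "\<lambda>_. True" "\<lambda>_. True"] length_representatives by (simp add: sift_eq)
  have "card (classes {Q \<in> small_polygons. reduced_rigid Q}) = length (sift is_rigid (tl representatives))"
    by (rule card_classes_small) (use types_cong types_polygon_of in_tl_representatives in blast)+
  then show "card (classes {Q \<in> small_polygons. reduced_rigid Q}) = 8"
    by (simp add: sift_rigid)
  have "card (classes {Q \<in> small_polygons. deformable_non_smoothable Q}) =
      length (sift is_deformable (tl representatives))"
    by (rule card_classes_small)
      (use types_cong types_polygon_of in_tl_representatives in \<open>auto simp del: is_smoothable.simps\<close>)
  then show "card (classes {Q \<in> small_polygons. deformable_non_smoothable Q}) = 79"
    by (simp add: length_sift_deformable)
  have "(P, unit_square) \<notin> unimodular_equiv \<longleftrightarrow> (Q, unit_square) \<notin> unimodular_equiv"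
    if "(P, Q) \<in> unimodular_equiv" for P Q
    using that unimodular_equiv_trans unimodular_equiv_sym by blast
  moreover have "(polygon_of R, unit_square) \<in> unimodular_equiv \<longleftrightarrow> R = square_edges"
    if "R \<in> set (tl representatives)" for R
    using that representatives_inequivalent[of R square_edges] in_tl_representatives square_in_tl
      equiv_unimodular_equiv unfolding unit_square_eq by (auto simp: equiv_def refl_on_def)
  ultimately have "card (classes {Q \<in> small_polygons. smoothable Q \<and> (Q, unit_square) \<notin> unimodular_equiv}) =
      length (sift is_smoothable_not_square (tl representatives))"
    by (intro card_classes_small)
      (use types_cong(3) types_polygon_of(2) in_tl_representatives in \<open>auto simp del: is_smoothable.simps\<close>)
  then show "card (classes {Q \<in> small_polygons. smoothable Q \<and> (Q, unit_square) \<notin> unimodular_equiv}) = 129"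
    by (simp add: length_sift_smooth)
qed

lemma classes_small_partition:
  "classes small_polygons =
     classes {unit_square} \<union>
     classes {Q \<in> small_polygons. reduced_rigid Q} \<union>
     classes {Q \<in> small_polygons. deformable_non_smoothable Q} \<union>
     classes {Q \<in> small_polygons. smoothable Q \<and> (Q, unit_square) \<notin> unimodular_equiv}"
    (is "_ = ?U")
proof
  show "classes small_polygons \<subseteq> ?U"
  proof
    fix X assume "X \<in> classes small_polygons"
    then obtain Q where Q: "X = cls Q" "Q \<in> small_polygons" by (auto simp: classes_eq_image)
    consider "(Q, unit_square) \<in> unimodular_equiv" | "reduced_rigid Q" | "deformable_non_smoothable Q"
      | "smoothable Q" "(Q, unit_square) \<notin> unimodular_equiv"
      unfolding reduced_rigid_def deformable_non_smoothable_def smoothable_def by blast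
    then show "X \<in> ?U"
    proof cases
      case 1
      then have "X = cls unit_square" using Q(1) by (simp add: cls_eq_iff)
      then show ?thesis by (auto simp: classes_eq_image)
    qed (use Q in \<open>auto simp: classes_eq_image\<close>)
  qed
  show "?U \<subseteq> classes small_polygons"
    using unit_square_small by (auto simp: classes_eq_image)
qed

lemma smoothable_unit_square: "smoothable unit_square"
proof -
  have "is_smoothable square_edges" by code_simp
  then show ?thesis
    using types_polygon_of(2)[OF in_tl_representatives[OF square_in_tl]] by (simp only: unit_square_eq)
qed

lemma rigid_representatives_classes:
  "set (map polygon_of rigid_representatives) \<subseteq> {Q \<in> small_polygons. reduced_rigid Q}"
  "classes {Q \<in> small_polygons. reduced_rigid Q} = classes (set (map polygon_of rigid_representatives))"
proof -
  have *: "{R \<in> set (tl representatives). reduced_rigid (polygon_of R)} = set rigid_representatives"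
    unfolding set_sift_rigid[symmetric] sift_eq
    using types_polygon_of(1) in_tl_representatives by auto
  show "set (map polygon_of rigid_representatives) \<subseteq> {Q \<in> small_polygons. reduced_rigid Q}"
    using * representative_small by auto
  have "classes {Q \<in> small_polygons. reduced_rigid Q} = (cls \<circ> polygon_of) ` set rigid_representatives"
    unfolding *[symmetric] by (rule classes_small_eq) (rule types_cong(1))
  then show "classes {Q \<in> small_polygons. reduced_rigid Q} = classes (set (map polygon_of rigid_representatives))"
    by (simp add: classes_eq_image image_comp)
qed

theorem proposition2p5:
  shows
    "card (classes small_polygons) = 217 \<and>
     classes small_polygons =
       classes {unit_square} \<union>
       classes {Q \<in> small_polygons. reduced_rigid Q} \<union>
       classes {Q \<in> small_polygons. deformable_non_smoothable Q} \<union>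
       classes {Q \<in> small_polygons. smoothable Q \<and> (Q, unit_square) \<notin> unimodular_equiv} \<and>
     unit_square \<in> small_polygons \<and>
     cone_is_ordinary_double_point unit_square \<and>
     smoothable unit_square \<and>
     (\<forall>Q\<in>small_polygons. terminal_cone Q \<longleftrightarrow> (Q, unit_square) \<in> unimodular_equiv) \<and>
     card (classes {Q \<in> small_polygons. reduced_rigid Q}) = 8 \<and>
     card (classes {Q \<in> small_polygons. deformable_non_smoothable Q}) = 79 \<and>
     card (classes {Q \<in> small_polygons.
             smoothable Q \<and> (Q, unit_square) \<notin> unimodular_equiv}) = 129 \<and>
     (\<exists>Qs. set Qs \<subseteq> {Q \<in> small_polygons. reduced_rigid Q} \<and>
           classes {Q \<in> small_polygons. reduced_rigid Q} = classes (set Qs) \<and>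
           map polygon_data Qs =
             [(3, 1, {#vector [-2, -1], vector [1, -1], vector [1, 2]#}),
              (4, 1, {#vector [-2, -1], vector [0, -1], vector [1, 0], vector [1, 2]#}),
              (4, 2, {#vector [-2, -1], vector [2, -1], vector [1, 2], vector [-1, 0]#}),
              (4, 2, {#vector [-2, -1], vector [2, -1], vector [1, 1], vector [-1, 1]#}),
              (5, 2, {#vector [-2, -1], vector [2, -1], vector [1, 1], vector [0, 1],
                       vector [-1, 0]#}),
              (5, 3, {#vector [-2, -1], vector [-1, -1], vector [2, -1], vector [1, 2],
                       vector [0, 1]#}),
              (5, 4, {#vector [-2, -1], vector [0, -1], vector [2, -1], vector [1, 2],
                       vector [-1, 1]#}),
              (6, 5, {#vector [-2, -1], vector [-1, -1], vector [2, -1], vector [1, 0],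
                       vector [1, 2], vector [-1, 1]#})])"
  by (intro conjI ballI exI[of _ "map polygon_of rigid_representatives"] card_classes_types
      classes_small_partition unit_square_small unit_square_ordinary_double_point
      smoothable_unit_square terminal_small_iff rigid_representatives_classes polygon_data_rigid_representatives)

end
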